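(* Let $p$ be a probability density on $\mathbb{R}^d$, let $f:\mathbb{R}_+\to\mathbb{R}$, and let $(a,b)\in\mathbb{R}^2$. Let $k\in\mathbb{N}$ be fixed with $k>-a$, and suppose that the estimator function $\phi_k$ of $f$ with parameter $k$ exists and satisfies $|\phi_k(u)|\le C\psi_{a,b}(u)$ for all $u>0$ and some constant $C$. Suppose that: (i) there exists $0<C_p<\infty$ with $p(x)\le C_p$ for almost every $x$; (ii) there exists $c_p>0$ with $p(x)\ge c_p$ for $x\in\operatorname{supp}(p)$; (iii) $\operatorname{supp}(p)$ is bounded; (iv) there exists $r>0$ such that $\displaystyle\inf_{x\in\operatorname{supp}(p)}\inf_{r'\in(0,r]}\frac{\mathrm{Leb}(B(x,r')\cap\operatorname{supp}(p))}{\mathrm{Leb}(B(x,r'))}>0$; (v) $p$ is $\sigma_p$-Hölder continuous over the interior of $\operatorname{supp}(p)$ for some $\sigma_p\in(0,2]$; (vi) the boundary of $\operatorname{supp}(p)$ has finite $(d-1)$-dimensional Hausdorff measure. Then, as $m\to\infty$, $$\bigl|\mathbb{E}[\hat T_f^{(k)}(X_1,\ldots,X_m)]-T_f(p)\bigr|=\tilde O\bigl(m^{-\lambda(\sigma_p,a,k)}\bigr),$$ where $$\lambda(\sigma,a,k)=\begin{cases}\frac1d(\sigma\wedge1)\frac{k+a}{k-1}&\text{if }a\le-\frac{\sigma}{d}-1,\\[2pt]\frac1d\bigl(\sigma\wedge\frac{k+a}{k-1}\bigr)&\text{if }-\frac{\sigma}{d}-1<a\le-1,\\[2pt]\frac1d(\sigma\wedge1)&\text{if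 }a>-1.\end{cases}$$
   Context: $\mathrm{Leb}$ is Lebesgue measure on $\mathbb{R}^d$ with Euclidean norm $\|\cdot\|$; $B(x,r)=\{y:\|x-y\|<r\}$. $P$ is the probability measure with density $p$, $\operatorname{supp}(p)=\{x:P(B(x,r))>0\ \forall r>0\}$, and $X_1,X_2,\ldots$ are i.i.d. with density $p$. For a finite set $A$, $r_k(x|A)$ is the distance from $x$ to its $k$-th nearest neighbor in $A$ (ties broken arbitrarily). $s\wedge t=\min\{s,t\}$. $F(m)=\tilde O(G(m))$ means $F(m)=O(G(m)(\ln G(m))^c)$ for some $c\in\mathbb{R}$ (i.e. $O$ up to polylogarithmic factors). Functional: $T_f(p)=\int f(p(x))p(x)\,dx$. Estimator function: $\phi_k(u)=\frac{\Gamma(k)}{u^{k-1}}\mathcal{L}^{-1}\{f(p)/p^k\}(u)$, where $\mathcal{L}^{-1}$ is the inverse of the one-sided Laplace transform; that is, $\phi_k:(0,\infty)\to\mathbb{R}$ is a function with $\int_0^\infty u^{k-1}\phi_k(u)e^{-su}\,du=\Gamma(k)f(s)/s^k$ for all $s>0$. Estimator: for $m\ge k+1$, $U_{km}(X_i)=(m-1)\,\mathrm{Leb}\bigl(B(X_i,r_k(X_i|\{X_j:j\ne i\}))\bigr)$ and $\hat T_f^{(k)}(X_1,\ldots,X_m)=\frac1m\sum_{i=1}^m\phi_k(U_{km}(X_i))$. Polynomial envelope: $\psi_{a,b}(u)=u^a$ for $0<u\le1$ and $\psi_{a,b}(u)=u^b$ for $u>1$. Hölder continuity: for $\sigma>0$,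 $g:\mathbb{R}^d\to\mathbb{R}$ is $\sigma$-Hölder continuous over an open set $\Omega$ if $g$ is continuously differentiable over $\Omega$ up to order $\kappa=\lceil\sigma\rceil-1$ and $\sup_{|\mathbf{r}|=\kappa}\sup_{y\ne z\in\Omega}\frac{|\partial^{\mathbf{r}}g(y)-\partial^{\mathbf{r}}g(z)|}{\|y-z\|^{\sigma-\kappa}}<\infty$, where $\mathbf{r}$ ranges over multi-indices in $\mathbb{Z}_+^d$. *)

theory Defs
  imports "HOL-Probability.Probability" "HOL-Library.Landau_Symbols"
begin

definition prob_density :: "('a::euclidean_space \<Rightarrow> real) \<Rightarrow> bool" where
  "prob_density p \<longleftrightarrow>
     p \<in> borel_measurable borel \<and> (\<forall>x. 0 \<le> p x) \<and> (\<integral>\<^sup>+ x. ennreal (p x) \<partial>lborel) = 1"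

definition supp :: "('a::euclidean_space \<Rightarrow> real) \<Rightarrow> 'a set" where
  "supp p = {x. \<forall>r>0. measure (density lborel (\<lambda>y. ennreal (p y))) (ball x r) > 0}"

definition T_functional :: "(real \<Rightarrow> real) \<Rightarrow> ('a::euclidean_space \<Rightarrow> real) \<Rightarrow> real" where
  "T_functional f p = (\<integral>x. f (p x) * p x \<partial>lborel)"

text \<open>\<open>\<phi>\<close> is an inverse one-sided Laplace transform of \<open>s \<mapsto> f s / s^k\<close>, multiplied by
  \<open>\<Gamma>(k) / u^(k-1)\<close>. Only the values on \<open>(0,\<infinity>)\<close> are constrained, and
  \<open>set_integrable lborel\<close> makes \<open>\<phi>\<close> Borel measurable there.\<close>

definition estimator_function :: "(real \<Rightarrow> real) \<Rightarrow> nat \<Rightarrow> (real \<Rightarrow> real) \<Rightarrow> bool" where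
  "estimator_function f k \<phi> \<longleftrightarrow>
     (\<forall>s>0. set_integrable lborel {0<..} (\<lambda>u. u ^ (k - 1) * \<phi> u * exp (- s * u)) \<and>
            (LBINT u:{0<..}. u ^ (k - 1) * \<phi> u * exp (- s * u)) = Gamma (real k) * f s / s ^ k)"

definition poly_envelope :: "real \<Rightarrow> real \<Rightarrow> real \<Rightarrow> real" where
  "poly_envelope a b u = (if u \<le> 1 then u powr a else u powr b)"

text \<open>Sorting the multiset of distances counts equidistant neighbors separately.
  The value is meaningful for finite \<open>A\<close> and \<open>1 \<le> k \<le> card A\<close>.\<close>

definition nn_dist :: "nat \<Rightarrow> 'a::euclidean_space \<Rightarrow> 'a set \<Rightarrow> real" where
  "nn_dist k x A = sorted_list_of_multiset (image_mset (dist x) (mset_set A)) ! (k - 1)"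

definition knn_volume :: "nat \<Rightarrow> nat \<Rightarrow> (nat \<Rightarrow> 'a::euclidean_space) \<Rightarrow> nat \<Rightarrow> real" where
  "knn_volume k m x i =
     (real m - 1) * measure lborel (ball (x i) (nn_dist k (x i) (x ` ({1..m} - {i}))))"

definition knn_estimator ::
  "(real \<Rightarrow> real) \<Rightarrow> nat \<Rightarrow> nat \<Rightarrow> (nat \<Rightarrow> 'a::euclidean_space) \<Rightarrow> real" where
  "knn_estimator \<phi> k m x = (1 / real m) * (\<Sum>i=1..m. \<phi> (knn_volume k m x i))"

text \<open>A multi-index \<open>r\<close> is represented by a list of coordinate directions in which each basis
  vector \<open>e\<close> occurs \<open>r e\<close> times, so \<open>\<bar>r\<bar>\<close> is the length of the list. For functions that are
  continuously differentiable up to the given order, the order of the entries is immaterial.\<close>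

primrec partial_deriv :: "'a::euclidean_space list \<Rightarrow> ('a \<Rightarrow> real) \<Rightarrow> 'a \<Rightarrow> real" where
  "partial_deriv [] g = g"
| "partial_deriv (e # es) g = (\<lambda>x. deriv (\<lambda>t. partial_deriv es g (x + t *\<^sub>R e)) 0)"

definition cont_differentiable_upto :: "nat \<Rightarrow> ('a::euclidean_space \<Rightarrow> real) \<Rightarrow> 'a set \<Rightarrow> bool" where
  "cont_differentiable_upto n g \<Omega> \<longleftrightarrow>
     (\<forall>es. set es \<subseteq> Basis \<and> length es \<le> n \<longrightarrow> continuous_on \<Omega> (partial_deriv es g)) \<and>
     (\<forall>es. set es \<subseteq> Basis \<and> length es < n \<longrightarrow>
        (\<forall>e\<in>Basis. \<forall>x\<in>\<Omega>. (\<lambda>t::real. partial_deriv es g (x + t *\<^sub>R e)) differentiable (at 0)))"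

definition hoelder_continuous :: "real \<Rightarrow> ('a::euclidean_space \<Rightarrow> real) \<Rightarrow> 'a set \<Rightarrow> bool" where
  "hoelder_continuous \<sigma> g \<Omega> \<longleftrightarrow>
     (let \<kappa> = nat (\<lceil>\<sigma>\<rceil> - 1) in
        cont_differentiable_upto \<kappa> g \<Omega> \<and>
        bdd_above {\<bar>partial_deriv es g y - partial_deriv es g z\<bar> / norm (y - z) powr (\<sigma> - real \<kappa>)
          | es y z. set es \<subseteq> Basis \<and> length es = \<kappa> \<and> y \<in> \<Omega> \<and> z \<in> \<Omega> \<and> y \<noteq> z})"

text \<open>The \<open>n\<close>-dimensional Hausdorff (outer) measure, without the normalizing constant that some
  authors include. The empty set contributes 0 to a cover, also for \<open>n = 0\<close>; a nonempty set then
  contributes 1 since \<open>0 ^ 0 = 1\<close>. Boundedness is demanded because \<open>diameter\<close> is meaningless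
  for unbounded sets.\<close>

definition hausdorff_measure :: "nat \<Rightarrow> 'a::euclidean_space set \<Rightarrow> ennreal" where
  "hausdorff_measure n A =
     (SUP \<delta>\<in>{(0::real)<..}.
        INF U\<in>{U :: nat \<Rightarrow> 'a set. A \<subseteq> (\<Union>i. U i) \<and> (\<forall>i. bounded (U i) \<and> diameter (U i) \<le> \<delta>)}.
          \<Sum>i. (if U i = {} then 0 else ennreal (diameter (U i) ^ n)))"

text \<open>The absolute value makes the real power of the logarithm meaningful also when \<open>G m < 1\<close>.\<close>

definition soft_O :: "(nat \<Rightarrow> real) \<Rightarrow> (nat \<Rightarrow> real) \<Rightarrow> bool" where
  "soft_O F G \<longleftrightarrow> (\<exists>c::real. F \<in> O(\<lambda>m. G m * \<bar>ln (G m)\<bar> powr c))"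

definition rate_exponent :: "nat \<Rightarrow> real \<Rightarrow> real \<Rightarrow> nat \<Rightarrow> real" where
  "rate_exponent d \<sigma> a k =
     (if a \<le> - \<sigma> / real d - 1 then (1 / real d) * min \<sigma> 1 * ((real k + a) / (real k - 1))
      else if a \<le> - 1 then (1 / real d) * min \<sigma> ((real k + a) / (real k - 1))
      else (1 / real d) * min \<sigma> 1)"

end

theory Submission
  imports Defs
begin

text \<open>Write \<open>n = m - 1\<close>, \<open>\<tau> = min \<sigma> 1\<close>, let \<open>Q x r\<close> be the probability of the ball \<open>B(x, r)\<close>, and for a
  displacement \<open>h\<close> let \<open>u = n * vol B(0, \<bar>h\<bar>)\<close>. Both quantities to be compared are integrals of the same
  function \<open>\<phi> u\<close> over pairs \<open>(x, h)\<close>, against two different weights.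

  The estimator: given \<open>X_i = x\<close>, the point \<open>x + h\<close> is the \<open>k\<close>-th neighbor iff exactly \<open>k - 1\<close> of the other
  \<open>n - 1\<close> points fall into \<open>B(x, \<bar>h\<bar>)\<close>. So the expectation of each summand is the integral of \<open>\<phi> u\<close> against
  \<open>n * p x * p (x + h) * g (Q x \<bar>h\<bar>)\<close>, where \<open>g q = (n-1 choose k-1) * q^(k-1) * (1-q)^(n-k)\<close>
  (\<open>distr_nn_dist\<close>, \<open>knn_term_expectation\<close>). The functional: by the Laplace transform that defines \<open>\<phi>\<close>, and by
  the substitution of \<open>u\<close> for \<open>h\<close>, it is the integral of \<open>\<phi> u\<close> against \<open>n * p x * p x * \<gamma> (p x * u)\<close>, where
  \<open>\<gamma> z = z^(k-1) * exp (- z) / (k-1)!\<close> (\<open>ideal_value\<close>).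

  The two weights differ in three respects: \<open>p (x + h)\<close> replaces \<open>p x\<close>, the binomial kernel replaces the
  Poisson kernel, and \<open>n * Q x \<bar>h\<bar>\<close> replaces \<open>p x * u\<close>. The second replacement causes an error of
  relative order \<open>1 / n\<close>, up to a polynomial in \<open>u\<close>. The first and the third are, after integration over \<open>x\<close>, bounded by the modulus of continuity of \<open>p\<close> in
  the mean, the integral of \<open>\<bar>p (x + h) - p x\<bar>\<close> (\<open>kernel_comparison\<close>, \<open>ball_mass_modulus\<close>, \<open>weight_diff\<close>). Since
  the density is bounded below and the support is regular, \<open>Q x \<bar>h\<bar>\<close> is comparable to the volume of the ball
  up to the diameter of the support, and every error carries a factor \<open>u^(k-1) * exp (- c * u)\<close>, against which
  the envelope is integrable because \<open>k + a > 0\<close>.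

  The modulus of continuity in the mean is of order \<open>\<bar>h\<bar> powr \<tau>\<close> (\<open>L1_modulus\<close>). It suffices to move along a
  coordinate axis. A segment that misses the boundary of the support lies inside the interior, where
  the Hoelder condition applies, or outside the support. The base points of the segments of length \<open>t\<close> that hit
  the boundary have volume of order \<open>t\<close>: replace each set of a cover of the boundary by a box, and stretch it
  by \<open>t\<close> along the axis (\<open>hausdorff_sweep\<close>). This estimate holds although a neighborhood of the boundary of
  width \<open>t\<close> can have a much larger volume, since a set of finite Hausdorff measure need not have a finite
  Minkowski content.

  Since \<open>\<bar>h\<bar> powr \<tau>\<close> is of order \<open>(u / n) powr (\<tau> / d)\<close>, the bias is of order \<open>n powr (- \<tau> / d)\<close>
  (\<open>knn_bias_bound\<close>). In each of its three cases the exponent of the theorem is positive and at most \<open>\<tau> / d\<close>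
  (\<open>rate_exponent_bounds\<close>).\<close>

section \<open>The binomial kernel and its Poisson limit\<close>

definition binomial_kernel :: "nat \<Rightarrow> nat \<Rightarrow> real \<Rightarrow> real" where
  "binomial_kernel k n q = real ((n - 1) choose (k - 1)) * q ^ (k - 1) * (1 - q) ^ (n - k)"

definition poisson_kernel :: "nat \<Rightarrow> real \<Rightarrow> real" where
  "poisson_kernel k z = z ^ (k - 1) * exp (- z) / fact (k - 1)"

text \<open>The factor \<open>B\<close> on the left avoids the exponent \<open>j - 1\<close>, and with it the case \<open>j = 0\<close>.\<close>

lemma power_diff_le:
  fixes x y B :: real
  assumes "0 \<le> x" "x \<le> B" "0 \<le> y" "y \<le> B"
  shows "B * \<bar>x ^ j - y ^ j\<bar> \<le> real j * B ^ j * \<bar>x - y\<bar>"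
proof (induction j)
  case 0
  then show ?case by simp
next
  case (Suc j)
  have "x ^ Suc j - y ^ Suc j = x * (x ^ j - y ^ j) + (x - y) * y ^ j"
    by (simp add: algebra_simps)
  then have "\<bar>x ^ Suc j - y ^ Suc j\<bar> \<le> x * \<bar>x ^ j - y ^ j\<bar> + \<bar>x - y\<bar> * y ^ j"
    using assms abs_triangle_ineq[of "x * (x ^ j - y ^ j)" "(x - y) * y ^ j"]
    by (simp add: abs_mult)
  also have "\<dots> \<le> B * \<bar>x ^ j - y ^ j\<bar> + \<bar>x - y\<bar> * B ^ j"
    using assms by (intro add_mono mult_mono power_mono) auto
  also have "\<dots> \<le> real j * B ^ j * \<bar>x - y\<bar> + \<bar>x - y\<bar> * B ^ j"
    using Suc.IH by simp
  finally have "B * \<bar>x ^ Suc j - y ^ Suc j\<bar> \<le> B * (real j * B ^ j * \<bar>x - y\<bar> + \<bar>x - y\<bar> * B ^ j)"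
    using assms by (intro mult_left_mono) auto
  then show ?case by (simp add: algebra_simps)
qed

lemma choose_fact_le: "real ((n - 1) choose j) * fact j \<le> real n ^ j"
proof -
  have "((n - 1) choose j) * fact j \<le> (n - 1) ^ j" by (rule binomial_fact_pow)
  also have "\<dots> \<le> n ^ j" by (intro power_mono) auto
  finally have "real (((n - 1) choose j) * fact j) \<le> real (n ^ j)"
    by (rule of_nat_mono)
  then show ?thesis by simp
qed

lemma choose_fact_ge:
  assumes "1 \<le> n"
  shows "real n ^ j * (1 - real j ^ 2 / real n) \<le> real ((n - 1) choose j) * fact j"
proof (induction j)
  case 0
  then show ?case by simp
next
  case (Suc j)
  let ?a = "real ((n - 1) choose j) * fact j"
  have rec: "real ((n - 1) choose Suc j) * fact (Suc j) = (real n - 1 - real j) * ?a"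
  proof (cases "j \<le> n - 1")
    case True
    have "(Suc j) * ((n - 1) choose Suc j) = (n - 1 - j) * ((n - 1) choose j)"
      by (metis binomial_absorption binomial_absorb_comp)
    then have "real (Suc j) * real ((n - 1) choose Suc j) = real (n - 1 - j) * real ((n - 1) choose j)"
      by (metis of_nat_mult)
    moreover have "real (n - 1 - j) = real n - 1 - real j" using True assms by linarith
    ultimately have "real (Suc j) * real ((n - 1) choose Suc j) = (real n - 1 - real j) * real ((n - 1) choose j)"
      by metis
    then have "fact j * (real (Suc j) * real ((n - 1) choose Suc j))
        = fact j * ((real n - 1 - real j) * real ((n - 1) choose j))" by (rule arg_cong)
    then show ?thesis by (simp add: mult_ac)
  next
    case False
    then have "(n - 1) choose j = 0" "(n - 1) choose Suc j = 0" by (auto intro!: binomial_eq_0)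
    then show ?thesis by (simp only: of_nat_0 mult_zero_left mult_zero_right)
  qed
  have n: "real n > 0" using assms by simp
  have "(real n - 1 - real j) * ?a = real n * ?a - (1 + real j) * ?a" by (simp add: algebra_simps)
  also have "\<dots> \<ge> real n * (real n ^ j * (1 - real j ^ 2 / real n)) - (1 + real j) * real n ^ j"
    using Suc.IH choose_fact_le[of n j] n by (intro diff_mono mult_left_mono) auto
  finally have "(real n - 1 - real j) * ?a \<ge> real n * (real n ^ j * (1 - real j ^ 2 / real n)) - (1 + real j) * real n ^ j" .
  moreover have "real n * (real n ^ j * (1 - real j ^ 2 / real n)) - (1 + real j) * real n ^ j
      = real n ^ Suc j - real n ^ j * (real j ^ 2 + 1 + real j)"
    using n by (simp add: field_simps power2_eq_square)
  moreover have "real n ^ Suc j * (1 - real (Suc j) ^ 2 / real n)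
      = real n ^ Suc j - real n ^ j * (real j ^ 2 + 1 + 2 * real j)"
    using n by (simp add: field_simps power2_eq_square)
  moreover have "real n ^ j * (real j ^ 2 + 1 + real j) \<le> real n ^ j * (real j ^ 2 + 1 + 2 * real j)"
    using n by (intro mult_left_mono) auto
  ultimately show ?case using rec by linarith
qed

lemma one_minus_power_le:
  fixes q :: real
  assumes "q \<le> 1"
  shows "(1 - q) ^ m \<le> exp (- (real m * q))"
proof -
  have "(1 - q) ^ m \<le> exp (- q) ^ m"
    using assms exp_ge_add_one_self[of "-q"] by (intro power_mono) auto
  then show ?thesis by (simp add: exp_of_nat_mult[symmetric])
qed

text \<open>From above, \<open>1 - q \<le> exp (- q)\<close> leaves the surplus factor \<open>exp (k * q)\<close>, and \<open>exp y - 1 \<le> y * exp y\<close>.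
  From below, \<open>n - k\<close> may be replaced by \<open>n\<close>, and then \<open>x^n - y^n \<le> n * (x - y) * x^(n-1)\<close> applies to
  \<open>x = exp (- q)\<close> and \<open>y = 1 - q\<close>, whose difference is at most \<open>q^2\<close>. Both bounds retain the decay \<open>exp (- n * q)\<close>.\<close>

lemma one_minus_power_diff:
  fixes q :: real
  assumes "0 \<le> q" "q \<le> 1" "k \<le> n" "1 \<le> k"
  shows "\<bar>(1 - q) ^ (n - k) - exp (- (real n * q))\<bar>
    \<le> 3 * real k * exp (real k) / real n * (real n * q * (1 + real n * q)) * exp (- (real n * q))"
proof -
  let ?z = "real n * q"
  have n: "real n > 0" using assms by simp
  have "(1 - q) ^ (n - k) \<le> exp (- (real (n - k) * q))" using one_minus_power_le assms by blast
  also have "\<dots> = exp (- ?z) * exp (real k * q)"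
    using assms by (simp add: exp_add[symmetric] of_nat_diff algebra_simps)
  finally have "(1 - q) ^ (n - k) - exp (- ?z) \<le> exp (- ?z) * (exp (real k * q) - 1)"
    by (simp add: algebra_simps)
  also have "exp (real k * q) - 1 \<le> real k * q * exp (real k * q)"
  proof -
    have "1 - real k * q \<le> exp (- (real k * q))" using exp_ge_add_one_self[of "-(real k * q)"] by simp
    then have "(1 - real k * q) * exp (real k * q) \<le> exp (- (real k * q)) * exp (real k * q)"
      by (intro mult_right_mono) auto
    then show ?thesis by (simp add: exp_add[symmetric] algebra_simps)
  qed
  also have "\<dots> \<le> real k * q * exp (real k)"
    using assms by (intro mult_left_mono) (auto simp: mult_left_le)
  finally have up: "(1 - q) ^ (n - k) - exp (- ?z) \<le> real k * exp (real k) / real n * ?z * exp (- ?z)"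
    using n by (simp add: field_simps)
  have "exp (- ?z) - (1 - q) ^ (n - k) \<le> exp (- ?z) - (1 - q) ^ n"
    using assms by (simp add: power_decreasing)
  also have "\<dots> = exp (- q) ^ n - (1 - q) ^ n" by (simp add: exp_of_nat_mult[symmetric])
  also have "\<dots> \<le> real n * q ^ 2 * exp (-q) ^ n * exp 1"
  proof -
    have e: "1 - q \<le> exp (- q)" using exp_ge_add_one_self[of "-q"] by simp
    have "exp (- q) * \<bar>exp (- q) ^ n - (1 - q) ^ n\<bar> \<le> real n * exp (- q) ^ n * \<bar>exp (- q) - (1 - q)\<bar>"
      using e assms by (intro power_diff_le) auto
    moreover have "(1 - q) ^ n \<le> exp (- q) ^ n" using e assms by (intro power_mono) auto
    moreover have "\<bar>exp (- q) - (1 - q)\<bar> \<le> q ^ 2"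
    proof -
      have "(1 + q) * exp (- q) \<le> exp q * exp (- q)"
        using exp_ge_add_one_self[of q] by (intro mult_right_mono) auto
      then have "(1 + q) * exp (- q) \<le> 1" by (simp add: exp_add[symmetric])
      then have "exp (- q) \<le> 1 / (1 + q)" using assms by (simp add: field_simps)
      also have "\<dots> \<le> 1 - q + q ^ 2" using assms by (simp add: field_simps power2_eq_square)
      finally show ?thesis using e by simp
    qed
    ultimately have "exp (- q) * (exp (- q) ^ n - (1 - q) ^ n) \<le> real n * exp (- q) ^ n * (q ^ 2)"
      by (smt (verit) mult_left_mono of_nat_0_le_iff mult_nonneg_nonneg exp_ge_zero zero_le_power)
    then have "exp q * (exp (- q) * (exp (- q) ^ n - (1 - q) ^ n)) \<le> exp q * (real n * exp (- q) ^ n * (q ^ 2))"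
      by (intro mult_left_mono) auto
    then have "exp (- q) ^ n - (1 - q) ^ n \<le> exp q * (real n * exp (- q) ^ n * (q ^ 2))"
      by (simp add: mult.assoc[symmetric] exp_add[symmetric])
    also have "\<dots> \<le> exp 1 * (real n * exp (- q) ^ n * (q ^ 2))"
      using assms by (intro mult_right_mono) auto
    finally show ?thesis by (simp add: mult_ac)
  qed
  also have "\<dots> = exp 1 / real n * (?z * ?z) * exp (- ?z)"
    using n by (simp add: exp_of_nat_mult[symmetric] field_simps power2_eq_square)
  finally have dn: "exp (- ?z) - (1 - q) ^ (n - k) \<le> exp 1 / real n * (?z * ?z) * exp (- ?z)" .
  have z0: "?z \<ge> 0" using assms by simp
  let ?A = "real k * exp (real k)"
  have A: "?A \<ge> 0" "exp 1 \<le> ?A"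
  proof -
    have "1 * exp 1 \<le> real k * exp (real k)" using assms by (intro mult_mono) auto
    then show "exp 1 \<le> ?A" by simp
  qed auto
  have m: "?A / real n * X * exp (- ?z) \<le> 3 * ?A / real n * (?z * (1 + ?z)) * exp (- ?z)" 
    if "X \<le> ?z * (1 + ?z)" "0 \<le> X" for X
  proof -
    have "?A / real n * X \<le> ?A / real n * (?z * (1 + ?z))"
      using that z0 n A by (intro mult_left_mono) auto
    moreover have "0 \<le> ?A / real n * (?z * (1 + ?z))"
      using assms by (intro mult_nonneg_nonneg divide_nonneg_nonneg) auto
    moreover have "Y \<le> 3 * P" if "Y \<le> P" "0 \<le> P" for Y P :: real using that by linarith
    ultimately have "?A / real n * X \<le> 3 * (?A / real n * (?z * (1 + ?z)))" by blast
    then have "?A / real n * X \<le> 3 * ?A / real n * (?z * (1 + ?z))"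
      by (simp only: times_divide_eq_left times_divide_eq_right mult.assoc)
    then show ?thesis by (intro mult_right_mono) auto
  qed
  have 1: "(1 - q) ^ (n - k) - exp (- ?z) \<le> 3 * ?A / real n * (?z * (1 + ?z)) * exp (- ?z)"
  proof (rule order.trans[OF up m])
    have "?z * 1 \<le> ?z * (1 + ?z)" using z0 by (intro mult_left_mono) auto
    then show "?z \<le> ?z * (1 + ?z)" by simp
  qed (rule z0)
  have "exp 1 / real n * (?z * ?z) * exp (- ?z) \<le> ?A / real n * (?z * ?z) * exp (- ?z)"
    using A n z0 by (intro mult_right_mono frac_le) auto
  also have "\<dots> \<le> 3 * ?A / real n * (?z * (1 + ?z)) * exp (- ?z)"
  proof (rule m)
    show "?z * ?z \<le> ?z * (1 + ?z)" using z0 by (intro mult_left_mono) auto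
  qed (rule zero_le_square)
  finally have 2: "exp (- ?z) - (1 - q) ^ (n - k) \<le> 3 * ?A / real n * (?z * (1 + ?z)) * exp (- ?z)"
    using dn by linarith
  show ?thesis using 1 2 by (simp add: abs_le_iff mult.assoc)
qed

lemma binomial_kernel_nonneg: "0 \<le> q \<Longrightarrow> q \<le> 1 \<Longrightarrow> 0 \<le> binomial_kernel k n q"
  by (simp add: binomial_kernel_def)

lemma poisson_kernel_nonneg: "0 \<le> z \<Longrightarrow> 0 \<le> poisson_kernel k z"
  by (simp add: poisson_kernel_def)

text \<open>The loss of \<open>exp k\<close> covers the exponent \<open>n - k\<close> in place of \<open>n\<close>, so the bound has no side condition
  that \<open>n\<close> be large.\<close>

lemma binomial_kernel_le:
  assumes "0 \<le> q" "q \<le> 1" "1 \<le> k" "k \<le> n"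
  shows "binomial_kernel k n q \<le> exp (real k) * (real n * q) ^ (k - 1) * exp (- (real n * q))"
proof -
  have "real ((n - 1) choose (k - 1)) * 1 \<le> real ((n - 1) choose (k - 1)) * fact (k - 1)"
    by (intro mult_left_mono) auto
  then have c: "real ((n - 1) choose (k - 1)) \<le> real n ^ (k - 1)"
    using choose_fact_le[of n "k - 1"] by linarith
  have "(1 - q) ^ (n - k) \<le> exp (- (real (n - k) * q))" using one_minus_power_le assms by blast
  also have "\<dots> = exp (- (real n * q)) * exp (real k * q)"
    using assms by (simp add: exp_add[symmetric] of_nat_diff algebra_simps)
  also have "\<dots> \<le> exp (- (real n * q)) * exp (real k)"
    using assms by (intro mult_left_mono) (auto simp: mult_left_le)
  finally have "(1 - q) ^ (n - k) \<le> exp (- (real n * q)) * exp (real k)" .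
  then have "binomial_kernel k n q \<le> real n ^ (k - 1) * q ^ (k - 1) * (exp (- (real n * q)) * exp (real k))"
    unfolding binomial_kernel_def using assms c by (intro mult_mono) auto
  then show ?thesis by (simp add: power_mult_distrib mult_ac)
qed

lemma kernel_diff_factor:
  fixes N :: real
  shows "N * Q * (Y / n * Z * E) + N * (d / n) * Q * E = N * Q * E / n * (Y * Z + d)"
proof -
  have "N * Q * (Y / n * Z * E) = N * Q * E / n * (Y * Z)" "N * (d / n) * Q * E = N * Q * E / n * d"
    by simp_all
  then show ?thesis by (simp only: distrib_left)
qed

lemma binomial_poisson_diff:
  assumes "0 \<le> q" "q \<le> 1" "1 \<le> k" "k \<le> n"
  shows "\<bar>binomial_kernel k n q - poisson_kernel k (real n * q)\<bar>
    \<le> 4 * real k ^ 2 * exp (real k) / real n * (real n * q) ^ (k - 1) * (1 + real n * q) ^ 2 * exp (- (real n * q))"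
proof -
  let ?z = "real n * q" and ?c = "real ((n - 1) choose (k - 1))"
  have n: "real n > 0" using assms by simp
  have z: "?z \<ge> 0" using assms by simp
  have c: "?c * fact (k - 1) \<le> real n ^ (k - 1)" by (rule choose_fact_le)
  have "?c * 1 \<le> ?c * fact (k - 1)" by (intro mult_left_mono) auto
  then have c1: "?c \<le> real n ^ (k - 1)" using c by linarith
  have c2: "\<bar>?c - real n ^ (k - 1) / fact (k - 1)\<bar> \<le> real n ^ (k - 1) * (real k ^ 2 / real n)"
  proof -
    have "real n ^ (k - 1) - ?c * fact (k - 1) \<le> real n ^ (k - 1) * (real (k - 1) ^ 2 / real n)"
      using choose_fact_ge[of n "k - 1"] assms by (simp add: algebra_simps)
    also have "\<dots> \<le> real n ^ (k - 1) * (real k ^ 2 / real n)"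
      using n by (intro mult_left_mono divide_right_mono power_mono) auto
    finally have "(real n ^ (k - 1) - ?c * fact (k - 1)) / fact (k - 1) \<le> real n ^ (k - 1) * (real k ^ 2 / real n) / fact (k - 1)"
      by (intro divide_right_mono) auto
    also have "\<dots> \<le> real n ^ (k - 1) * (real k ^ 2 / real n) / 1"
      by (intro divide_left_mono) auto
    finally have "(real n ^ (k - 1) - ?c * fact (k - 1)) / fact (k - 1) \<le> real n ^ (k - 1) * (real k ^ 2 / real n)" by simp
    moreover have "(real n ^ (k - 1) - ?c * fact (k - 1)) / fact (k - 1) = real n ^ (k - 1) / fact (k - 1) - ?c"
      by (simp add: field_simps)
    moreover have "?c \<le> real n ^ (k - 1) / fact (k - 1)" using c by (simp add: field_simps)
    ultimately show ?thesis by (simp add: abs_if)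
  qed
  let ?D = "3 * real k * exp (real k) / real n * (?z * (1 + ?z)) * exp (- ?z)"
  have "binomial_kernel k n q - poisson_kernel k ?z
     = ?c * q ^ (k - 1) * ((1 - q) ^ (n - k) - exp (- ?z))
      + (?c - real n ^ (k - 1) / fact (k - 1)) * q ^ (k - 1) * exp (- ?z)"
    by (simp add: binomial_kernel_def poisson_kernel_def power_mult_distrib algebra_simps)
  also have "\<bar>\<dots>\<bar> \<le> ?c * q ^ (k - 1) * \<bar>(1 - q) ^ (n - k) - exp (- ?z)\<bar>
      + \<bar>?c - real n ^ (k - 1) / fact (k - 1)\<bar> * q ^ (k - 1) * exp (- ?z)"
    using assms abs_triangle_ineq by (simp add: abs_mult order.trans[OF abs_triangle_ineq])
  also have "\<dots> \<le> real n ^ (k - 1) * q ^ (k - 1) * ?D + real n ^ (k - 1) * (real k ^ 2 / real n) * q ^ (k - 1) * exp (- ?z)"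
  proof (rule add_mono)
    have D: "\<bar>(1 - q) ^ (n - k) - exp (- ?z)\<bar> \<le> ?D" using assms by (intro one_minus_power_diff) auto
    have cq: "?c * q ^ (k - 1) \<le> real n ^ (k - 1) * q ^ (k - 1)"
      using assms by (intro mult_right_mono[OF c1]) auto
    show "?c * q ^ (k - 1) * \<bar>(1 - q) ^ (n - k) - exp (- ?z)\<bar> \<le> real n ^ (k - 1) * q ^ (k - 1) * ?D"
      using assms(1) by (intro mult_mono[OF cq D]) auto
    show "\<bar>?c - real n ^ (k - 1) / fact (k - 1)\<bar> * q ^ (k - 1) * exp (- ?z)
        \<le> real n ^ (k - 1) * (real k ^ 2 / real n) * q ^ (k - 1) * exp (- ?z)"
      using assms by (intro mult_right_mono c2) auto
  qed
  also have "\<dots> = ?z ^ (k - 1) * exp (- ?z) / real n * (3 * real k * exp (real k) * (?z * (1 + ?z)) + real k ^ 2)"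
  proof -
    have pw: "?z ^ (k - 1) = real n ^ (k - 1) * q ^ (k - 1)" by (rule power_mult_distrib)
    show ?thesis unfolding pw by (rule kernel_diff_factor)
  qed
  also have "\<dots> \<le> ?z ^ (k - 1) * exp (- ?z) / real n * (4 * real k ^ 2 * exp (real k) * (1 + ?z) ^ 2)"
  proof (intro mult_left_mono)
    have k: "real k \<le> real k ^ 2" using assms by (simp add: power2_eq_square)
    have "?z * (1 + ?z) \<le> (1 + ?z) ^ 2" using z by (simp add: power2_eq_square algebra_simps)
    then have h1: "3 * real k * exp (real k) * (?z * (1 + ?z)) \<le> 3 * real k ^ 2 * exp (real k) * (1 + ?z) ^ 2"
      using k z by (intro mult_mono) auto
    have h2: "real k ^ 2 * 1 * 1 \<le> real k ^ 2 * exp (real k) * (1 + ?z) ^ 2"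
      using z by (intro mult_mono one_le_power) auto
    show "3 * real k * exp (real k) * (?z * (1 + ?z)) + real k ^ 2 \<le> 4 * real k ^ 2 * exp (real k) * (1 + ?z) ^ 2"
    proof -
      define W where "W = real k ^ 2 * (exp (real k) * (1 + ?z) ^ 2)"
      have "3 * real k * exp (real k) * (?z * (1 + ?z)) \<le> 3 * W" "real k ^ 2 \<le> W"
        using h1 h2 unfolding W_def by (simp_all only: mult.assoc mult_1_right)
      then have "3 * real k * exp (real k) * (?z * (1 + ?z)) + real k ^ 2 \<le> 4 * W" by linarith
      then show ?thesis unfolding W_def by (simp only: mult.assoc)
    qed
  qed (use z in auto)
  finally show ?thesis by (simp add: mult_ac)
qed

lemma poisson_kernel_lipschitz:
  assumes "0 < c" "0 < u" "c * u \<le> y" "y \<le> B * u" "c * u \<le> z" "z \<le> B * u"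
  shows "u * \<bar>poisson_kernel k y - poisson_kernel k z\<bar>
    \<le> (B * u) ^ (k - 1) * (real k / B + u) * exp (- (c * u)) * \<bar>y - z\<bar>"
proof -
  let ?j = "k - 1"
  have cu: "c * u > 0" using assms by simp
  have yz: "y > 0" "z > 0" using assms cu by linarith+
  have Bu: "B * u > 0" using assms yz by linarith
  have B: "B > 0" using Bu assms by (simp add: zero_less_mult_iff)
  have ed: "\<bar>exp (- y) - exp (- z)\<bar> \<le> exp (- (c * u)) * \<bar>y - z\<bar>"
  proof -
    have *: "exp (- s) - exp (- t) \<le> exp (- (c * u)) * (t - s)" if "c * u \<le> s" "s \<le> t" for s t
    proof -
      have "exp (- s) - exp (- t) = exp (- s) * (1 - exp (- (t - s)))"
        by (simp add: algebra_simps exp_add[symmetric])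
      also have "\<dots> \<le> exp (- s) * (t - s)"
        using exp_ge_add_one_self[of "s - t"] by (intro mult_left_mono) (simp_all add: algebra_simps)
      also have "\<dots> \<le> exp (- (c * u)) * (t - s)" using that by (intro mult_right_mono) auto
      finally show ?thesis .
    qed
    show ?thesis
      using *[of y z] *[of z y] assms by (cases "y \<le> z") (auto simp: abs_if)
  qed
  have "B * u * \<bar>y ^ ?j * exp (- y) - z ^ ?j * exp (- z)\<bar>
      = B * u * \<bar>(y ^ ?j - z ^ ?j) * exp (- y) + z ^ ?j * (exp (- y) - exp (- z))\<bar>"
    by (simp add: algebra_simps)
  also have "\<dots> \<le> B * u * (\<bar>y ^ ?j - z ^ ?j\<bar> * exp (- y) + z ^ ?j * \<bar>exp (- y) - exp (- z)\<bar>)"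
    using yz Bu abs_triangle_ineq[of "(y ^ ?j - z ^ ?j) * exp (- y)" "z ^ ?j * (exp (- y) - exp (- z))"]
    by (intro mult_left_mono) (auto simp: abs_mult)
  also have "\<dots> = (B * u * \<bar>y ^ ?j - z ^ ?j\<bar>) * exp (- y) + B * u * (z ^ ?j * \<bar>exp (- y) - exp (- z)\<bar>)"
    by (simp add: algebra_simps)
  also have "\<dots> \<le> (real ?j * (B * u) ^ ?j * \<bar>y - z\<bar>) * exp (- (c * u))
      + B * u * ((B * u) ^ ?j * (exp (- (c * u)) * \<bar>y - z\<bar>))"
    using assms yz Bu B ed
    by (intro add_mono mult_mono power_diff_le power_mono) auto
  also have "\<dots> \<le> (real k * (B * u) ^ ?j * \<bar>y - z\<bar>) * exp (- (c * u))
      + B * u * ((B * u) ^ ?j * (exp (- (c * u)) * \<bar>y - z\<bar>))"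
    using Bu assms(2) by (intro add_mono mult_right_mono) auto
  also have "\<dots> = B * ((B * u) ^ ?j * (real k / B + u) * exp (- (c * u)) * \<bar>y - z\<bar>)"
    using B by (simp add: field_simps)
  finally have "u * \<bar>y ^ ?j * exp (- y) - z ^ ?j * exp (- z)\<bar> \<le> (B * u) ^ ?j * (real k / B + u) * exp (- (c * u)) * \<bar>y - z\<bar>"
    using B by (simp add: mult.assoc)
  moreover have "\<bar>poisson_kernel k y - poisson_kernel k z\<bar> \<le> \<bar>y ^ ?j * exp (- y) - z ^ ?j * exp (- z)\<bar> / 1"
  proof -
    have "poisson_kernel k y - poisson_kernel k z = (y ^ ?j * exp (- y) - z ^ ?j * exp (- z)) / fact ?j"
      by (simp add: poisson_kernel_def diff_divide_distrib)
    then have "\<bar>poisson_kernel k y - poisson_kernel k z\<bar> = \<bar>y ^ ?j * exp (- y) - z ^ ?j * exp (- z)\<bar> / fact ?j"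
      by simp
    also have "\<dots> \<le> \<bar>y ^ ?j * exp (- y) - z ^ ?j * exp (- z)\<bar> / 1"
      by (intro divide_left_mono) auto
    finally show ?thesis .
  qed
  ultimately show ?thesis
    using assms by (smt (verit) mult_left_mono div_by_1)
qed

text \<open>The pointwise heart of the bias estimate. It will be used with \<open>s = p (x + h)\<close>, \<open>t = p x\<close>, \<open>q\<close> the mass of the
  ball and \<open>z = t * u\<close>; the three summands are the errors of density, of kernel and of mass. Halving the rate
  of decay absorbs the polynomial factors.\<close>

lemma kernel_comparison:
  assumes c: "0 < c" "c \<le> B" and k: "1 \<le> k"
  obtains K where "0 < K"
    "\<And>n q u z s t. \<lbrakk>k \<le> n; 0 \<le> q; q \<le> 1; 0 < u; c * u \<le> real n * q; real n * q \<le> B * u;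
       c * u \<le> z; z \<le> B * u; 0 \<le> s; 0 \<le> t\<rbrakk>
     \<Longrightarrow> \<bar>s * binomial_kernel k n q - t * poisson_kernel k z\<bar>
       \<le> K * u ^ (k - 1) * exp (- (c / 2 * u)) * (\<bar>s - t\<bar> + t / real n + t * \<bar>real n * q - z\<bar> / u)"
proof -
  have B: "0 < B" using c by linarith
  define K1 where "K1 = exp (real k) * B ^ (k - 1)"
  define K2 where "K2 = 4 * real k ^ 2 * exp (real k) * B ^ (k - 1) * (1 + 4 * B / c) ^ 2"
  define K3 where "K3 = B ^ (k - 1) * (real k / B + 2 / c)"
  define K where "K = K1 + K2 + K3"
  have "0 < 1 + 4 * B / c" using B c by (intro add_pos_pos) auto
  then have Kpos: "0 < K1" "0 < K2" "0 < K3" using B c k by (auto simp: K1_def K2_def K3_def intro!: mult_pos_pos add_nonneg_pos add_pos_nonneg)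
  then have "0 < K" by (simp add: K_def)
  moreover have "\<bar>s * binomial_kernel k n q - t * poisson_kernel k z\<bar>
       \<le> K * u ^ (k - 1) * exp (- (c / 2 * u)) * (\<bar>s - t\<bar> + t / real n + t * \<bar>real n * q - z\<bar> / u)"
    if n: "k \<le> n" and q: "0 \<le> q" "q \<le> 1" and u: "0 < u" and y: "c * u \<le> real n * q" "real n * q \<le> B * u"
      and z: "c * u \<le> z" "z \<le> B * u" and st: "0 \<le> s" "0 \<le> t" for n q u z s t
  proof -
    let ?y = "real n * q" and ?w = "u ^ (k - 1) * exp (- (c / 2 * u))"
    have w: "?w \<ge> 0" using u by simp
    have y0: "0 \<le> ?y" using q by simp
    have n0: "real n > 0" using n k by simp
    have yp: "?y ^ (k - 1) \<le> B ^ (k - 1) * u ^ (k - 1)"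
      using power_mono[OF y(2) y0, of "k - 1"] by (simp add: power_mult_distrib)
    have ee: "exp (- (c * u)) = exp (- (c / 2 * u)) * exp (- (c / 2 * u))"
      by (simp add: exp_add[symmetric])
    have ey: "exp (- ?y) \<le> exp (- (c * u))" using y by simp
    have "c / 2 * u \<le> c * u" using c u by simp
    then have ey2: "exp (- ?y) \<le> exp (- (c / 2 * u))" using y by simp
    have "binomial_kernel k n q \<le> exp (real k) * ?y ^ (k - 1) * exp (- ?y)"
      by (rule binomial_kernel_le) (use q k n in auto)
    also have "\<dots> \<le> exp (real k) * (B ^ (k - 1) * u ^ (k - 1)) * exp (- (c / 2 * u))"
      using yp ey2 y0 B u by (intro mult_mono mult_left_mono) auto
    finally have 1: "binomial_kernel k n q \<le> K1 * ?w" by (simp add: K1_def mult_ac)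
    have a1: "(1 + ?y) ^ 2 * exp (- (c * u)) \<le> (1 + 4 * B / c) ^ 2 * exp (- (c / 2 * u))"
    proof -
      have "1 + ?y \<le> 1 + B * u" using y by simp
      also have "\<dots> \<le> (1 + 4 * B / c) * (1 + c / 4 * u)"
        using c B u by (simp add: field_simps)
      also have "\<dots> \<le> (1 + 4 * B / c) * exp (c / 4 * u)"
        using c B by (intro mult_left_mono) auto
      finally have "(1 + ?y) ^ 2 \<le> ((1 + 4 * B / c) * exp (c / 4 * u)) ^ 2"
        using y0 by (intro power_mono) auto
      then have "(1 + ?y) ^ 2 \<le> (1 + 4 * B / c) ^ 2 * exp (c / 2 * u)"
        by (simp add: power_mult_distrib exp_of_nat_mult[symmetric])
      then have "(1 + ?y) ^ 2 * exp (- (c * u)) \<le> (1 + 4 * B / c) ^ 2 * exp (c / 2 * u) * exp (- (c * u))"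
        by (intro mult_right_mono) auto
      also have "\<dots> = (1 + 4 * B / c) ^ 2 * exp (- (c / 2 * u))"
        by (simp add: mult.assoc exp_add[symmetric])
      finally show ?thesis .
    qed
    have "\<bar>binomial_kernel k n q - poisson_kernel k ?y\<bar>
       \<le> 4 * real k ^ 2 * exp (real k) / real n * ?y ^ (k - 1) * (1 + ?y) ^ 2 * exp (- ?y)"
      by (rule binomial_poisson_diff) (use q k n in auto)
    also have "\<dots> = 4 * real k ^ 2 * exp (real k) / real n * (?y ^ (k - 1) * ((1 + ?y) ^ 2 * exp (- ?y)))"
      by (simp only: mult_ac)
    also have "\<dots> \<le> 4 * real k ^ 2 * exp (real k) / real n * (?y ^ (k - 1) * ((1 + ?y) ^ 2 * exp (- (c * u))))"
      using y y0 q by (intro mult_left_mono) auto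
    also have "\<dots> \<le> 4 * real k ^ 2 * exp (real k) / real n * (B ^ (k - 1) * u ^ (k - 1) * ((1 + 4 * B / c) ^ 2 * exp (- (c / 2 * u))))"
      using y0 B u q by (intro mult_left_mono mult_mono[OF yp a1]) auto
    also have "\<dots> = K2 * ?w / real n" by (simp add: K2_def mult_ac)
    finally have 2: "\<bar>binomial_kernel k n q - poisson_kernel k ?y\<bar> \<le> K2 * ?w / real n" .
    have a2: "(real k / B + u) * exp (- (c * u)) \<le> (real k / B + 2 / c) * exp (- (c / 2 * u))"
    proof -
      have "real k / B + u \<le> (real k / B + 2 / c) * (1 + c / 2 * u)"
      proof -
        have "0 \<le> real k / B * (c / 2 * u)" "0 \<le> 2 / c" using B c u by auto
        then show ?thesis using c by (simp add: algebra_simps)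
      qed
      also have "\<dots> \<le> (real k / B + 2 / c) * exp (c / 2 * u)"
        using B c by (intro mult_left_mono) auto
      finally have "(real k / B + u) * exp (- (c * u)) \<le> (real k / B + 2 / c) * exp (c / 2 * u) * exp (- (c * u))"
        by (intro mult_right_mono) auto
      also have "\<dots> = (real k / B + 2 / c) * exp (- (c / 2 * u))"
        by (simp add: mult.assoc exp_add[symmetric])
      finally show ?thesis .
    qed
    have "u * \<bar>poisson_kernel k ?y - poisson_kernel k z\<bar>
      \<le> (B * u) ^ (k - 1) * (real k / B + u) * exp (- (c * u)) * \<bar>?y - z\<bar>"
      by (rule poisson_kernel_lipschitz) (use c u y z in auto)
    also have "\<dots> = (B ^ (k - 1) * u ^ (k - 1)) * ((real k / B + u) * exp (- (c * u))) * \<bar>?y - z\<bar>"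
      by (simp add: power_mult_distrib)
    also have "\<dots> \<le> (B ^ (k - 1) * u ^ (k - 1)) * ((real k / B + 2 / c) * exp (- (c / 2 * u))) * \<bar>?y - z\<bar>"
      using a2 B u by (intro mult_right_mono mult_left_mono) auto
    also have "\<dots> = K3 * ?w * \<bar>?y - z\<bar>" by (simp add: K3_def mult_ac)
    finally have 3: "\<bar>poisson_kernel k ?y - poisson_kernel k z\<bar> \<le> K3 * ?w * (\<bar>?y - z\<bar> / u)"
      using u by (simp add: field_simps)
    have b0: "binomial_kernel k n q \<ge> 0" using q by (rule binomial_kernel_nonneg)
    have "s * binomial_kernel k n q - t * poisson_kernel k z
      = (s - t) * binomial_kernel k n q + t * (binomial_kernel k n q - poisson_kernel k ?y)
        + t * (poisson_kernel k ?y - poisson_kernel k z)" by (simp add: algebra_simps)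
    also have "\<bar>\<dots>\<bar> \<le> \<bar>(s - t) * binomial_kernel k n q\<bar> + \<bar>t * (binomial_kernel k n q - poisson_kernel k ?y)\<bar>
        + \<bar>t * (poisson_kernel k ?y - poisson_kernel k z)\<bar>" by linarith
    also have "\<dots> = \<bar>s - t\<bar> * binomial_kernel k n q + t * \<bar>binomial_kernel k n q - poisson_kernel k ?y\<bar>
        + t * \<bar>poisson_kernel k ?y - poisson_kernel k z\<bar>" using st b0 by (simp add: abs_mult)
    also have "\<dots> \<le> \<bar>s - t\<bar> * (K1 * ?w) + t * (K2 * ?w / real n) + t * (K3 * ?w * (\<bar>?y - z\<bar> / u))"
      using st 1 2 3 by (intro add_mono mult_left_mono) auto
    also have "\<dots> \<le> \<bar>s - t\<bar> * (K * ?w) + t * (K * ?w / real n) + t * (K * ?w * (\<bar>?y - z\<bar> / u))"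
      using st w Kpos n0 u unfolding K_def
      by (intro add_mono mult_left_mono mult_right_mono divide_right_mono) auto
    finally show ?thesis by (simp add: algebra_simps)
  qed
  ultimately show ?thesis using that by blast
qed

section \<open>Radial integration and integrals of the envelope\<close>

definition radial_volume :: "'a::euclidean_space \<Rightarrow> real" where
  "radial_volume h = unit_ball_vol (real DIM('a)) * norm h ^ DIM('a)"

lemma radial_volume_nonneg: "0 \<le> radial_volume h"
  by (simp add: radial_volume_def)

lemma radial_volume_pos: "h \<noteq> 0 \<Longrightarrow> 0 < radial_volume h"
  by (simp add: radial_volume_def)

lemma measurable_radial_volume [measurable]: "radial_volume \<in> borel_measurable borel"
  unfolding radial_volume_def by measurable

lemma emeasure_ball_radial_volume:
  fixes x h :: "'a::euclidean_space"
  shows "emeasure lborel (ball x (norm h)) = ennreal (radial_volume h)"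
  by (simp add: emeasure_ball radial_volume_def)

lemma measure_ball_radial_volume:
  fixes x h :: "'a::euclidean_space"
  shows "measure lborel (ball x (norm h)) = radial_volume h"
  by (simp add: measure_def emeasure_ball_radial_volume radial_volume_nonneg)

text \<open>The sublevel sets of the volume of the ball spanned by \<open>h\<close> are balls of exactly that volume, which
  makes this volume uniformly distributed on the half-line and gives integration in polar coordinates
  without a surface measure.\<close>

lemma emeasure_distr_radial_volume:
  "emeasure (distr lborel borel (radial_volume :: 'a::euclidean_space \<Rightarrow> real)) {..t} = (if 0 \<le> t then ennreal t else 0)"
  proof -
  let ?v = "unit_ball_vol (real DIM('a))"
  have "emeasure (distr lborel borel (radial_volume :: 'a \<Rightarrow> real)) {..t}
      = emeasure lborel ((radial_volume :: 'a \<Rightarrow> real) -` {..t})"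
    by (subst emeasure_distr) auto
  also have "\<dots> = (if 0 \<le> t then ennreal t else 0)"
  proof (cases "0 \<le> t")
    case True
    define r where "r = root DIM('a) (t / ?v)"
    have r: "0 \<le> r" "r ^ DIM('a) = t / ?v"
      using True by (auto simp: r_def real_root_pow_pos2)
    have "radial_volume h \<le> t \<longleftrightarrow> norm h \<le> r" for h :: 'a
    proof -
      have "radial_volume h \<le> t \<longleftrightarrow> norm h ^ DIM('a) \<le> r ^ DIM('a)"
        unfolding r radial_volume_def by (simp add: pos_le_divide_eq mult.commute)
      also have "\<dots> \<longleftrightarrow> norm h \<le> r" using r by (intro power_mono_iff) auto
      finally show ?thesis .
    qed
    then have "(radial_volume :: 'a \<Rightarrow> real) -` {..t} = cball 0 r" by auto
    moreover have "?v > 0" by simp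
    ultimately show ?thesis using r True by (simp add: emeasure_cball del: unit_ball_vol_pos)
  next
    case False
    then have "(radial_volume :: 'a \<Rightarrow> real) -` {..t} = {}"
      using radial_volume_nonneg by (fastforce intro: order_trans)
    then show ?thesis using False by simp
  qed
  finally show ?thesis .
qed

lemma distr_radial_volume:
  "distr lborel borel (radial_volume :: 'a::euclidean_space \<Rightarrow> real)
    = density lborel (indicator {0<..})"
proof (rule measure_eqI_generator_eq[where E = "range (\<lambda>t::real. {..t})" and \<Omega> = UNIV and A = "\<lambda>i. {..real i}"])
  show "Int_stable (range (\<lambda>t::real. {..t}))"
    by (auto simp: Int_stable_def)
  have el: "emeasure (density lborel (indicator {0<..})) {..t} = (if 0 \<le> t then ennreal t else 0)" for t :: real
  proof -
    have "emeasure (density lborel (indicator {0<..})) {..t} = emeasure lborel ({0<..} \<inter> {..t})"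
      by (subst emeasure_density) (auto simp: indicator_inter_arith[symmetric])
    also have "{0<..} \<inter> {..t} = {0<..t}" by auto
    also have "emeasure lborel {0<..t} = (if 0 \<le> t then ennreal t else 0)"
      by auto
    finally show ?thesis .
  qed
  fix X assume "X \<in> range (\<lambda>t::real. {..t})"
  then show "emeasure (distr lborel borel (radial_volume :: 'a \<Rightarrow> real)) X = emeasure (density lborel (indicator {0<..})) X"
    using emeasure_distr_radial_volume[where 'a = 'a] el by auto
next
  show "emeasure (distr lborel borel (radial_volume :: 'a \<Rightarrow> real)) {..real i} \<noteq> \<infinity>" for i
    by (simp add: emeasure_distr_radial_volume)
  show "(\<Union>i. {..real i}) = UNIV"
    by (auto intro: real_arch_simple)
qed (auto simp: borel_eq_atMost)

lemma nn_integral_radial: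
  fixes G :: "real \<Rightarrow> ennreal"
  assumes [measurable]: "G \<in> borel_measurable borel" and c: "0 < c"
  shows "(\<integral>\<^sup>+h. G (c * radial_volume (h :: 'a::euclidean_space)) \<partial>lborel)
    = ennreal (1 / c) * (\<integral>\<^sup>+u. G u * indicator {0<..} u \<partial>lborel)"
proof -
  have "(\<integral>\<^sup>+h. G (c * radial_volume (h :: 'a)) \<partial>lborel)
     = (\<integral>\<^sup>+t. G (c * t) \<partial>distr lborel borel (radial_volume :: 'a \<Rightarrow> real))"
    by (subst nn_integral_distr) auto
  also have "\<dots> = (\<integral>\<^sup>+t. indicator {0<..} t * G (c * t) \<partial>lborel)"
    unfolding distr_radial_volume by (subst nn_integral_density) auto
  also have "\<dots> = ennreal \<bar>1 / c\<bar> * (\<integral>\<^sup>+u. indicator {0<..} (0 + 1 / c * u) * G (c * (0 + 1 / c * u)) \<partial>lborel)"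
    using c by (intro nn_integral_real_affine) auto
  also have "\<dots> = ennreal (1 / c) * (\<integral>\<^sup>+u. G u * indicator {0<..} u \<partial>lborel)"
    using c by (intro arg_cong2[where f = "(*)", OF _ nn_integral_cong]) (auto simp: indicator_def zero_less_divide_iff)
  finally show ?thesis .
qed

lemma integral_radial:
  fixes G :: "real \<Rightarrow> real"
  assumes G: "integrable lborel G" and G0: "\<And>u. u \<le> 0 \<Longrightarrow> G u = 0" and c: "0 < c"
  shows "integrable lborel (\<lambda>h. G (c * radial_volume (h :: 'a::euclidean_space)))" (is ?A)
    and "(\<integral>h. G (c * radial_volume (h :: 'a::euclidean_space)) \<partial>lborel) = (\<integral>u. G u \<partial>lborel) / c" (is ?B)
proof -
  have [measurable]: "G \<in> borel_measurable borel" using G by auto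
  have d: "density lborel (indicator {0<..}) = density lborel (\<lambda>x. ennreal (indicator {0::real<..} x))"
    by (intro density_cong) (auto simp: indicator_def)
  have e: "(\<lambda>t. indicator {0<..} t *\<^sub>R G (c * t)) = (\<lambda>t. G (0 + c * t))"
    using c G0 by (auto simp: fun_eq_iff indicator_def not_less mult_nonneg_nonpos)
  have i: "integrable lborel (\<lambda>t. G (0 + c * t))"
    using c G by (intro lborel_integrable_real_affine) auto
  have "integrable (distr lborel borel (radial_volume :: 'a \<Rightarrow> real)) (\<lambda>t. G (c * t))"
    unfolding distr_radial_volume d by (subst integrable_density) (use i e in auto)
  then show ?A by (subst (asm) integrable_distr_eq) auto
  have "(\<integral>h. G (c * radial_volume (h :: 'a)) \<partial>lborel)
      = (\<integral>t. G (c * t) \<partial>distr lborel borel (radial_volume :: 'a \<Rightarrow> real))"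
    by (subst integral_distr) auto
  also have "\<dots> = (\<integral>t. indicator {0<..} t *\<^sub>R G (c * t) \<partial>lborel)"
    unfolding distr_radial_volume d by (subst integral_density) auto
  also have "\<dots> = (\<integral>t. G (0 + c * t) \<partial>lborel)" unfolding e ..
  also have "\<dots> = (\<integral>u. G u \<partial>lborel) / c"
    using lborel_integral_real_affine[of c G 0] c by (simp add: field_simps)
  finally show ?B .
qed

lemma nn_integral_powr_exp_finite:
  assumes "0 < s" "0 < c"
  shows "(\<integral>\<^sup>+u. ennreal (u powr (s - 1) * exp (- (c * u))) * indicator {0<..} u \<partial>lborel) < \<infinity>"
proof -
  have "(\<integral>\<^sup>+u. ennreal (u powr (s - 1) * exp (- (c * u))) * indicator {0<..} u \<partial>lborel)
    = ennreal \<bar>1 / c\<bar> * (\<integral>\<^sup>+t. ennreal ((0 + 1 / c * t) powr (s - 1) * exp (- (c * (0 + 1 / c * t)))) * indicator {0<..} (0 + 1 / c * t) \<partial>lborel)"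
    using assms by (intro nn_integral_real_affine) auto
  also have "\<dots> = ennreal \<bar>1 / c\<bar> * (\<integral>\<^sup>+t. ennreal ((1 / c) powr (s - 1)) * ennreal (indicator {0..} t * t powr (s - 1) / exp t) \<partial>lborel)"
    using assms
    by (intro arg_cong2[where f = "(*)", OF refl nn_integral_cong])
       (auto simp: indicator_def ennreal_mult[symmetric] powr_mult powr_divide exp_minus field_simps zero_less_divide_iff)
  also have "\<dots> = ennreal \<bar>1 / c\<bar> * (ennreal ((1 / c) powr (s - 1)) * ennreal (Gamma s))"
    using assms by (simp add: nn_integral_cmult Gamma_conv_nn_integral_real)
  also have "\<dots> < \<infinity>" by (simp add: ennreal_mult_less_top)
  finally show ?thesis .
qed

lemma poly_envelope_nonneg: "0 \<le> poly_envelope a b u"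
  by (simp add: poly_envelope_def)

lemma measurable_poly_envelope [measurable]: "poly_envelope a b \<in> borel_measurable borel"
  unfolding poly_envelope_def by measurable

text \<open>The maximum makes the second power at least as integrable at 0 as the first.\<close>

lemma poly_envelope_le:
  assumes "0 < u"
  shows "poly_envelope a b u \<le> u powr a + u powr (max a b)"
proof (cases "u \<le> 1")
  case False
  then have "u powr b \<le> u powr (max a b)" by (intro powr_mono) auto
  then show ?thesis using False by (simp add: poly_envelope_def add_increasing)
qed (simp add: poly_envelope_def)

lemma envelope_integral_finite:
  assumes k: "1 \<le> k" "- a < real k" and e: "0 \<le> e" and c: "0 < c"
  shows "(\<integral>\<^sup>+u. ennreal (poly_envelope a b u * u ^ (k - 1) * exp (- (c * u)) * u powr e) * indicator {0<..} u \<partial>lborel) < \<infinity>"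
proof -
  let ?g = "\<lambda>a u. ennreal (u powr (a + real k + e - 1) * exp (- (c * u))) * indicator {0<..} u"
  have eq: "u powr a' * u ^ (k - 1) * u powr e = u powr (a' + real k + e - 1)" if "0 < u" for u a' :: real
  proof -
    have "u ^ (k - 1) = u powr (real k - 1)" using that k by (simp add: powr_realpow[symmetric] of_nat_diff)
    then show ?thesis using that by (simp add: powr_add[symmetric] algebra_simps)
  qed
  have le: "ennreal (poly_envelope a b u * u ^ (k - 1) * exp (- (c * u)) * u powr e) * indicator {0<..} u
      \<le> ?g a u + ?g (max a b) u" for u
  proof (cases "0 < u")
    case True
    have "poly_envelope a b u * (u ^ (k - 1) * u powr e * exp (- (c * u)))
        \<le> (u powr a + u powr (max a b)) * (u ^ (k - 1) * u powr e * exp (- (c * u)))"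
      using True poly_envelope_le by (intro mult_right_mono) auto
    also have "\<dots> = (u powr a * u ^ (k - 1) * u powr e) * exp (- (c * u))
        + (u powr max a b * u ^ (k - 1) * u powr e) * exp (- (c * u))"
      by (simp add: algebra_simps)
    finally have "poly_envelope a b u * u ^ (k - 1) * exp (- (c * u)) * u powr e
       \<le> u powr (a + real k + e - 1) * exp (- (c * u)) + u powr (max a b + real k + e - 1) * exp (- (c * u))"
      unfolding eq[OF True] by (simp add: mult_ac)
    then show ?thesis using True by (simp add: ennreal_plus[symmetric] del: ennreal_plus)
  qed simp
  have "(\<integral>\<^sup>+u. ennreal (poly_envelope a b u * u ^ (k - 1) * exp (- (c * u)) * u powr e) * indicator {0<..} u \<partial>lborel)
    \<le> (\<integral>\<^sup>+u. ?g a u + ?g (max a b) u \<partial>lborel)"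
    by (intro nn_integral_mono le)
  also have "\<dots> = (\<integral>\<^sup>+u. ?g a u \<partial>lborel) + (\<integral>\<^sup>+u. ?g (max a b) u \<partial>lborel)"
    by (rule nn_integral_add) auto
  also have "\<dots> < \<infinity>"
    using nn_integral_powr_exp_finite[of "a + real k + e" c] nn_integral_powr_exp_finite[of "max a b + real k + e" c] k e c
    by (simp add: algebra_simps)
  finally show ?thesis .
qed

definition ball_volume :: "'a::euclidean_space itself \<Rightarrow> real \<Rightarrow> real" where
  "ball_volume _ r = (if 0 \<le> r then unit_ball_vol (real DIM('a)) * r ^ DIM('a) else 0)"

lemma measure_ball_volume: "measure lborel (ball x r) = ball_volume TYPE('a) r" for x :: "'a::euclidean_space"
proof (cases "0 \<le> r")
  case False
  then have "ball x r = {}" by simp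
  then show ?thesis using False by (simp add: ball_volume_def)
qed (simp add: ball_volume_def measure_def emeasure_ball)

section \<open>Regularity of the density along coordinate axes\<close>

text \<open>For \<open>\<sigma> \<le> 1\<close> this is the hypothesis itself. For \<open>\<sigma> > 1\<close> the first partial derivatives have a finite modulus
  on a bounded set, hence are bounded, and the mean value theorem on the segment gives a Lipschitz bound.
  The segment must lie in \<open>\<Omega>\<close>, which need not be connected.\<close>

lemma hoelder_along_axis:
  fixes g :: "'a::euclidean_space \<Rightarrow> real"
  assumes hg: "hoelder_continuous \<sigma> g \<Omega>" and \<sigma>: "0 < \<sigma>" "\<sigma> \<le> 2" and bd: "bounded \<Omega>"
  obtains L where "0 \<le> L"
    "\<And>x e t. \<lbrakk>e \<in> Basis; 0 < t; \<And>s. \<lbrakk>0 \<le> s; s \<le> t\<rbrakk> \<Longrightarrow> x + s *\<^sub>R e \<in> \<Omega>\<rbrakk>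
       \<Longrightarrow> \<bar>g (x + t *\<^sub>R e) - g x\<bar> \<le> L * t powr (min \<sigma> 1)"
proof -
  define \<kappa> where "\<kappa> = nat (\<lceil>\<sigma>\<rceil> - 1)"
  have cd: "cont_differentiable_upto \<kappa> g \<Omega>"
    and bdd: "bdd_above {\<bar>partial_deriv es g y - partial_deriv es g z\<bar> / norm (y - z) powr (\<sigma> - real \<kappa>)
          | es y z. set es \<subseteq> Basis \<and> length es = \<kappa> \<and> y \<in> \<Omega> \<and> z \<in> \<Omega> \<and> y \<noteq> z}"
    using hg by (auto simp: hoelder_continuous_def \<kappa>_def Let_def)
  from bdd obtain H0 where H0: "\<And>es y z. \<lbrakk>set es \<subseteq> Basis; length es = \<kappa>; y \<in> \<Omega>; z \<in> \<Omega>; y \<noteq> z\<rbrakk>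
      \<Longrightarrow> \<bar>partial_deriv es g y - partial_deriv es g z\<bar> / norm (y - z) powr (\<sigma> - real \<kappa>) \<le> H0"
    unfolding bdd_above_def by blast
  define H where "H = max H0 0"
  have H: "0 \<le> H" "\<bar>partial_deriv es g y - partial_deriv es g z\<bar> \<le> H * norm (y - z) powr (\<sigma> - real \<kappa>)"
    if "set es \<subseteq> Basis" "length es = \<kappa>" "y \<in> \<Omega>" "z \<in> \<Omega>" for es y z
  proof -
    show "0 \<le> H" by (simp add: H_def)
    show "\<bar>partial_deriv es g y - partial_deriv es g z\<bar> \<le> H * norm (y - z) powr (\<sigma> - real \<kappa>)"
    proof (cases "y = z")
      case False
      then have "norm (y - z) powr (\<sigma> - real \<kappa>) > 0" by simp
      then have "\<bar>partial_deriv es g y - partial_deriv es g z\<bar> \<le> H0 * norm (y - z) powr (\<sigma> - real \<kappa>)"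
        using H0[OF that False] by (simp add: pos_divide_le_eq)
      also have "\<dots> \<le> H * norm (y - z) powr (\<sigma> - real \<kappa>)"
        by (intro mult_right_mono) (auto simp: H_def)
      finally show ?thesis .
    qed (simp add: H_def)
  qed
  have H_nonneg: "0 \<le> H" by (simp add: H_def)
  show ?thesis
  proof (cases "\<sigma> \<le> 1")
    case True
    then have "\<lceil>\<sigma>\<rceil> = 1" using \<sigma> by (simp add: ceiling_eq_iff)
    then have k0: "\<kappa> = 0" by (simp add: \<kappa>_def)
    show ?thesis
    proof (rule that[OF H_nonneg])
      fix x e :: 'a and t :: real
      assume e: "e \<in> Basis" and t: "0 < t" and seg: "\<And>s. \<lbrakk>0 \<le> s; s \<le> t\<rbrakk> \<Longrightarrow> x + s *\<^sub>R e \<in> \<Omega>"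
      show "\<bar>g (x + t *\<^sub>R e) - g x\<bar> \<le> H * t powr min \<sigma> 1"
        using H(2)[of "[]" "x + t *\<^sub>R e" x] seg[of t] seg[of 0] t e k0 True by simp
    qed
  next
    case False
    then have "\<lceil>\<sigma>\<rceil> = 2" using \<sigma> by (simp add: ceiling_eq_iff)
    then have k1: "\<kappa> = 1" by (simp add: \<kappa>_def)
    obtain G where G: "0 \<le> G" "\<And>e y. \<lbrakk>e \<in> Basis; y \<in> \<Omega>\<rbrakk> \<Longrightarrow> \<bar>partial_deriv [e] g y\<bar> \<le> G"
    proof (cases "\<Omega> = {}")
      case True
      then show ?thesis using that[of 0] by simp
    next
      case False
      then obtain z0 where z0: "z0 \<in> \<Omega>" by blast
      define G where "G = (\<Sum>b\<in>Basis. \<bar>partial_deriv [b] g z0\<bar>) + H * diameter \<Omega> powr (\<sigma> - 1)"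
      show ?thesis
      proof (rule that[of G])
        show "0 \<le> G" using H_nonneg by (auto simp: G_def intro!: add_nonneg_nonneg sum_nonneg)
        fix e y :: 'a
        assume e: "e \<in> Basis" and y: "y \<in> \<Omega>"
        have "\<bar>partial_deriv [e] g y\<bar> \<le> \<bar>partial_deriv [e] g z0\<bar> + \<bar>partial_deriv [e] g y - partial_deriv [e] g z0\<bar>"
          by linarith
        also have "\<bar>partial_deriv [e] g z0\<bar> \<le> (\<Sum>b\<in>Basis. \<bar>partial_deriv [b] g z0\<bar>)"
          using e by (intro member_le_sum) auto
        also have "\<bar>partial_deriv [e] g y - partial_deriv [e] g z0\<bar> \<le> H * norm (y - z0) powr (\<sigma> - 1)"
          using H(2)[of "[e]" y z0] e y z0 k1 by simp
        also have "\<dots> \<le> H * diameter \<Omega> powr (\<sigma> - 1)"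
          using diameter_bounded_bound[OF bd y z0] False H_nonneg \<open>\<not> \<sigma> \<le> 1\<close>
          by (intro mult_left_mono powr_mono2) (auto simp: dist_norm)
        finally show "\<bar>partial_deriv [e] g y\<bar> \<le> G" by (simp add: G_def)
      qed
    qed
    show ?thesis
    proof (rule that[OF G(1)])
      fix x e :: 'a and t :: real
      assume e: "e \<in> Basis" and t: "0 < t" and seg: "\<And>s. \<lbrakk>0 \<le> s; s \<le> t\<rbrakk> \<Longrightarrow> x + s *\<^sub>R e \<in> \<Omega>"
      define w where "w s = g (x + s *\<^sub>R e)" for s
      have der: "(w has_real_derivative partial_deriv [e] g (x + s *\<^sub>R e)) (at s)" if s: "0 \<le> s" "s \<le> t" for s
      proof -
        have "(\<lambda>r::real. partial_deriv [] g ((x + s *\<^sub>R e) + r *\<^sub>R e)) differentiable (at 0)"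
          using cd e seg[OF s] k1 unfolding cont_differentiable_upto_def by (metis empty_subsetI length_0_conv list.set(1) zero_less_one)
        then have "(\<lambda>r. w (s + r)) differentiable (at 0)"
          by (simp add: w_def algebra_simps)
        then have d: "((\<lambda>r. w (s + r)) has_real_derivative deriv (\<lambda>r. w (s + r)) 0) (at 0)"
          using DERIV_deriv_iff_real_differentiable by blast
        have dd: "deriv (\<lambda>r. w (s + r)) 0 = partial_deriv [e] g (x + s *\<^sub>R e)"
          by (simp add: w_def algebra_simps)
        have "(w has_real_derivative deriv (\<lambda>r. w (s + r)) 0) (at (0 + s))"
          unfolding DERIV_shift using d by (simp only: add.commute)
        then show ?thesis unfolding dd by simp
      qed
      have "\<exists>z. 0 < z \<and> z < t \<and> w t - w 0 = (t - 0) * partial_deriv [e] g (x + z *\<^sub>R e)"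
        using t der by (intro MVT2) auto
      then obtain z where z: "0 < z" "z < t" "w t - w 0 = t * partial_deriv [e] g (x + z *\<^sub>R e)" by auto
      have "\<bar>g (x + t *\<^sub>R e) - g x\<bar> = t * \<bar>partial_deriv [e] g (x + z *\<^sub>R e)\<bar>"
        using z t by (simp add: w_def abs_mult)
      also have "\<dots> \<le> t * G" using t z G(2)[OF e seg[of z]] by (intro mult_left_mono) auto
      finally show "\<bar>g (x + t *\<^sub>R e) - g x\<bar> \<le> G * t powr min \<sigma> 1"
        using t False by (simp add: mult.commute)
    qed
  qed
qed

text \<open>A cover of \<open>F\<close> by sets of diameter at most \<open>t\<close> is chosen for the given \<open>t\<close>. A set of diameter \<open>\<delta>\<close> lies in a cube of
  side \<open>2 * \<delta>\<close>; the base points of segments that hit the cube fill a box that is longer by \<open>t\<close> in one direction, of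
  volume \<open>(2 * \<delta>)^(d-1) * (2 * \<delta> + t) \<le> 3 * t * (2 * \<delta>)^(d-1)\<close>. The sum of these volumes is controlled by the
  Hausdorff sum in dimension \<open>d - 1\<close>.\<close>

lemma hausdorff_sweep:
  fixes F :: "'a::euclidean_space set"
  assumes fin: "hausdorff_measure (DIM('a) - 1) F < \<infinity>"
  obtains C where "0 \<le> C"
    "\<And>e t. \<lbrakk>e \<in> Basis; 0 < t\<rbrakk> \<Longrightarrow> emeasure lborel {x. \<exists>s\<in>{0..t}. x + s *\<^sub>R e \<in> F} \<le> ennreal (C * t)"
proof -
  let ?d = "DIM('a) - 1"
  define H where "H = enn2real (hausdorff_measure ?d F) + 1"
  have H: "0 \<le> H" "hausdorff_measure ?d F < ennreal H"
  proof -
    show "0 \<le> H" by (simp add: H_def)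
    have "hausdorff_measure ?d F = ennreal (enn2real (hausdorff_measure ?d F))" using fin by simp
    also have "\<dots> < ennreal H" by (rule ennreal_lessI) (auto simp: H_def add_nonneg_pos)
    finally show "hausdorff_measure ?d F < ennreal H" .
  qed
  show ?thesis
  proof (rule that[of "3 * 2 ^ ?d * H"])
    show "0 \<le> 3 * 2 ^ ?d * H" using H by simp
    fix e :: 'a and t :: real
    assume e: "e \<in> Basis" and t: "0 < t"
    let ?\<U> = "{U :: nat \<Rightarrow> 'a set. F \<subseteq> (\<Union>i. U i) \<and> (\<forall>i. bounded (U i) \<and> diameter (U i) \<le> t)}"
    let ?w = "\<lambda>U :: nat \<Rightarrow> 'a set. \<lambda>i. if U i = {} then 0 else ennreal (diameter (U i) ^ ?d)"
    have "(INF U\<in>?\<U>. \<Sum>i. ?w U i) \<le> hausdorff_measure ?d F"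
      unfolding hausdorff_measure_def using t by (intro SUP_upper2[of t]) auto
    also note H(2)
    finally obtain U where U: "U \<in> ?\<U>" and wU: "(\<Sum>i. ?w U i) < ennreal H"
      unfolding INF_less_iff by blast
    have "\<forall>i. \<exists>z. U i \<noteq> {} \<longrightarrow> z \<in> U i" by auto
    then have "\<exists>z. \<forall>i. U i \<noteq> {} \<longrightarrow> z i \<in> U i" by (rule choice)
    then obtain z where z: "\<And>i. U i \<noteq> {} \<Longrightarrow> z i \<in> U i" by blast
    define \<delta> where "\<delta> i = diameter (U i)" for i
    have \<delta>: "0 \<le> \<delta> i" "\<delta> i \<le> t" for i
      using U by (auto simp: \<delta>_def diameter_ge_0)
    define B where "B i = (if U i = {} then {} else cbox (z i - \<delta> i *\<^sub>R One - t *\<^sub>R e) (z i + \<delta> i *\<^sub>R One))" for i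
    have sub: "{x. \<exists>s\<in>{0..t}. x + s *\<^sub>R e \<in> F} \<subseteq> (\<Union>i. B i)"
    proof safe
      fix x s assume s: "s \<in> {0..t}" and "x + s *\<^sub>R e \<in> F"
      then obtain i where i: "x + s *\<^sub>R e \<in> U i" using U by blast
      then have zi: "z i \<in> U i" using z by blast
      have "x \<in> B i"
      proof -
        have "(z i - \<delta> i *\<^sub>R One - t *\<^sub>R e) \<bullet> b \<le> x \<bullet> b \<and> x \<bullet> b \<le> (z i + \<delta> i *\<^sub>R One) \<bullet> b"
          if b: "b \<in> Basis" for b
        proof -
          have "dist (x + s *\<^sub>R e) (z i) \<le> \<delta> i"
            unfolding \<delta>_def using U i zi by (intro diameter_bounded_bound) auto
          then have "\<bar>(x + s *\<^sub>R e - z i) \<bullet> b\<bar> \<le> \<delta> i"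
            using Basis_le_norm[OF b, of "x + s *\<^sub>R e - z i"] by (simp add: dist_norm)
          then have "\<bar>x \<bullet> b + s * (e \<bullet> b) - z i \<bullet> b\<bar> \<le> \<delta> i" by (simp add: inner_simps)
          moreover have "0 \<le> s * (e \<bullet> b)" "s * (e \<bullet> b) \<le> t * (e \<bullet> b)"
            using s e b by (auto simp: inner_Basis)
          moreover have "One \<bullet> b = 1" using b by simp
          moreover have "(z i - \<delta> i *\<^sub>R One - t *\<^sub>R e) \<bullet> b = z i \<bullet> b - \<delta> i * (One \<bullet> b) - t * (e \<bullet> b)"
            "(z i + \<delta> i *\<^sub>R One) \<bullet> b = z i \<bullet> b + \<delta> i * (One \<bullet> b)"
            by (simp_all only: inner_simps real_scaleR_def inner_scaleR_left)
          ultimately show ?thesis by (simp only: mult_1_right) linarith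
        qed
        then show ?thesis using i by (auto simp: B_def mem_box)
      qed
      then show "x \<in> (\<Union>i. B i)" by blast
    qed
    have vol: "emeasure lborel (B i) \<le> ennreal (3 * 2 ^ ?d * t) * ?w U i" for i
    proof (cases "U i = {}")
      case False
      have "emeasure lborel (B i) = emeasure lborel (cbox (z i - \<delta> i *\<^sub>R One - t *\<^sub>R e) (z i + \<delta> i *\<^sub>R One))"
        using False by (simp add: B_def)
      also have "\<dots> = (\<Prod>b\<in>Basis. ((z i + \<delta> i *\<^sub>R One) - (z i - \<delta> i *\<^sub>R One - t *\<^sub>R e)) \<bullet> b)"
        using \<delta>[of i] t e by (intro emeasure_lborel_cbox) (auto simp: inner_simps inner_Basis)
      also have "(\<Prod>b\<in>Basis. ((z i + \<delta> i *\<^sub>R One) - (z i - \<delta> i *\<^sub>R One - t *\<^sub>R e)) \<bullet> b)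
          = (\<Prod>b\<in>Basis. if b = e then 2 * \<delta> i + t else 2 * \<delta> i)"
        using e by (intro prod.cong) (auto simp: inner_simps inner_Basis)
      also have "\<dots> = (2 * \<delta> i + t) * (2 * \<delta> i) ^ ?d"
        using e by (subst prod.remove[of _ e]) auto
      also have "\<dots> \<le> (3 * t) * (2 * \<delta> i) ^ ?d"
        using \<delta>[of i] by (intro mult_right_mono) auto
      also have "\<dots> = (3 * 2 ^ ?d * t) * \<delta> i ^ ?d" by (simp add: power_mult_distrib)
      finally have "emeasure lborel (B i) \<le> ennreal ((3 * 2 ^ ?d * t) * \<delta> i ^ ?d)"
        by (simp add: ennreal_leI)
      also have "\<dots> = ennreal (3 * 2 ^ ?d * t) * ennreal (\<delta> i ^ ?d)"
        using t \<delta> by (intro ennreal_mult) auto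
      finally show ?thesis using False by (simp add: \<delta>_def)
    qed (simp add: B_def)
    have "emeasure lborel {x. \<exists>s\<in>{0..t}. x + s *\<^sub>R e \<in> F} \<le> emeasure lborel (\<Union>i. B i)"
      using sub by (intro emeasure_mono) (auto simp: B_def)
    also have "\<dots> \<le> (\<Sum>i. emeasure lborel (B i))"
      by (intro emeasure_subadditive_countably) (auto simp: B_def)
    also have "\<dots> \<le> (\<Sum>i. ennreal (3 * 2 ^ ?d * t) * ?w U i)"
      using vol by (intro suminf_le) auto
    also have "\<dots> = ennreal (3 * 2 ^ ?d * t) * (\<Sum>i. ?w U i)"
      by (rule ennreal_suminf_cmult)
    also have "\<dots> \<le> ennreal (3 * 2 ^ ?d * t) * ennreal H"
      using wU by (intro mult_left_mono) auto
    also have "\<dots> = ennreal (3 * 2 ^ ?d * H * t)"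
      using t H by (simp add: ennreal_mult[symmetric] mult_ac)
    finally show "emeasure lborel {x. \<exists>s\<in>{0..t}. x + s *\<^sub>R e \<in> F} \<le> ennreal (3 * 2 ^ ?d * H * t)" .
  qed
qed

lemma closed_sweep:
  fixes F :: "'a::euclidean_space set"
  assumes "compact F"
  shows "closed {x. \<exists>s\<in>{0..t}. x + s *\<^sub>R e \<in> F}"
proof -
  have "{x. \<exists>s\<in>{0..t}. x + s *\<^sub>R e \<in> F} = (\<lambda>(y, s). y - s *\<^sub>R e) ` (F \<times> {0..t})"
    by (force simp: image_iff)
  moreover have "compact ((\<lambda>(y, s). y - s *\<^sub>R e) ` (F \<times> {0..t}))"
    using assms by (intro compact_continuous_image compact_Times) (auto simp: case_prod_beta intro!: continuous_intros)
  ultimately show ?thesis by (simp add: compact_imp_closed)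
qed

lemma nn_integral_translate:
  fixes g :: "'a::euclidean_space \<Rightarrow> ennreal"
  assumes [measurable]: "g \<in> borel_measurable borel"
  shows "(\<integral>\<^sup>+x. g (x + h) \<partial>lborel) = (\<integral>\<^sup>+x. g x \<partial>lborel)"
proof -
  have "(\<integral>\<^sup>+x. g x \<partial>lborel) = (\<integral>\<^sup>+x. g x \<partial>distr lborel borel ((+) h))"
    by (simp add: lborel_distr_plus)
  also have "\<dots> = (\<integral>\<^sup>+x. g (x + h) \<partial>lborel)"
    by (subst nn_integral_distr) (auto simp: add.commute)
  finally show ?thesis ..
qed

text \<open>What the modulus of continuity uses of a density: it is bounded, vanishes off a compact set, is Hoelder
  along segments in the interior, and few segments of a given length meet the boundary.\<close>

locale piecewise_hoelder_density =
  fixes q :: "'a::euclidean_space \<Rightarrow> real" and \<Omega> :: "'a set" and B L C \<tau> :: real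
  assumes measurable_q [measurable]: "q \<in> borel_measurable borel"
    and \<Omega>: "compact \<Omega>"
    and q_bounds: "\<And>x. 0 \<le> q x" "\<And>x. q x \<le> B"
    and q_outside: "\<And>x. x \<notin> \<Omega> \<Longrightarrow> q x = 0"
    and L: "0 \<le> L" and \<tau>: "0 < \<tau>" "\<tau> \<le> 1"
    and q_axis: "\<And>x e t. \<lbrakk>e \<in> Basis; 0 < t; \<And>s. \<lbrakk>0 \<le> s; s \<le> t\<rbrakk> \<Longrightarrow> x + s *\<^sub>R e \<in> interior \<Omega>\<rbrakk>
       \<Longrightarrow> \<bar>q (x + t *\<^sub>R e) - q x\<bar> \<le> L * t powr \<tau>"
    and C: "0 \<le> C"
    and sweep: "\<And>e t. \<lbrakk>e \<in> Basis; 0 < t\<rbrakk>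
       \<Longrightarrow> emeasure lborel {x. \<exists>s\<in>{0..t}. x + s *\<^sub>R e \<in> frontier \<Omega>} \<le> ennreal (C * t)"
begin

lemma B_nonneg: "0 \<le> B"
  using q_bounds order.trans by blast

definition support_volume where "support_volume = measure lborel \<Omega>"

lemma emeasure_\<Omega>: "emeasure lborel \<Omega> = ennreal support_volume"
  using emeasure_compact_finite[OF \<Omega>] by (simp add: support_volume_def emeasure_eq_ennreal_measure)

lemma support_volume_nonneg: "0 \<le> support_volume"
  by (simp add: support_volume_def)

lemma \<Omega>_sets [measurable]: "\<Omega> \<in> sets borel"
  using \<Omega> by (simp add: borel_closed compact_imp_closed)

definition modulus_const where "modulus_const = B * C + L * support_volume + 2 * B * support_volume"

lemma modulus_const_nonneg: "0 \<le> modulus_const"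
  using B_nonneg C L support_volume_nonneg by (simp add: modulus_const_def)

text \<open>For \<open>t \<le> 1\<close> the segments that meet the boundary contribute \<open>B * C * t\<close> and the others the Hoelder bound. For
  \<open>t > 1\<close> the trivial bound by twice the integral of the density is enough.\<close>

lemma axis_modulus_pos:
  assumes e: "e \<in> Basis" and t: "0 < t"
  shows "(\<integral>\<^sup>+x. ennreal \<bar>q (x + t *\<^sub>R e) - q x\<bar> \<partial>lborel) \<le> ennreal (modulus_const * t powr \<tau>)"
proof (cases "t \<le> 1")
  case True
  let ?S = "{x. \<exists>s\<in>{0..t}. x + s *\<^sub>R e \<in> frontier \<Omega>}"
  have [measurable]: "?S \<in> sets borel"
    using closed_sweep[of "frontier \<Omega>" t e] \<Omega> by (simp add: compact_frontier borel_closed)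
  have le: "ennreal \<bar>q (x + t *\<^sub>R e) - q x\<bar>
      \<le> ennreal B * indicator ?S x + ennreal (L * t powr \<tau>) * indicator \<Omega> x" for x
  proof (cases "x \<in> ?S")
    case True
    have "\<bar>q (x + t *\<^sub>R e) - q x\<bar> \<le> B"
      using q_bounds[of x] q_bounds[of "x + t *\<^sub>R e"] by linarith
    then have "ennreal \<bar>q (x + t *\<^sub>R e) - q x\<bar> \<le> ennreal B" by (rule ennreal_leI)
    then show ?thesis using True by (simp add: add_increasing2)
  next
    case False
    define S where "S = (\<lambda>s. x + s *\<^sub>R e) ` {0..t}"
    have "connected S" unfolding S_def by (intro connected_continuous_image continuous_intros) auto
    moreover have "S \<inter> frontier \<Omega> = {}" using False by (auto simp: S_def)
    ultimately consider "S \<inter> \<Omega> = {}" | "S \<subseteq> \<Omega>"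
      using connected_Int_frontier by blast
    then show ?thesis
    proof cases
      case 1
      have "x + 0 *\<^sub>R e \<in> S" "x + t *\<^sub>R e \<in> S" using t unfolding S_def by (intro imageI; simp)+
      then have "q x = 0" "q (x + t *\<^sub>R e) = 0" using 1 by (auto intro!: q_outside)
      then show ?thesis by simp
    next
      case 2
      have int: "S \<subseteq> interior \<Omega>"
        using 2 \<open>S \<inter> frontier \<Omega> = {}\<close> closure_subset[of \<Omega>] by (auto simp: frontier_def)
      have "\<bar>q (x + t *\<^sub>R e) - q x\<bar> \<le> L * t powr \<tau>"
        by (rule q_axis[OF e t]) (use int[unfolded S_def, THEN subsetD, OF imageI] in simp)
      moreover have "x \<in> \<Omega>" using 2 t by (force simp: S_def)
      ultimately show ?thesis by (simp add: ennreal_leI add_increasing)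
    qed
  qed
  have "(\<integral>\<^sup>+x. ennreal \<bar>q (x + t *\<^sub>R e) - q x\<bar> \<partial>lborel)
      \<le> (\<integral>\<^sup>+x. ennreal B * indicator ?S x + ennreal (L * t powr \<tau>) * indicator \<Omega> x \<partial>lborel)"
    by (intro nn_integral_mono le)
  also have "\<dots> = ennreal B * emeasure lborel ?S + ennreal (L * t powr \<tau>) * emeasure lborel \<Omega>"
    by (subst nn_integral_add) (auto simp: nn_integral_cmult_indicator)
  also have "\<dots> \<le> ennreal B * ennreal (C * t) + ennreal (L * t powr \<tau>) * ennreal support_volume"
    using sweep[OF e t] by (intro add_mono mult_left_mono) (auto simp: emeasure_\<Omega>)
  also have "\<dots> = ennreal (B * (C * t) + L * t powr \<tau> * support_volume)"
    using B_nonneg C t L support_volume_nonneg by (simp add: ennreal_mult[symmetric] ennreal_plus[symmetric] del: ennreal_plus)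
  also have "\<dots> \<le> ennreal (modulus_const * t powr \<tau>)"
  proof (rule ennreal_leI)
    have "t powr 1 \<le> t powr \<tau>" using t True \<tau> by (intro powr_mono') auto
    then have "B * (C * t) \<le> B * (C * t powr \<tau>)" using t B_nonneg C by (intro mult_left_mono) auto
    moreover have "0 \<le> 2 * B * support_volume * t powr \<tau>" using B_nonneg support_volume_nonneg by simp
    ultimately show "B * (C * t) + L * t powr \<tau> * support_volume \<le> modulus_const * t powr \<tau>"
      by (simp add: modulus_const_def algebra_simps)
  qed
  finally show ?thesis .
next
  case False
  have le: "ennreal \<bar>q (x + t *\<^sub>R e) - q x\<bar>
      \<le> ennreal B * indicator \<Omega> (x + t *\<^sub>R e) + ennreal B * indicator \<Omega> x" for x
    using q_bounds[of x] q_bounds[of "x + t *\<^sub>R e"] q_outside[of x] q_outside[of "x + t *\<^sub>R e"] B_nonneg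
    by (auto simp: indicator_def ennreal_plus[symmetric] simp del: ennreal_plus intro!: ennreal_leI)
  have "(\<integral>\<^sup>+x. ennreal \<bar>q (x + t *\<^sub>R e) - q x\<bar> \<partial>lborel)
      \<le> (\<integral>\<^sup>+x. ennreal B * indicator \<Omega> (x + t *\<^sub>R e) + ennreal B * indicator \<Omega> x \<partial>lborel)"
    by (intro nn_integral_mono le)
  also have "\<dots> = (\<integral>\<^sup>+x. ennreal B * indicator \<Omega> (x + t *\<^sub>R e) \<partial>lborel) + (\<integral>\<^sup>+x. ennreal B * indicator \<Omega> x \<partial>lborel)"
    by (rule nn_integral_add) auto
  also have "(\<integral>\<^sup>+x. ennreal B * indicator \<Omega> (x + t *\<^sub>R e) \<partial>lborel) = (\<integral>\<^sup>+x. ennreal B * indicator \<Omega> x \<partial>lborel)"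
    by (rule nn_integral_translate) auto
  also have "(\<integral>\<^sup>+x. ennreal B * indicator \<Omega> x \<partial>lborel) = ennreal (B * support_volume)"
    using B_nonneg support_volume_nonneg by (simp add: nn_integral_cmult_indicator emeasure_\<Omega> ennreal_mult)
  also have "ennreal (B * support_volume) + ennreal (B * support_volume) = ennreal (2 * B * support_volume)"
    using B_nonneg support_volume_nonneg by (simp add: ennreal_plus[symmetric] del: ennreal_plus)
  also have "\<dots> \<le> ennreal (modulus_const * t powr \<tau>)"
  proof (rule ennreal_leI)
    have "2 * B * support_volume * 1 \<le> modulus_const * t powr \<tau>"
      using False \<tau> B_nonneg support_volume_nonneg C L by (intro mult_mono ge_one_powr_ge_zero) (auto simp: modulus_const_def)
    then show "2 * B * support_volume \<le> modulus_const * t powr \<tau>" by simp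
  qed
  finally show ?thesis .
qed

lemma axis_modulus:
  assumes e: "e \<in> Basis"
  shows "(\<integral>\<^sup>+x. ennreal \<bar>q (x + t *\<^sub>R e) - q x\<bar> \<partial>lborel) \<le> ennreal (modulus_const * \<bar>t\<bar> powr \<tau>)"
proof -
  consider "t = 0" | "0 < t" | "t < 0" by linarith
  then show ?thesis
  proof cases
    case 3
    have "(\<integral>\<^sup>+x. ennreal \<bar>q (x + t *\<^sub>R e) - q x\<bar> \<partial>lborel)
       = (\<integral>\<^sup>+x. ennreal \<bar>q ((x + (- t) *\<^sub>R e) + t *\<^sub>R e) - q (x + (- t) *\<^sub>R e)\<bar> \<partial>lborel)"
      by (rule nn_integral_translate[symmetric]) auto
    also have "\<dots> = (\<integral>\<^sup>+x. ennreal \<bar>q (x + (- t) *\<^sub>R e) - q x\<bar> \<partial>lborel)"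
      by (simp add: abs_minus_commute)
    finally show ?thesis using axis_modulus_pos[OF e, of "- t"] 3 by simp
  qed (use axis_modulus_pos[OF e, of t] in auto)
qed

text \<open>A displacement is decomposed into its coordinates; the integral is invariant under translation, so the
  increments along the axes add up.\<close>

lemma L1_modulus:
  "(\<integral>\<^sup>+x. ennreal \<bar>q (x + h) - q x\<bar> \<partial>lborel) \<le> ennreal (real DIM('a) * modulus_const * norm h powr \<tau>)"
proof -
  have *: "(\<integral>\<^sup>+x. ennreal \<bar>q (x + (\<Sum>b\<in>S. (h \<bullet> b) *\<^sub>R b)) - q x\<bar> \<partial>lborel)
      \<le> ennreal (real (card S) * (modulus_const * norm h powr \<tau>))" if "finite S" "S \<subseteq> Basis" for S
    using that
  proof (induction S rule: finite_induct)
    case empty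
    then show ?case by simp
  next
    case (insert b S)
    let ?g = "\<Sum>b\<in>S. (h \<bullet> b) *\<^sub>R b"
    have "(\<integral>\<^sup>+x. ennreal \<bar>q (x + (\<Sum>b\<in>insert b S. (h \<bullet> b) *\<^sub>R b)) - q x\<bar> \<partial>lborel)
       = (\<integral>\<^sup>+x. ennreal \<bar>q ((x + ?g) + (h \<bullet> b) *\<^sub>R b) - q x\<bar> \<partial>lborel)"
      using insert by (simp add: add_ac)
    also have "\<dots> \<le> (\<integral>\<^sup>+x. ennreal \<bar>q ((x + ?g) + (h \<bullet> b) *\<^sub>R b) - q (x + ?g)\<bar>
        + ennreal \<bar>q (x + ?g) - q x\<bar> \<partial>lborel)"
      by (intro nn_integral_mono) (auto simp: ennreal_plus[symmetric] simp del: ennreal_plus intro!: ennreal_leI)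
    also have "\<dots> = (\<integral>\<^sup>+x. ennreal \<bar>q ((x + ?g) + (h \<bullet> b) *\<^sub>R b) - q (x + ?g)\<bar> \<partial>lborel)
        + (\<integral>\<^sup>+x. ennreal \<bar>q (x + ?g) - q x\<bar> \<partial>lborel)"
      by (rule nn_integral_add) auto
    also have "(\<integral>\<^sup>+x. ennreal \<bar>q ((x + ?g) + (h \<bullet> b) *\<^sub>R b) - q (x + ?g)\<bar> \<partial>lborel)
        = (\<integral>\<^sup>+x. ennreal \<bar>q (x + (h \<bullet> b) *\<^sub>R b) - q x\<bar> \<partial>lborel)"
      by (rule nn_integral_translate) auto
    also have "\<dots> \<le> ennreal (modulus_const * \<bar>h \<bullet> b\<bar> powr \<tau>)" using insert by (intro axis_modulus) auto
    also have "\<dots> \<le> ennreal (modulus_const * norm h powr \<tau>)"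
      using insert \<tau> modulus_const_nonneg by (intro ennreal_leI mult_left_mono powr_mono2 Basis_le_norm) auto
    also have "(\<integral>\<^sup>+x. ennreal \<bar>q (x + ?g) - q x\<bar> \<partial>lborel) \<le> ennreal (real (card S) * (modulus_const * norm h powr \<tau>))"
      using insert by simp
    also have "ennreal (modulus_const * norm h powr \<tau>) + ennreal (real (card S) * (modulus_const * norm h powr \<tau>))
       = ennreal (real (card (insert b S)) * (modulus_const * norm h powr \<tau>))"
      using insert modulus_const_nonneg by (simp add: ennreal_plus[symmetric] algebra_simps del: ennreal_plus)
    finally show ?case by (simp add: add_right_mono)
  qed
  from *[of Basis] show ?thesis by (simp add: euclidean_representation mult.assoc)
qed

end

section \<open>Bias of the weighted integral\<close>

lemma sets_ball [measurable]: "ball (x :: 'a::euclidean_space) r \<in> sets borel"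
  by simp

text \<open>Densities that are measurable, nonnegative and normalized at every point, so that no null sets
  have to be carried along.\<close>

locale borel_density =
  fixes q :: "'a::euclidean_space \<Rightarrow> real"
  assumes measurable_q [measurable]: "q \<in> borel_measurable borel"
    and q_nonneg: "\<And>x. 0 \<le> q x"
    and q_prob: "(\<integral>\<^sup>+x. ennreal (q x) \<partial>lborel) = 1"
begin

abbreviation lborel2 :: "('a \<times> 'a) measure" where
  "lborel2 \<equiv> lborel \<Otimes>\<^sub>M lborel"

definition ball_mass :: "'a \<Rightarrow> 'a \<Rightarrow> real" where
  "ball_mass x h = measure (density lborel (\<lambda>y. ennreal (q y))) (ball x (norm h))"

lemma integrable_q: "integrable lborel q"
  using q_nonneg q_prob by (intro integrableI_nonneg) auto

lemma ball_mass_eq: "ball_mass x h = (\<integral>y. q y * indicator (ball x (norm h)) y \<partial>lborel)"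
proof -
  have "emeasure (density lborel (\<lambda>y. ennreal (q y))) (ball x (norm h))
      = (\<integral>\<^sup>+y. ennreal (q y * indicator (ball x (norm h)) y) \<partial>lborel)"
    by (subst emeasure_density) (auto intro!: nn_integral_cong simp: indicator_def)
  also have "\<dots> = ennreal (\<integral>y. q y * indicator (ball x (norm h)) y \<partial>lborel)"
    using integrable_q q_nonneg
    by (intro nn_integral_eq_integral integrable_real_mult_indicator) auto
  finally show ?thesis
    using q_nonneg by (simp add: ball_mass_def measure_def integral_nonneg_AE)
qed

lemma measurable_ball_mass [measurable]:
  "(\<lambda>z. ball_mass (fst z) (snd z)) \<in> borel_measurable (borel \<Otimes>\<^sub>M borel)"
proof -
  have "(\<lambda>z. ball_mass (fst z) (snd z)) =
      (\<lambda>z. \<integral>y. (if dist (fst z) y < norm (snd z) then q y else 0) \<partial>lborel)"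
    by (auto simp: ball_mass_eq fun_eq_iff indicator_def intro!: Bochner_Integration.integral_cong)
  moreover have "(\<lambda>z::'a \<times> 'a. \<integral>y. (if dist (fst z) y < norm (snd z) then q y else 0) \<partial>lborel)
      \<in> borel_measurable (borel \<Otimes>\<^sub>M borel)"
    by measurable
  ultimately show ?thesis by simp
qed

lemma prob_space_q: "prob_space (density lborel (\<lambda>y. ennreal (q y)))"
  by (rule prob_spaceI) (simp add: emeasure_density q_prob)

lemma ball_mass_01: "0 \<le> ball_mass x h" "ball_mass x h \<le> 1"
proof -
  interpret P: prob_space "density lborel (\<lambda>y. ennreal (q y))" by (rule prob_space_q)
  show "0 \<le> ball_mass x h" "ball_mass x h \<le> 1" by (simp_all add: ball_mass_def)
qed

text \<open>The joint density, with respect to \<open>(x, h)\<close>, of a sample point \<open>x\<close> and the displacement \<open>h\<close> to its \<open>k\<close>-th nearest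
  neighbor among \<open>n\<close> further sample points.\<close>

definition knn_weight :: "nat \<Rightarrow> nat \<Rightarrow> 'a \<Rightarrow> 'a \<Rightarrow> real" where
  "knn_weight k n x h = real n * q x * q (x + h) * binomial_kernel k n (ball_mass x h)"

lemma measurable_knn_weight [measurable]:
  "(\<lambda>z. knn_weight k n (fst z) (snd z)) \<in> borel_measurable (borel \<Otimes>\<^sub>M borel)"
  unfolding knn_weight_def binomial_kernel_def by measurable

end

text \<open>The constant \<open>c\<close> bounds from below both the density on its support and the ratio of mass to volume
  of the balls around support points of radius up to \<open>D\<close>; beyond \<open>D\<close> there are no pairs of support points. The
  function \<open>\<phi>\<close> is extended by 0 to make it measurable on the whole line.\<close>

locale knn_bias = borel_density q
  for q :: "'a::euclidean_space \<Rightarrow> real" +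
  fixes B D c E \<tau> a b A :: real and k :: nat and \<phi> :: "real \<Rightarrow> real"
  assumes q_le: "\<And>x. q x \<le> B"
    and c: "0 < c" "c \<le> B" and D: "0 < D"
    and q_lower: "\<And>x. q x \<noteq> 0 \<Longrightarrow> c \<le> q x"
    and q_diam: "\<And>x h. \<lbrakk>q x \<noteq> 0; q (x + h) \<noteq> 0\<rbrakk> \<Longrightarrow> norm h \<le> D"
    and q_mass: "\<And>x (h::'a). \<lbrakk>q x \<noteq> 0; norm h \<le> D\<rbrakk>
      \<Longrightarrow> c * radial_volume h \<le> measure (density lborel (\<lambda>y. ennreal (q y))) (ball x (norm h))"
    and \<tau>: "0 < \<tau>" "\<tau> \<le> 1" and E: "0 \<le> E"
    and modulus: "\<And>h. (\<integral>\<^sup>+x. ennreal \<bar>q (x + h) - q x\<bar> \<partial>lborel) \<le> ennreal (E * norm h powr \<tau>)"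
    and k: "1 \<le> k" "- a < real k"
    and measurable_\<phi> [measurable]: "\<phi> \<in> borel_measurable borel"
    and \<phi>_zero: "\<And>u. u \<le> 0 \<Longrightarrow> \<phi> u = 0"
    and A: "0 \<le> A" and \<phi>_bound: "\<And>u. 0 < u \<Longrightarrow> \<bar>\<phi> u\<bar> \<le> A * poly_envelope a b u"
begin

lemmas q_bounds = q_nonneg q_le

lemma B_pos: "0 < B"
  using c by linarith

lemma ball_mass_shift:
  "ball_mass x h = (\<integral>z. q (x + z) * indicator (ball 0 (norm h)) z \<partial>lborel)"
proof -
  have "ball_mass x h = (\<integral>y. q y * indicator (ball x (norm h)) y \<partial>distr lborel borel ((+) x))"
    by (simp add: lborel_distr_plus ball_mass_eq)
  also have "\<dots> = (\<integral>z. q (x + z) * indicator (ball x (norm h)) (x + z) \<partial>lborel)"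
    by (subst integral_distr) auto
  also have "(\<lambda>z. q (x + z) * indicator (ball x (norm h)) (x + z)) = (\<lambda>z. q (x + z) * indicator (ball 0 (norm h)) z)"
    by (auto simp: indicator_def dist_norm fun_eq_iff)
  finally show ?thesis .
qed

lemma integrable_shift_indicator:
  "integrable lborel (\<lambda>z. q (x + z) * indicator (ball 0 (norm h)) z)"
proof -
  have "integrable (distr lborel borel ((+) x)) q" using integrable_q by (simp add: lborel_distr_plus)
  then have "integrable lborel (\<lambda>z. q (x + z))" by (subst (asm) integrable_distr_eq) auto
  then show ?thesis by (intro integrable_real_mult_indicator) auto
qed

lemma integrable_const_indicator: "integrable lborel (\<lambda>z. s * indicator (ball (0::'a) (norm (h::'a))) z :: real)"
  by (intro integrable_mult_right integrable_real_indicator) (auto simp: emeasure_ball_radial_volume)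

lemma integral_const_indicator: "(\<integral>z. s * indicator (ball (0::'a) (norm (h::'a))) z \<partial>lborel) = s * radial_volume h"
  by (simp add: measure_ball_radial_volume)

lemma ball_mass_le: "ball_mass x h \<le> B * radial_volume h"
proof -
  have "ball_mass x h \<le> (\<integral>z. B * indicator (ball (0::'a) (norm h)) z \<partial>lborel)"
    unfolding ball_mass_shift
    by (intro integral_mono integrable_shift_indicator integrable_const_indicator)
       (auto simp: indicator_def q_bounds)
  then show ?thesis by (simp only: integral_const_indicator)
qed

text \<open>The mass of the ball minus the density times the volume is an average of increments of the density over
  displacements shorter than \<open>h\<close>; Tonelli's theorem reduces it to the modulus of continuity.\<close>

lemma ball_mass_modulus:
  "(\<integral>\<^sup>+x. ennreal \<bar>ball_mass x h - q x * radial_volume h\<bar> \<partial>lborel)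
     \<le> ennreal (radial_volume h * (E * norm h powr \<tau>))"
proof -
  let ?I = "indicator (ball (0::'a) (norm h))"
  have "ennreal \<bar>ball_mass x h - q x * radial_volume h\<bar> \<le> (\<integral>\<^sup>+z. ennreal \<bar>q (x + z) - q x\<bar> * ?I z \<partial>lborel)" for x
  proof -
    have "ball_mass x h - q x * radial_volume h = (\<integral>z. q (x + z) * ?I z - q x * ?I z \<partial>lborel)"
      unfolding ball_mass_shift integral_const_indicator[symmetric]
      by (rule Bochner_Integration.integral_diff[symmetric, OF integrable_shift_indicator integrable_const_indicator])
    also have "ennreal \<bar>\<dots>\<bar> \<le> (\<integral>\<^sup>+z. ennreal (norm (q (x + z) * ?I z - q x * ?I z)) \<partial>lborel)"
      using integral_norm_bound_ennreal[OF Bochner_Integration.integrable_diff[OF integrable_shift_indicator integrable_const_indicator], of x h "q x" h]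
      by simp
    also have "\<dots> = (\<integral>\<^sup>+z. ennreal \<bar>q (x + z) - q x\<bar> * ?I z \<partial>lborel)"
      by (intro nn_integral_cong) (auto simp: indicator_def)
    finally show ?thesis .
  qed
  then have "(\<integral>\<^sup>+x. ennreal \<bar>ball_mass x h - q x * radial_volume h\<bar> \<partial>lborel)
      \<le> (\<integral>\<^sup>+x. (\<integral>\<^sup>+z. ennreal \<bar>q (x + z) - q x\<bar> * ?I z \<partial>lborel) \<partial>lborel)"
    by (intro nn_integral_mono)
  also have "\<dots> = (\<integral>\<^sup>+z. (\<integral>\<^sup>+x. ennreal \<bar>q (x + z) - q x\<bar> * ?I z \<partial>lborel) \<partial>lborel)"
    by (rule lborel_pair.Fubini'[symmetric]) measurable
  also have "\<dots> \<le> (\<integral>\<^sup>+z. ennreal (E * norm h powr \<tau>) * ?I z \<partial>lborel)"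
  proof (rule nn_integral_mono)
    fix z :: 'a
    have "(\<integral>\<^sup>+x. ennreal \<bar>q (x + z) - q x\<bar> * ?I z \<partial>lborel) = (\<integral>\<^sup>+x. ennreal \<bar>q (x + z) - q x\<bar> \<partial>lborel) * ?I z"
      by (rule nn_integral_multc) measurable
    also have "\<dots> \<le> ennreal (E * norm z powr \<tau>) * ?I z"
      by (intro mult_right_mono modulus) auto
    also have "\<dots> \<le> ennreal (E * norm h powr \<tau>) * ?I z"
    proof (cases "z \<in> ball 0 (norm h)")
      case True
      then have "E * norm z powr \<tau> \<le> E * norm h powr \<tau>"
        using E \<tau> by (intro mult_left_mono powr_mono2) auto
      then show ?thesis by (intro mult_right_mono ennreal_leI) auto
    qed auto
    finally show "(\<integral>\<^sup>+x. ennreal \<bar>q (x + z) - q x\<bar> * ?I z \<partial>lborel) \<le> ennreal (E * norm h powr \<tau>) * ?I z" .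
  qed
  also have "\<dots> = ennreal (E * norm h powr \<tau>) * ennreal (radial_volume h)"
    by (simp add: nn_integral_cmult_indicator emeasure_ball_radial_volume)
  also have "\<dots> = ennreal (radial_volume h * (E * norm h powr \<tau>))"
    using E radial_volume_nonneg[of h] by (simp add: ennreal_mult mult_ac)
  finally show ?thesis .
qed

text \<open>The weight under which \<open>u\<close>, given \<open>x\<close>, has the Gamma distribution of shape \<open>k\<close> and rate \<open>q x\<close>.\<close>

definition ideal_weight :: "nat \<Rightarrow> 'a \<Rightarrow> 'a \<Rightarrow> real" where
  "ideal_weight n x h = real n * q x * q x * poisson_kernel k (q x * (real n * radial_volume h))"

lemma measurable_ideal_weight [measurable]:
  "(\<lambda>z. ideal_weight n (fst z) (snd z)) \<in> borel_measurable (borel \<Otimes>\<^sub>M borel)"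
  unfolding ideal_weight_def poisson_kernel_def by measurable

lemma ideal_weight_le:
  assumes u: "u = real n * radial_volume h"
  shows "ideal_weight n x h \<le> real n * B ^ k * (u ^ (k - 1) * exp (- (c * u))) * q x"
proof (cases "q x = 0")
  case False
  have u0: "0 \<le> u" using u radial_volume_nonneg[of h] by simp
  have cq: "c * u \<le> q x * u" using q_lower[OF False] u0 by (intro mult_right_mono) auto
  have Bk: "B * B ^ (k - 1) = B ^ k" using k by (simp add: power_eq_if)
  have "poisson_kernel k (q x * u) \<le> (q x * u) ^ (k - 1) * exp (- (q x * u)) / 1"
    unfolding poisson_kernel_def using q_bounds u0 by (intro divide_left_mono) auto
  also have "\<dots> \<le> (B * u) ^ (k - 1) * exp (- (c * u))"
    using q_bounds[of x] u0 cq B_pos by (simp, intro mult_mono power_mono mult_right_mono) auto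
  finally have "q x * poisson_kernel k (q x * u) \<le> B * ((B * u) ^ (k - 1) * exp (- (c * u)))"
    using q_bounds[of x] u0 B_pos by (intro mult_mono) (auto intro!: poisson_kernel_nonneg)
  also have "\<dots> = B ^ k * (u ^ (k - 1) * exp (- (c * u)))"
    by (simp only: power_mult_distrib mult.assoc Bk[symmetric])
  finally have "(real n * q x) * (q x * poisson_kernel k (q x * u)) \<le> (real n * q x) * (B ^ k * (u ^ (k - 1) * exp (- (c * u))))"
    using q_bounds[of x] by (intro mult_left_mono) auto
  then show ?thesis by (simp add: ideal_weight_def u mult_ac)
qed (simp add: ideal_weight_def)

lemma ideal_weight_nonneg: "0 \<le> ideal_weight n x h"
  using q_bounds radial_volume_nonneg[of h] by (auto simp: ideal_weight_def intro!: mult_nonneg_nonneg poisson_kernel_nonneg)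

text \<open>If \<open>\<bar>h\<bar> \<le> D\<close>, the ball has mass comparable to its volume and the comparison of the kernels
  applies. If \<open>\<bar>h\<bar> > D\<close>, the first weight vanishes, and the second one is multiplied by
  \<open>(\<bar>h\<bar> / D) powr \<tau> \<ge> 1\<close> to fit the same bound.\<close>

lemma weight_diff:
  obtains K where "0 < K" "\<And>n h. \<lbrakk>k \<le> n; h \<noteq> 0\<rbrakk> \<Longrightarrow>
    (\<integral>\<^sup>+x. ennreal \<bar>knn_weight k n x h - ideal_weight n x h\<bar> \<partial>lborel)
      \<le> ennreal (real n * K * ((real n * radial_volume h) ^ (k - 1) * exp (- (c / 2 * (real n * radial_volume h))))
          * (norm h powr \<tau> + 1 / real n))"
proof -
  obtain K0 where K0: "0 < K0" and comp:
    "\<And>n q u z s t. \<lbrakk>k \<le> n; 0 \<le> q; q \<le> 1; 0 < u; c * u \<le> real n * q; real n * q \<le> B * u;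
       c * u \<le> z; z \<le> B * u; 0 \<le> s; 0 \<le> t\<rbrakk>
     \<Longrightarrow> \<bar>s * binomial_kernel k n q - t * poisson_kernel k z\<bar>
       \<le> K0 * u ^ (k - 1) * exp (- (c / 2 * u)) * (\<bar>s - t\<bar> + t / real n + t * \<bar>real n * q - z\<bar> / u)"
    using kernel_comparison[OF c k(1)] by metis
  define K1 where "K1 = K0 * (B * E + B + B * B * E)"
  define K2 where "K2 = B ^ k * D powr (- \<tau>)"
  have "0 < B * E + B" using B_pos E by (intro add_nonneg_pos) auto
  moreover have "0 \<le> B * B * E" using B_pos E by auto
  ultimately have K1: "0 < K1" unfolding K1_def using K0 by (intro mult_pos_pos) linarith+
  have K2: "0 < K2" using B_pos D by (simp add: K2_def)
  show ?thesis
  proof (rule that[of "K1 + K2"])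
    show "0 < K1 + K2" using K1 K2 by simp
    fix n and h :: 'a
    assume n: "k \<le> n" and h: "h \<noteq> 0"
    define u where "u = real n * radial_volume h"
    define w where "w = u ^ (k - 1) * exp (- (c / 2 * u))"
    have n0: "0 < real n" using n k by simp
    have rv: "0 < radial_volume h" using h by (rule radial_volume_pos)
    have u: "0 < u" using n0 rv by (simp add: u_def)
    have w: "0 \<le> w" using u by (simp add: w_def)
    let ?C1 = "real n * K0 * w * B" and ?C2 = "real n * K0 * w * (B / real n)"
      and ?C3 = "real n * K0 * w * (B * B / radial_volume h)"
      and ?e = "\<lambda>x. \<bar>ball_mass x h - q x * radial_volume h\<bar>"
      and ?g = "\<lambda>x. \<bar>q (x + h) - q x\<bar>" and ?\<Delta> = "\<lambda>x. \<bar>knn_weight k n x h - ideal_weight n x h\<bar>"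
      and ?\<epsilon> = "norm h powr \<tau>"
    have "(\<integral>\<^sup>+x. ennreal (?\<Delta> x) \<partial>lborel)
      \<le> ennreal (real n * (K1 + K2) * w * (?\<epsilon> + 1 / real n))"
    proof (cases "norm h \<le> D")
      case True
      have "ennreal (?\<Delta> x)
         \<le> ennreal (?C1) * ennreal (?g x)
          + ennreal (?C2) * ennreal (q x)
          + ennreal (?C3) * ennreal (?e x)" for x
      proof (cases "q x = 0")
        case False
        let ?m = "ball_mass x h"
        have "\<bar>q (x + h) * binomial_kernel k n ?m - q x * poisson_kernel k (q x * u)\<bar>
          \<le> K0 * u ^ (k - 1) * exp (- (c / 2 * u)) *
            ((?g x) + q x / real n + q x * \<bar>real n * ?m - q x * u\<bar> / u)"
        proof (rule comp)
          have "c * radial_volume h \<le> ?m" using q_mass[OF False True] by (simp add: ball_mass_def)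
          then have "real n * (c * radial_volume h) \<le> real n * ?m" by (intro mult_left_mono) auto
          then show "c * u \<le> real n * ?m" by (simp add: u_def mult_ac)
          have "real n * ?m \<le> real n * (B * radial_volume h)" by (intro mult_left_mono ball_mass_le) auto
          then show "real n * ?m \<le> B * u" by (simp add: u_def mult_ac)
          show "c * u \<le> q x * u" "q x * u \<le> B * u" using q_lower[OF False] q_bounds[of x] u by simp_all
        qed (use n u q_bounds ball_mass_01 in auto)
        also have "real n * ?m - q x * u = real n * (?m - q x * radial_volume h)"
          by (simp add: u_def algebra_simps)
        also have "\<bar>real n * (?m - q x * radial_volume h)\<bar> = real n * (?e x)"
          by (simp add: abs_mult)
        also have "q x * (real n * (?e x)) / u = q x * ((?e x) / radial_volume h)"
          using n0 by (simp add: u_def)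
        finally have 1: "\<bar>q (x + h) * binomial_kernel k n ?m - q x * poisson_kernel k (q x * u)\<bar>
          \<le> K0 * w * ((?g x) + q x / real n + q x * ((?e x) / radial_volume h))"
          by (simp add: w_def mult.assoc)
        have "(?\<Delta> x)
          = \<bar>real n * q x * (q (x + h) * binomial_kernel k n ?m - q x * poisson_kernel k (q x * u))\<bar>"
          by (simp add: knn_weight_def ideal_weight_def u_def algebra_simps)
        also have "\<dots> = real n * q x * \<bar>q (x + h) * binomial_kernel k n ?m - q x * poisson_kernel k (q x * u)\<bar>"
          using q_bounds[of x] by (simp add: abs_mult)
        also have "\<dots> \<le> real n * q x * (K0 * w * ((?g x) + q x / real n + q x * ((?e x) / radial_volume h)))"
          using q_bounds[of x] by (intro mult_left_mono 1) auto
        also have "\<dots> = real n * K0 * w * (q x * (?g x) + q x * (q x / real n) + q x * (q x * ((?e x) / radial_volume h)))"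
          by (simp add: algebra_simps)
        also have "\<dots> \<le> real n * K0 * w * (B * (?g x) + B * (q x / real n) + B * (B * ((?e x) / radial_volume h)))"
          using q_bounds[of x] K0 w n0 rv B_pos
          by (intro mult_left_mono add_mono mult_right_mono mult_mono) auto
        also have "\<dots> = ?C1 * (?g x) + ?C2 * q x
            + ?C3 * (?e x)"
          by (simp add: algebra_simps)
        finally have "ennreal (?\<Delta> x) \<le> ennreal (?C1 * (?g x) + ?C2 * q x
            + ?C3 * (?e x))"
          by (rule ennreal_leI)
        also have "\<dots> = ennreal (?C1) * ennreal (?g x)
          + ennreal (?C2) * ennreal (q x)
          + ennreal (?C3) * ennreal (?e x)"
        proof -
          have nn: "0 \<le> ?C1" "0 \<le> ?C2" "0 \<le> ?C3"
            using K0 w B_pos rv by auto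
          show ?thesis
            using nn q_bounds[of x] by (simp only: ennreal_mult'[symmetric] ennreal_plus[symmetric] mult_nonneg_nonneg abs_ge_zero add_nonneg_nonneg)
        qed
        finally show ?thesis .
      qed (simp add: knn_weight_def ideal_weight_def)
      then have "(\<integral>\<^sup>+x. ennreal (?\<Delta> x) \<partial>lborel)
         \<le> (\<integral>\<^sup>+x. ennreal (?C1) * ennreal (?g x)
          + ennreal (?C2) * ennreal (q x)
          + ennreal (?C3) * ennreal (?e x) \<partial>lborel)"
        by (intro nn_integral_mono)
      also have "\<dots> = ennreal (?C1) * (\<integral>\<^sup>+x. ennreal (?g x) \<partial>lborel)
          + ennreal (?C2) * (\<integral>\<^sup>+x. ennreal (q x) \<partial>lborel)
          + ennreal (?C3) * (\<integral>\<^sup>+x. ennreal (?e x) \<partial>lborel)"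
      proof -
        have [measurable]: "(\<lambda>x. ball_mass x h) \<in> borel_measurable borel"
          using measurable_compose[OF _ measurable_ball_mass, of "\<lambda>x. (x, h)" borel] by simp
        show ?thesis by (subst nn_integral_add, measurable)+ (simp add: nn_integral_cmult)
      qed
      also have "\<dots> \<le> ennreal (?C1) * ennreal (E * ?\<epsilon>)
          + ennreal (?C2) * 1
          + ennreal (?C3) * ennreal (radial_volume h * (E * ?\<epsilon>))"
        unfolding q_prob by (intro add_mono mult_left_mono modulus ball_mass_modulus) auto
      also have "\<dots> = ennreal (?C1 * (E * ?\<epsilon>) + ?C2
          + ?C3 * (radial_volume h * (E * ?\<epsilon>)))"
        using K0 w B_pos rv E by (simp add: ennreal_mult[symmetric] ennreal_plus[symmetric] del: ennreal_plus)
      also have "\<dots> \<le> ennreal (real n * (K1 + K2) * w * (?\<epsilon> + 1 / real n))"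
      proof (rule ennreal_leI)
        have "?C1 * (E * ?\<epsilon>) + ?C2
          + ?C3 * (radial_volume h * (E * ?\<epsilon>))
          = real n * w * K0 * ((B * E + B * B * E) * ?\<epsilon> + B * (1 / real n))"
          using rv by (simp add: algebra_simps)
        also have "\<dots> \<le> real n * w * K0 * ((B * E + B + B * B * E) * ?\<epsilon> + (B * E + B + B * B * E) * (1 / real n))"
          using w K0 B_pos E by (intro mult_left_mono add_mono mult_right_mono) auto
        also have "\<dots> = real n * w * K1 * (?\<epsilon> + 1 / real n)"
          by (simp add: K1_def algebra_simps)
        also have "\<dots> \<le> real n * w * (K1 + K2) * (?\<epsilon> + 1 / real n)"
          using w K2 by (intro mult_right_mono mult_left_mono) auto
        finally show "?C1 * (E * ?\<epsilon>) + ?C2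
          + ?C3 * (radial_volume h * (E * ?\<epsilon>))
          \<le> real n * (K1 + K2) * w * (?\<epsilon> + 1 / real n)" by (simp only: mult_ac)
      qed
      finally show ?thesis .
    next
      case False
      have Dh: "1 \<le> D powr (- \<tau>) * ?\<epsilon>"
      proof -
        have "D powr \<tau> \<le> ?\<epsilon>" using False D \<tau> by (intro powr_mono2) auto
        then have "D powr (- \<tau>) * D powr \<tau> \<le> D powr (- \<tau>) * ?\<epsilon>" by (intro mult_left_mono) auto
        then show ?thesis using D by (simp add: powr_add[symmetric])
      qed
      have "(?\<Delta> x) \<le> real n * B ^ k * w * q x" for x
      proof -
        have "q x = 0 \<or> q (x + h) = 0" using q_diam[of x h] False by blast
        then have "knn_weight k n x h = 0" by (auto simp: knn_weight_def)
        then have "(?\<Delta> x) = ideal_weight n x h" using ideal_weight_nonneg by simp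
        also have "\<dots> \<le> real n * B ^ k * (u ^ (k - 1) * exp (- (c * u))) * q x"
          by (rule ideal_weight_le) (simp add: u_def)
        also have "\<dots> \<le> real n * B ^ k * w * q x"
          unfolding w_def using c u B_pos q_bounds[of x]
          by (intro mult_right_mono mult_left_mono) (auto simp: field_simps)
        finally show ?thesis .
      qed
      then have "(\<integral>\<^sup>+x. ennreal (?\<Delta> x) \<partial>lborel)
          \<le> (\<integral>\<^sup>+x. ennreal (real n * B ^ k * w) * ennreal (q x) \<partial>lborel)"
        using B_pos w q_bounds by (intro nn_integral_mono) (simp add: ennreal_mult[symmetric] ennreal_leI)
      also have "\<dots> = ennreal (real n * B ^ k * w * 1)" by (simp add: nn_integral_cmult q_prob)
      also have "\<dots> \<le> ennreal (real n * (K1 + K2) * w * (?\<epsilon> + 1 / real n))"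
      proof (rule ennreal_leI)
        have "real n * B ^ k * w * 1 \<le> real n * B ^ k * w * (D powr (- \<tau>) * ?\<epsilon>)"
          using B_pos w Dh by (intro mult_left_mono) auto
        also have "\<dots> = real n * K2 * w * ?\<epsilon>" by (simp add: K2_def mult_ac)
        also have "\<dots> \<le> real n * (K1 + K2) * w * (?\<epsilon> + 1 / real n)"
          using K1 K2 w by (intro mult_mono) auto
        finally show "real n * B ^ k * w * 1 \<le> real n * (K1 + K2) * w * (?\<epsilon> + 1 / real n)" .
      qed
      finally show ?thesis .
    qed
    then show "(\<integral>\<^sup>+x. ennreal \<bar>knn_weight k n x h - ideal_weight n x h\<bar> \<partial>lborel)
      \<le> ennreal (real n * (K1 + K2) * ((real n * radial_volume h) ^ (k - 1) * exp (- (c / 2 * (real n * radial_volume h))))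
          * (norm h powr \<tau> + 1 / real n))" by (simp only: u_def w_def)
  qed
qed

end

context knn_bias
begin

lemma envelope_weight_finite:
  assumes "0 \<le> e" "0 < r"
  shows "(\<integral>\<^sup>+u. ennreal (poly_envelope a b u * u ^ (k - 1) * exp (- (r * u)) * u powr e) * indicator {0<..} u \<partial>lborel) < \<infinity>"
  using envelope_integral_finite[OF k assms] .

definition weighted :: "nat \<Rightarrow> ('a \<Rightarrow> 'a \<Rightarrow> real) \<Rightarrow> 'a \<times> 'a \<Rightarrow> real" where
  "weighted n W z = \<phi> (real n * radial_volume (snd z)) * W (fst z) (snd z)"

lemma AE_nonzero: "AE h in (lborel :: 'a measure). h \<noteq> 0"
  using AE_lborel_singleton by auto

text \<open>With \<open>\<bar>h\<bar> powr \<tau>\<close> expressed through \<open>u\<close>, the bound on the difference of the weights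
  becomes \<open>n powr (- \<tau> / d)\<close> times a fixed function of \<open>u\<close>. The factor \<open>n\<close> in the weights cancels in the substitution of \<open>u\<close> for \<open>h\<close>.\<close>

lemma bias_nn_integral:
  obtains K where "\<And>n. k \<le> n \<Longrightarrow>
    (\<integral>\<^sup>+z. ennreal \<bar>weighted n (knn_weight k n) z - weighted n (ideal_weight n) z\<bar> \<partial>lborel2)
      \<le> ennreal (K * real n powr (- \<tau> / real DIM('a)))"
proof -
  let ?W = "\<lambda>n z. weighted n (knn_weight k n) z - weighted n (ideal_weight n) z"
    and ?D = "\<lambda>n h. \<integral>\<^sup>+x. ennreal \<bar>knn_weight k n x h - ideal_weight n x h\<bar> \<partial>lborel"
  let ?d = "real DIM('a)" and ?v = "unit_ball_vol (real DIM('a))"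
  obtain K where K: "0 < K" and diff: "\<And>n h. \<lbrakk>k \<le> n; h \<noteq> 0\<rbrakk> \<Longrightarrow>
    ?D n h
      \<le> ennreal (real n * K * ((real n * radial_volume h) ^ (k - 1) * exp (- (c / 2 * (real n * radial_volume h))))
          * (norm h powr \<tau> + 1 / real n))"
    using weight_diff by blast
  define g where "g e u = poly_envelope a b u * u ^ (k - 1) * exp (- (c / 2 * u)) * u powr e" for e u
  define G where "G u = A * K * (?v powr (- \<tau> / ?d) * g (\<tau> / ?d) u + g 0 u)" for u
  have [measurable]: "g e \<in> borel_measurable borel" for e unfolding g_def by measurable
  have [measurable]: "G \<in> borel_measurable borel" unfolding G_def by measurable
  have g0: "0 \<le> g e u" if "0 < u" for e u using that by (simp add: g_def poly_envelope_nonneg)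
  have G0: "0 \<le> G u" if "0 < u" for u using g0[OF that] A K by (auto simp: G_def intro!: mult_nonneg_nonneg add_nonneg_nonneg)
  have "(\<integral>\<^sup>+u. ennreal (G u) * indicator {0<..} u \<partial>lborel)
    = (\<integral>\<^sup>+u. ennreal (A * K * ?v powr (- \<tau> / ?d)) * (ennreal (g (\<tau> / ?d) u) * indicator {0<..} u)
        + ennreal (A * K) * (ennreal (g 0 u) * indicator {0<..} u) \<partial>lborel)"
    using A K g0
    by (intro nn_integral_cong)
       (auto simp: indicator_def G_def ennreal_mult[symmetric] ennreal_plus[symmetric] algebra_simps simp del: ennreal_plus)
  also have "\<dots> = ennreal (A * K * ?v powr (- \<tau> / ?d)) * (\<integral>\<^sup>+u. ennreal (g (\<tau> / ?d) u) * indicator {0<..} u \<partial>lborel)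
        + ennreal (A * K) * (\<integral>\<^sup>+u. ennreal (g 0 u) * indicator {0<..} u \<partial>lborel)"
    by (subst nn_integral_add) (auto simp: nn_integral_cmult)
  also have "\<dots> < \<infinity>"
    using envelope_weight_finite[of "\<tau> / ?d" "c / 2"] envelope_weight_finite[of 0 "c / 2"] c \<tau>
    by (simp add: g_def ennreal_mult_less_top)
  finally obtain I where I: "0 \<le> I" "(\<integral>\<^sup>+u. ennreal (G u) * indicator {0<..} u \<partial>lborel) = ennreal I"
    by (cases "\<integral>\<^sup>+u. ennreal (G u) * indicator {0<..} u \<partial>lborel") auto
  show ?thesis
  proof (rule that[of I])
    fix n assume n: "k \<le> n"
    then have n0: "1 \<le> real n" using k by simp
    let ?s = "real n powr (- \<tau> / ?d)"
    have pt: "ennreal \<bar>\<phi> (real n * radial_volume h)\<bar> * ?D n h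
        \<le> ennreal (real n * ?s) * ennreal (G (real n * radial_volume h))" if h: "h \<noteq> 0" for h :: 'a
    proof -
      define u where "u = real n * radial_volume h"
      have u: "0 < u" using n0 radial_volume_pos[OF h] by (simp add: u_def)
      have hn: "norm h powr \<tau> = ?s * (?v powr (- \<tau> / ?d) * u powr (\<tau> / ?d))"
      proof -
        have "u powr (\<tau> / ?d) = real n powr (\<tau> / ?d) * (?v powr (\<tau> / ?d) * (norm h ^ DIM('a)) powr (\<tau> / ?d))"
          using n0 by (simp add: u_def radial_volume_def powr_mult)
        also have "(norm h ^ DIM('a)) powr (\<tau> / ?d) = norm h powr \<tau>"
          using h by (simp add: powr_realpow[symmetric] powr_powr)
        finally have "?s * (?v powr (- \<tau> / ?d) * u powr (\<tau> / ?d))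
          = (?s * real n powr (\<tau> / ?d)) * (?v powr (- \<tau> / ?d) * ?v powr (\<tau> / ?d)) * norm h powr \<tau>"
          by (simp only: mult_ac)
        also have "?s * real n powr (\<tau> / ?d) = 1" using n0 by (simp add: powr_add[symmetric])
        also have "?v powr (- \<tau> / ?d) * ?v powr (\<tau> / ?d) = 1" by (simp add: powr_add[symmetric] less_imp_neq[symmetric])
        finally show ?thesis by simp
      qed
      have n1: "1 / real n \<le> ?s"
      proof -
        have "1 \<le> ?d" using DIM_positive[where 'a = 'a] by (simp add: Suc_le_eq)
        then have "\<tau> \<le> ?d" using \<tau> by linarith
        then have "\<tau> / ?d \<le> 1" by (simp add: pos_divide_le_eq)
        then have "real n powr (- 1) \<le> ?s" using n0 by (intro powr_mono) auto
        then show ?thesis using n0 by (simp add: powr_minus_divide)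
      qed
      have "\<bar>\<phi> u\<bar> * (real n * K * (u ^ (k - 1) * exp (- (c / 2 * u))) * (norm h powr \<tau> + 1 / real n))
        \<le> (A * poly_envelope a b u) * (real n * K * (u ^ (k - 1) * exp (- (c / 2 * u)))
            * (?s * (?v powr (- \<tau> / ?d) * u powr (\<tau> / ?d)) + ?s))"
      proof (rule mult_mono)
        show "\<bar>\<phi> u\<bar> \<le> A * poly_envelope a b u" by (rule \<phi>_bound[OF u])
        have "norm h powr \<tau> + 1 / real n \<le> ?s * (?v powr (- \<tau> / ?d) * u powr (\<tau> / ?d)) + ?s"
          unfolding hn using n1 by (rule add_left_mono)
        then show "real n * K * (u ^ (k - 1) * exp (- (c / 2 * u))) * (norm h powr \<tau> + 1 / real n)
          \<le> real n * K * (u ^ (k - 1) * exp (- (c / 2 * u))) * (?s * (?v powr (- \<tau> / ?d) * u powr (\<tau> / ?d)) + ?s)"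
          using K u by (intro mult_left_mono) auto
      qed (use A K u in \<open>simp_all add: poly_envelope_nonneg\<close>)
      also have "\<dots> = real n * ?s * G u"
        using u by (simp add: G_def g_def algebra_simps)
      finally have "ennreal (\<bar>\<phi> u\<bar> * (real n * K * (u ^ (k - 1) * exp (- (c / 2 * u))) * (norm h powr \<tau> + 1 / real n)))
        \<le> ennreal (real n * ?s * G u)" by (rule ennreal_leI)
      moreover have "ennreal \<bar>\<phi> u\<bar> * ?D n h
        \<le> ennreal \<bar>\<phi> u\<bar> * ennreal (real n * K * (u ^ (k - 1) * exp (- (c / 2 * u))) * (norm h powr \<tau> + 1 / real n))"
        using diff[OF n h] by (intro mult_left_mono) (auto simp: u_def)
      ultimately show ?thesis
        using K u G0[OF u] by (simp add: ennreal_mult' ennreal_mult u_def[symmetric])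
    qed
    have "(\<integral>\<^sup>+z. ennreal \<bar>?W n z\<bar> \<partial>lborel2)
      = (\<integral>\<^sup>+h. (\<integral>\<^sup>+x. ennreal \<bar>?W n (x, h)\<bar> \<partial>lborel) \<partial>lborel)"
      by (rule lborel_pair.nn_integral_snd[symmetric]) (unfold weighted_def, measurable)
    also have "\<dots> = (\<integral>\<^sup>+h. ennreal \<bar>\<phi> (real n * radial_volume h)\<bar> * ?D n h \<partial>lborel)"
    proof (rule nn_integral_cong)
      fix h :: 'a
      have [measurable]: "(\<lambda>x. knn_weight k n x h) \<in> borel_measurable borel" "(\<lambda>x. ideal_weight n x h) \<in> borel_measurable borel"
        using measurable_compose[OF _ measurable_knn_weight, of "\<lambda>x. (x, h)" borel]
          measurable_compose[OF _ measurable_ideal_weight, of "\<lambda>x. (x, h)" borel] by simp_all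
      show "(\<integral>\<^sup>+x. ennreal \<bar>?W n (x, h)\<bar> \<partial>lborel)
        = ennreal \<bar>\<phi> (real n * radial_volume h)\<bar> * ?D n h"
        by (subst nn_integral_cmult[symmetric])
           (auto simp: weighted_def ennreal_mult[symmetric] abs_mult[symmetric] algebra_simps)
    qed
    also have "\<dots> \<le> (\<integral>\<^sup>+h. ennreal (real n * ?s) * ennreal (G (real n * radial_volume (h :: 'a))) \<partial>lborel)"
      by (rule nn_integral_mono_AE) (use AE_nonzero pt in auto)
    also have "\<dots> = ennreal (real n * ?s) * (\<integral>\<^sup>+h. ennreal (G (real n * radial_volume (h :: 'a))) \<partial>lborel)"
      by (rule nn_integral_cmult) measurable
    also have "(\<integral>\<^sup>+h. ennreal (G (real n * radial_volume (h :: 'a))) \<partial>lborel) = ennreal (1 / real n) * ennreal I"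
      using nn_integral_radial[where 'a = 'a, of "\<lambda>u. ennreal (G u)" "real n"] n0 I by simp
    also have "ennreal (real n * ?s) * (ennreal (1 / real n) * ennreal I) = ennreal (I * ?s)"
      using n0 I by (simp add: ennreal_mult[symmetric])
    finally show "(\<integral>\<^sup>+z. ennreal \<bar>?W n z\<bar> \<partial>lborel2)
      \<le> ennreal (I * ?s)" .
  qed
qed

lemma measurable_weighted [measurable]:
  "weighted n (knn_weight k n) \<in> borel_measurable (borel \<Otimes>\<^sub>M borel)"
  "weighted n (ideal_weight n) \<in> borel_measurable (borel \<Otimes>\<^sub>M borel)"
  unfolding weighted_def by measurable

text \<open>Integrability of the difference is part of the bias estimate, so integrability under the ideal weight
  is enough to obtain it under the other weight too.\<close>

lemma integrable_ideal:
  assumes n: "1 \<le> n"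
  shows "integrable lborel2 (weighted n (ideal_weight n))"
proof (rule integrableI_bounded)
  show "weighted n (ideal_weight n) \<in> borel_measurable lborel2" by measurable
  define g where "g u = poly_envelope a b u * u ^ (k - 1) * exp (- (c * u)) * u powr 0" for u
  have [measurable]: "g \<in> borel_measurable borel" unfolding g_def by measurable
  have "(\<integral>\<^sup>+z. ennreal (norm (weighted n (ideal_weight n) z)) \<partial>lborel2)
     = (\<integral>\<^sup>+h. (\<integral>\<^sup>+x. ennreal (norm (weighted n (ideal_weight n) (x, h))) \<partial>lborel) \<partial>lborel)"
    by (rule lborel_pair.nn_integral_snd[symmetric]) measurable
  also have "\<dots> \<le> (\<integral>\<^sup>+h. ennreal (A * real n * B ^ k) * ennreal (g (real n * radial_volume (h :: 'a))) \<partial>lborel)"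
  proof (rule nn_integral_mono_AE)
    have "(\<integral>\<^sup>+x. ennreal (norm (weighted n (ideal_weight n) (x, h))) \<partial>lborel)
        \<le> ennreal (A * real n * B ^ k) * ennreal (g (real n * radial_volume h))" if h: "h \<noteq> 0" for h :: 'a
    proof -
      define u where "u = real n * radial_volume h"
      have u: "0 < u" using n radial_volume_pos[OF h] by (simp add: u_def)
      have gu: "0 \<le> g u" using u by (simp add: g_def poly_envelope_nonneg)
      have "norm (weighted n (ideal_weight n) (x, h)) \<le> (A * real n * B ^ k * g u) * q x" for x
      proof -
        have "norm (weighted n (ideal_weight n) (x, h)) = \<bar>\<phi> u\<bar> * ideal_weight n x h"
          using ideal_weight_nonneg[of n x h] by (simp add: weighted_def u_def abs_mult)
        also have "\<dots> \<le> (A * poly_envelope a b u) * (real n * B ^ k * (u ^ (k - 1) * exp (- (c * u))) * q x)"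
          using \<phi>_bound[OF u] ideal_weight_le[OF u_def] ideal_weight_nonneg[of n x h] A
          by (intro mult_mono) (auto simp: poly_envelope_nonneg)
        also have "\<dots> = (A * real n * B ^ k * g u) * q x" using u by (simp add: g_def)
        finally show ?thesis .
      qed
      then have "(\<integral>\<^sup>+x. ennreal (norm (weighted n (ideal_weight n) (x, h))) \<partial>lborel)
          \<le> (\<integral>\<^sup>+x. ennreal (A * real n * B ^ k * g u) * ennreal (q x) \<partial>lborel)"
        using A B_pos gu q_bounds by (intro nn_integral_mono) (simp add: ennreal_mult[symmetric] ennreal_leI)
      also have "\<dots> = ennreal (A * real n * B ^ k * g u)" by (simp add: nn_integral_cmult q_prob)
      also have "\<dots> = ennreal (A * real n * B ^ k) * ennreal (g u)"
        using A B_pos gu by (intro ennreal_mult) auto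
      finally show ?thesis by (simp add: u_def)
    qed
    then show "AE h in lborel. (\<integral>\<^sup>+x. ennreal (norm (weighted n (ideal_weight n) (x, h))) \<partial>lborel)
        \<le> ennreal (A * real n * B ^ k) * ennreal (g (real n * radial_volume (h :: 'a)))"
      using AE_nonzero by auto
  qed
  also have "\<dots> = ennreal (A * real n * B ^ k) * (\<integral>\<^sup>+h. ennreal (g (real n * radial_volume (h :: 'a))) \<partial>lborel)"
    by (rule nn_integral_cmult) measurable
  also have "(\<integral>\<^sup>+h. ennreal (g (real n * radial_volume (h :: 'a))) \<partial>lborel)
      = ennreal (1 / real n) * (\<integral>\<^sup>+u. ennreal (g u) * indicator {0<..} u \<partial>lborel)"
    using nn_integral_radial[where 'a = 'a, of "\<lambda>u. ennreal (g u)" "real n"] n by simp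
  also have "ennreal (A * real n * B ^ k) * (ennreal (1 / real n) * (\<integral>\<^sup>+u. ennreal (g u) * indicator {0<..} u \<partial>lborel)) < \<infinity>"
    using envelope_weight_finite[of 0 c] c by (simp add: g_def ennreal_mult_less_top)
  finally show "(\<integral>\<^sup>+z. ennreal (norm (weighted n (ideal_weight n) z)) \<partial>lborel2) < \<infinity>" .
qed

lemma knn_bias_bound:
  obtains K where "\<And>n. k \<le> n \<Longrightarrow> integrable lborel2 (weighted n (knn_weight k n))"
    "\<And>n. k \<le> n \<Longrightarrow> \<bar>(\<integral>z. weighted n (knn_weight k n) z \<partial>lborel2) - (\<integral>z. weighted n (ideal_weight n) z \<partial>lborel2)\<bar>
      \<le> K * real n powr (- \<tau> / real DIM('a))"
proof -
  obtain K where K: "\<And>n. k \<le> n \<Longrightarrow>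
    (\<integral>\<^sup>+z. ennreal \<bar>weighted n (knn_weight k n) z - weighted n (ideal_weight n) z\<bar> \<partial>lborel2)
      \<le> ennreal (K * real n powr (- \<tau> / real DIM('a)))"
    using bias_nn_integral by blast
  have d: "integrable lborel2 (\<lambda>z. weighted n (knn_weight k n) z - weighted n (ideal_weight n) z)"
    if n: "k \<le> n" for n
  proof (rule integrableI_bounded)
    show "(\<integral>\<^sup>+z. ennreal (norm (weighted n (knn_weight k n) z - weighted n (ideal_weight n) z)) \<partial>lborel2) < \<infinity>"
      using K[OF n] by (simp add: order.strict_trans1)
  qed measurable
  have i: "integrable lborel2 (weighted n (knn_weight k n))" if n: "k \<le> n" for n
    using Bochner_Integration.integrable_add[OF d[OF n] integrable_ideal[of n]] n k by simp
  have "\<bar>(\<integral>z. weighted n (knn_weight k n) z \<partial>lborel2) - (\<integral>z. weighted n (ideal_weight n) z \<partial>lborel2)\<bar>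
      \<le> max K 0 * real n powr (- \<tau> / real DIM('a))" if n: "k \<le> n" for n
  proof -
    let ?D = "\<lambda>z. weighted n (knn_weight k n) z - weighted n (ideal_weight n) z"
    have "ennreal \<bar>\<integral>z. ?D z \<partial>lborel2\<bar> \<le> (\<integral>\<^sup>+z. ennreal \<bar>?D z\<bar> \<partial>lborel2)"
      using integral_norm_bound_ennreal[OF d[OF n]] by simp
    also have "\<dots> \<le> ennreal (K * real n powr (- \<tau> / real DIM('a)))" by (rule K[OF n])
    also have "\<dots> \<le> ennreal (max K 0 * real n powr (- \<tau> / real DIM('a)))"
      by (intro ennreal_leI mult_right_mono) auto
    finally have "\<bar>\<integral>z. ?D z \<partial>lborel2\<bar> \<le> max K 0 * real n powr (- \<tau> / real DIM('a))"
      by (subst (asm) ennreal_le_iff) auto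
    then show ?thesis
      using i[OF n] integrable_ideal[of n] n k by simp
  qed
  then show ?thesis using that i by blast
qed

text \<open>For fixed \<open>x\<close> the inner integral is the Laplace transform in the definition of an estimator
  function, taken at \<open>q x\<close>.\<close>

lemma ideal_value:
  assumes est: "estimator_function f k \<phi>" and n: "1 \<le> n"
  shows "integrable lborel (\<lambda>x. f (q x) * q x)"
    and "(\<integral>z. weighted n (ideal_weight n) z \<partial>lborel2) = (\<integral>x. f (q x) * q x \<partial>lborel)"
proof -
  have inner: "(\<integral>h. weighted n (ideal_weight n) (x, h) \<partial>lborel) = f (q x) * q x" for x
  proof (cases "q x = 0")
    case True
    have "weighted n (ideal_weight n) (x, h) = 0" for h
      unfolding weighted_def ideal_weight_def fst_conv True by simp
    then show ?thesis using True by simp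
  next
    case False
    then have s: "0 < q x" using q_bounds[of x] by simp
    define G where "G u = u ^ (k - 1) * \<phi> u * exp (- q x * u)" for u
    have ind: "(\<lambda>u. indicator {0<..} u *\<^sub>R (u ^ (k - 1) * \<phi> u * exp (- q x * u))) = G"
      by (auto simp: G_def indicator_def \<phi>_zero fun_eq_iff)
    have "set_integrable lborel {0<..} (\<lambda>u. u ^ (k - 1) * \<phi> u * exp (- q x * u))"
      "(LBINT u:{0<..}. u ^ (k - 1) * \<phi> u * exp (- q x * u)) = Gamma (real k) * f (q x) / q x ^ k"
      using est s unfolding estimator_function_def by blast+
    then have G: "integrable lborel G" "(\<integral>u. G u \<partial>lborel) = Gamma (real k) * f (q x) / q x ^ k"
      unfolding set_integrable_def set_lebesgue_integral_def ind by (simp_all only:)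
    have "(\<integral>h. weighted n (ideal_weight n) (x, h) \<partial>lborel)
      = (\<integral>h. (real n * q x ^ (k + 1) / fact (k - 1)) * G (real n * radial_volume (h :: 'a)) \<partial>lborel)"
    proof (rule Bochner_Integration.integral_cong[OF refl])
      fix h :: 'a
      define u where "u = real n * radial_volume h"
      have kk: "q x ^ k = q x * q x ^ (k - 1)" using k by (cases k) simp_all
      show "weighted n (ideal_weight n) (x, h) = (real n * q x ^ (k + 1) / fact (k - 1)) * G (real n * radial_volume h)"
        unfolding weighted_def ideal_weight_def poisson_kernel_def G_def snd_conv fst_conv u_def[symmetric]
        by (simp add: power_mult_distrib kk)
    qed
    also have "\<dots> = (real n * q x ^ (k + 1) / fact (k - 1)) * ((\<integral>u. G u \<partial>lborel) / real n)"
      using integral_radial(2)[where 'a = 'a, OF G(1)] n by (simp add: G_def \<phi>_zero)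
    also have "\<dots> = q x ^ (k + 1) / fact (k - 1) * (Gamma (real k) * f (q x) / q x ^ k)"
      using n by (simp add: G(2))
    also have "Gamma (real k) = fact (k - 1)"
      using Gamma_fact[of "k - 1", where 'a = real] k by (simp add: of_nat_diff)
    also have "q x ^ (k + 1) / fact (k - 1) * (fact (k - 1) * f (q x) / q x ^ k) = f (q x) * q x"
      using s by simp
    finally show ?thesis .
  qed
  show "integrable lborel (\<lambda>x. f (q x) * q x)"
    using lborel_pair.integrable_fst'[OF integrable_ideal[OF n]] by (simp add: inner)
  show "(\<integral>z. weighted n (ideal_weight n) z \<partial>lborel2) = (\<integral>x. f (q x) * q x \<partial>lborel)"
    using lborel_pair.integral_fst'[OF integrable_ideal[OF n]] by (simp add: inner)
qed

end

section \<open>The law of the nearest neighbor distance\<close>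

lemma sorted_nth_le_iff:
  fixes xs :: "real list"
  assumes "sorted xs" "j < length xs"
  shows "xs ! j \<le> t \<longleftrightarrow> j < card {i. i < length xs \<and> xs ! i \<le> t}"
proof
  assume "xs ! j \<le> t"
  then have "{..j} \<subseteq> {i. i < length xs \<and> xs ! i \<le> t}"
    using assms by (auto intro: order_trans[OF sorted_nth_mono])
  then have "card {..j} \<le> card {i. i < length xs \<and> xs ! i \<le> t}" by (intro card_mono) auto
  then show "j < card {i. i < length xs \<and> xs ! i \<le> t}" by simp
next
  assume j: "j < card {i. i < length xs \<and> xs ! i \<le> t}"
  show "xs ! j \<le> t"
  proof (rule ccontr)
    assume "\<not> xs ! j \<le> t"
    then have "{i. i < length xs \<and> xs ! i \<le> t} \<subseteq> {..<j}"
      using assms by (auto simp: not_less[symmetric]) (meson order_trans sorted_nth_mono not_less)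
    then have "card {i. i < length xs \<and> xs ! i \<le> t} \<le> card {..<j}" by (intro card_mono) auto
    then show False using j by simp
  qed
qed

lemma nn_dist_le_iff:
  assumes A: "finite A" "1 \<le> k" "k \<le> card A"
  shows "nn_dist k x A \<le> t \<longleftrightarrow> k \<le> card {y \<in> A. dist x y \<le> t}"
proof -
  define xs where "xs = sorted_list_of_multiset (image_mset (dist x) (mset_set A))"
  have len: "length xs = card A"
    by (simp add: xs_def flip: size_mset)
  have "nn_dist k x A \<le> t \<longleftrightarrow> k - 1 < card {i. i < length xs \<and> xs ! i \<le> t}"
    unfolding nn_dist_def xs_def[symmetric]
    by (rule sorted_nth_le_iff) (use A len in \<open>auto simp: xs_def\<close>)
  also have "card {i. i < length xs \<and> xs ! i \<le> t} = length (filter (\<lambda>v. v \<le> t) xs)"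
    by (rule length_filter_conv_card[symmetric])
  also have "\<dots> = size (filter_mset (\<lambda>v. v \<le> t) (mset xs))"
    by (metis mset_filter size_mset)
  also have "\<dots> = size (filter_mset (\<lambda>y. dist x y \<le> t) (mset_set A))"
    by (simp add: xs_def filter_mset_image_mset)
  also have "\<dots> = card {y \<in> A. dist x y \<le> t}"
    using A by simp
  finally show ?thesis using A by linarith
qed

text \<open>If sample points coincide, the list of distances can be too short, and its entry is an unspecified
  value. That value depends only on the number of distinct points, which is what measurability needs.\<close>

lemma nn_dist_overflow:
  assumes A: "finite A" "card A < k"
  shows "nn_dist k x A = ([] :: real list) ! (k - 1 - card A)"
proof -
  define xs where "xs = sorted_list_of_multiset (image_mset (dist x) (mset_set A))"
  have len: "length xs = card A"
    by (simp add: xs_def flip: size_mset)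
  have "xs ! (k - 1) = (xs @ []) ! (k - 1)" by simp
  also have "\<dots> = [] ! (k - 1 - card A)" using A len by (subst nth_append) auto
  finally show ?thesis by (simp add: nn_dist_def xs_def)
qed

lemma nn_dist_mem:
  assumes A: "finite A" "1 \<le> k" "k \<le> card A"
  shows "nn_dist k x A \<in> dist x ` A"
proof -
  define xs where "xs = sorted_list_of_multiset (image_mset (dist x) (mset_set A))"
  have len: "length xs = card A"
    by (simp add: xs_def flip: size_mset)
  have "xs ! (k - 1) \<in> set xs" using A len by (intro nth_mem) auto
  also have "set xs = dist x ` A"
    using A by (simp add: xs_def)
  finally show ?thesis by (simp add: nn_dist_def xs_def)
qed

text \<open>Counting an image by the first index of each value turns it into a sum of measurable indicators.\<close>

lemma card_image_distinct:
  fixes S :: "nat set" and x :: "nat \<Rightarrow> 'a"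
  assumes "finite S"
  shows "card {y \<in> x ` S. P y} = card {l \<in> S. P (x l) \<and> (\<forall>l'\<in>S. l' < l \<longrightarrow> x l' \<noteq> x l)}"
proof (rule bij_betw_same_card[symmetric, where f = x])
  let ?T = "{l \<in> S. P (x l) \<and> (\<forall>l'\<in>S. l' < l \<longrightarrow> x l' \<noteq> x l)}"
  have "inj_on x ?T"
  proof (rule inj_onI)
    fix l l' assume l: "l \<in> ?T" "l' \<in> ?T" "x l = x l'"
    then have "\<not> l < l'" "\<not> l' < l" by auto
    then show "l = l'" by simp
  qed
  moreover have "x ` ?T = {y \<in> x ` S. P y}"
  proof (intro equalityI subsetI)
    fix y assume "y \<in> {y \<in> x ` S. P y}"
    then obtain l0 where l0: "l0 \<in> S" "y = x l0" "P y" by auto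
    define l where "l = (LEAST l. l \<in> S \<and> x l = y)"
    have l: "l \<in> S \<and> x l = y" unfolding l_def by (rule LeastI[of _ l0]) (use l0 in auto)
    have "x l' \<noteq> x l" if "l' \<in> S" "l' < l" for l'
      using not_less_Least[of l' "\<lambda>l. l \<in> S \<and> x l = y"] that l by (auto simp: l_def)
    then have "l \<in> ?T" using l l0 by auto
    then show "y \<in> x ` ?T" using l by blast
  qed auto
  ultimately show "bij_betw x ?T {y \<in> x ` S. P y}" by (simp add: bij_betw_def)
qed

lemma measurable_sum_nat:
  fixes f :: "'i \<Rightarrow> 'w \<Rightarrow> nat"
  assumes "finite S" "\<And>l. l \<in> S \<Longrightarrow> f l \<in> N \<rightarrow>\<^sub>M count_space UNIV"
  shows "(\<lambda>x. \<Sum>l\<in>S. f l x) \<in> N \<rightarrow>\<^sub>M count_space UNIV"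
  using assms
proof (induction S rule: finite_induct)
  case (insert l S)
  have f: "f l \<in> N \<rightarrow>\<^sub>M count_space UNIV" and g: "(\<lambda>x. \<Sum>l\<in>S. f l x) \<in> N \<rightarrow>\<^sub>M count_space UNIV"
    using insert by auto
  have "(\<lambda>x. f l x + (\<Sum>l\<in>S. f l x)) \<in> N \<rightarrow>\<^sub>M count_space UNIV"
    by (rule measurable_compose_countable[OF measurable_compose[OF g] f]) simp
  then show ?case using insert by simp
qed simp

lemma measurable_card_image:
  fixes S :: "nat set" and N :: "(nat \<Rightarrow> 'a::euclidean_space) measure"
  assumes S: "finite S"
    and x: "\<And>l. l \<in> S \<Longrightarrow> (\<lambda>x. x l) \<in> N \<rightarrow>\<^sub>M borel"
    and P: "\<And>l. l \<in> S \<Longrightarrow> Measurable.pred N (\<lambda>x. P x (x l))"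
  shows "(\<lambda>x. card {y \<in> x ` S. P x y}) \<in> N \<rightarrow>\<^sub>M count_space UNIV"
proof -
  have eq: "card {y \<in> x ` S. P x y} = (\<Sum>l\<in>S. if P x (x l) \<and> (\<forall>l'\<in>S. l' < l \<longrightarrow> dist (x l') (x l) \<noteq> 0) then 1 else 0)" for x
    using S by (subst card_image_distinct) (auto simp: sum.If_cases Int_def intro!: arg_cong[where f = card])
  show ?thesis unfolding eq
  proof (rule measurable_sum_nat[OF S])
    fix l assume l: "l \<in> S"
    have [measurable]: "(\<lambda>x. x l) \<in> N \<rightarrow>\<^sub>M borel" using x l by auto
    have first: "Measurable.pred N (\<lambda>x. \<forall>l'\<in>S. l' < l \<longrightarrow> dist (x l') (x l) \<noteq> 0)"
    proof (rule pred_intros_finite[OF S])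
      fix l' assume "l' \<in> S"
      then have [measurable]: "(\<lambda>x. x l') \<in> N \<rightarrow>\<^sub>M borel" by (rule x)
      show "Measurable.pred N (\<lambda>x. l' < l \<longrightarrow> dist (x l') (x l) \<noteq> 0)" by measurable
    qed
    show "(\<lambda>x. if P x (x l) \<and> (\<forall>l'\<in>S. l' < l \<longrightarrow> dist (x l') (x l) \<noteq> 0) then 1 else 0 :: nat) \<in> N \<rightarrow>\<^sub>M count_space UNIV"
    proof (rule measurable_If)
      show "{x \<in> space N. P x (x l) \<and> (\<forall>l'\<in>S. l' < l \<longrightarrow> dist (x l') (x l) \<noteq> 0)} \<in> sets N"
        using sets.sets_Collect_conj[OF predE[OF first] predE[OF P[OF l]]] .
    qed auto
  qed
qed

lemma measurable_nn_dist:
  fixes S :: "nat set" and N :: "(nat \<Rightarrow> 'a::euclidean_space) measure"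
  assumes S: "finite S" and k: "1 \<le> k"
    and x: "\<And>l. l \<in> insert i S \<Longrightarrow> (\<lambda>x. x l) \<in> N \<rightarrow>\<^sub>M borel"
  shows "(\<lambda>x. nn_dist k (x i) (x ` S)) \<in> borel_measurable N"
proof (subst borel_measurable_iff_le, intro allI)
  fix t :: real
  have xi [measurable]: "(\<lambda>x. x i) \<in> N \<rightarrow>\<^sub>M borel" using x by simp
  have [measurable]: "(\<lambda>x. card {y \<in> x ` S. dist (x i) y \<le> t}) \<in> N \<rightarrow>\<^sub>M count_space UNIV"
  proof (rule measurable_card_image[OF S x])
    fix l assume "l \<in> S"
    then have [measurable]: "(\<lambda>x. x l) \<in> N \<rightarrow>\<^sub>M borel" using x by simp
    show "Measurable.pred N (\<lambda>x. dist (x i) (x l) \<le> t)" by measurable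
  qed simp
  have "(\<lambda>x. card {y \<in> x ` S. True}) \<in> N \<rightarrow>\<^sub>M count_space UNIV"
    by (rule measurable_card_image[OF S x]) simp_all
  then have [measurable]: "(\<lambda>x. card (x ` S)) \<in> N \<rightarrow>\<^sub>M count_space UNIV"
    by (simp add: image_def)
  have eq: "nn_dist k (x i) (x ` S) \<le> t \<longleftrightarrow>
     (if k \<le> card (x ` S) then k \<le> card {y \<in> x ` S. dist (x i) y \<le> t}
      else ([] :: real list) ! (k - 1 - card (x ` S)) \<le> t)" for x
    using nn_dist_le_iff[of "x ` S" k "x i" t] nn_dist_overflow[of "x ` S" k "x i"] S k by auto
  then show "{x \<in> space N. nn_dist k (x i) (x ` S) \<le> t} \<in> sets N"
    unfolding eq by measurable
qed

text \<open>In the absence of ties exactly one index has precisely \<open>k - 1\<close> closer competitors.\<close>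

lemma nn_dist_sum_eq:
  fixes h :: "real \<Rightarrow> ennreal" and x :: "nat \<Rightarrow> 'a::euclidean_space"
  assumes S: "finite S" and k: "1 \<le> k" "k \<le> card S"
    and inj: "inj_on (\<lambda>l. dist z (x l)) S"
  shows "h (nn_dist k z (x ` S)) =
    (\<Sum>j\<in>S. h (dist z (x j)) * of_bool (card {l \<in> S - {j}. dist z (x l) < dist z (x j)} = k - 1))"
proof -
  let ?d = "\<lambda>l. dist z (x l)" and ?r = "nn_dist k z (x ` S)"
  have injx: "inj_on x S" using inj by (auto simp: inj_on_def)
  have cx: "card {y \<in> x ` S. dist z y \<le> t} = card {l \<in> S. ?d l \<le> t}" for t
  proof -
    have "{y \<in> x ` S. dist z y \<le> t} = x ` {l \<in> S. ?d l \<le> t}" by auto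
    then show ?thesis using injx by (simp add: card_image inj_on_subset)
  qed
  have cS: "card (x ` S) = card S" using injx by (rule card_image)
  have le: "?r \<le> t \<longleftrightarrow> k \<le> card {l \<in> S. ?d l \<le> t}" for t
    using nn_dist_le_iff[of "x ` S" k z t] S k cS cx by simp
  have "?r \<in> dist z ` x ` S" using nn_dist_mem[of "x ` S" k z] S k cS by simp
  then obtain j0 where j0: "j0 \<in> S" "?r = ?d j0" by auto
  have low: "{l \<in> S - {j}. ?d l < ?d j} = {l \<in> S. ?d l < ?d j}" for j by auto
  have split: "{l \<in> S. ?d l \<le> ?d j} = insert j {l \<in> S. ?d l < ?d j}" if "j \<in> S" for j
    using inj that by (auto simp: inj_on_def less_le)
  have sc: "card {l \<in> S. ?d l \<le> ?d j} = Suc (card {l \<in> S. ?d l < ?d j})" if "j \<in> S" for j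
    unfolding split[OF that] using S by (subst card_insert_disjoint) auto
  have iff: "card {l \<in> S - {j}. ?d l < ?d j} = k - 1 \<longleftrightarrow> j = j0" if j: "j \<in> S" for j
  proof
    assume "j = j0"
    have "k \<le> Suc (card {l \<in> S. ?d l < ?d j0})" using le[of "?d j0"] j0 sc by simp
    moreover have "card {l \<in> S. ?d l < ?d j0} < k"
    proof (cases "{l \<in> S. ?d l < ?d j0} = {}")
      case False
      define t where "t = Max (?d ` {l \<in> S. ?d l < ?d j0})"
      have "t \<in> ?d ` {l \<in> S. ?d l < ?d j0}" unfolding t_def using False S by (intro Max_in) auto
      then have t: "t < ?d j0" by auto
      have "{l \<in> S. ?d l < ?d j0} = {l \<in> S. ?d l \<le> t}"
        using t S by (auto simp: t_def intro!: Max_ge)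
      then show ?thesis using le[of t] t j0 by auto
    next
      case True
      then show ?thesis unfolding True using k by simp
    qed
    ultimately show "card {l \<in> S - {j}. ?d l < ?d j} = k - 1" unfolding low \<open>j = j0\<close> by simp
  next
    assume "card {l \<in> S - {j}. ?d l < ?d j} = k - 1"
    then have "card {l \<in> S. ?d l < ?d j} = k - 1" unfolding low .
    then have j': "card {l \<in> S. ?d l \<le> ?d j} = k" using sc[OF j] k by linarith
    then have "?d j0 \<le> ?d j" using le[of "?d j"] j0 by simp
    moreover have "\<not> ?d j0 < ?d j"
    proof
      assume "?d j0 < ?d j"
      then have "{l \<in> S. ?d l \<le> ?d j0} \<subseteq> {l \<in> S. ?d l \<le> ?d j}"
        "j \<in> {l \<in> S. ?d l \<le> ?d j}" "j \<notin> {l \<in> S. ?d l \<le> ?d j0}" using j by auto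
      then have "{l \<in> S. ?d l \<le> ?d j0} \<subset> {l \<in> S. ?d l \<le> ?d j}" by blast
      then have "card {l \<in> S. ?d l \<le> ?d j0} < card {l \<in> S. ?d l \<le> ?d j}"
        using S by (intro psubset_card_mono) auto
      then have "card {l \<in> S. ?d l \<le> ?d j0} < k" unfolding j' .
      then show False using le[of "?d j0"] j0 by simp
    qed
    ultimately show "j = j0" using inj j j0 by (auto simp: inj_on_def)
  qed
  have "(\<Sum>j\<in>S. h (?d j) * of_bool (card {l \<in> S - {j}. ?d l < ?d j} = k - 1)) = (\<Sum>j\<in>S. if j = j0 then h (?d j) else 0)"
    by (intro sum.cong refl) (simp only: iff, simp)
  also have "\<dots> = h ?r" using S j0 by simp
  finally show ?thesis ..
qed

text \<open>The number of independent sample points that fall into \<open>B\<close> is binomial: the event is the disjoint union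
  over the sets of indices of those points.\<close>

lemma (in prob_space) emeasure_PiM_count:
  assumes R: "finite R" and B: "B \<in> sets M"
  shows "emeasure (Pi\<^sub>M R (\<lambda>_. M)) {x \<in> space (Pi\<^sub>M R (\<lambda>_. M)). card {l \<in> R. x l \<in> B} = j}
    = ennreal (real (card R choose j) * prob B ^ j * (1 - prob B) ^ (card R - j))"
proof -
  have eB: "emeasure M B = ennreal (measure M B)" "emeasure M (space M - B) = ennreal (1 - measure M B)"
    using B by (simp_all add: emeasure_eq_measure prob_compl)
  interpret product_prob_space "\<lambda>_. M" R by unfold_locales
  define F where "F T = Pi\<^sub>E R (\<lambda>l. if l \<in> T then B else space M - B)" for T
  let ?I = "{T. T \<subseteq> R \<and> card T = j}"
  have Fs: "F T \<in> sets (Pi\<^sub>M R (\<lambda>_. M))" for T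
    unfolding F_def using R B by (intro sets_PiM_I_finite) auto
  have eq: "{x \<in> space (Pi\<^sub>M R (\<lambda>_. M)). card {l \<in> R. x l \<in> B} = j} = (\<Union>T\<in>?I. F T)"
  proof (intro equalityI subsetI)
    fix x assume x: "x \<in> {x \<in> space (Pi\<^sub>M R (\<lambda>_. M)). card {l \<in> R. x l \<in> B} = j}"
    then have "x \<in> F {l \<in> R. x l \<in> B}"
      by (auto simp: F_def space_PiM PiE_iff)
    moreover have "{l \<in> R. x l \<in> B} \<in> ?I" using x by auto
    ultimately show "x \<in> (\<Union>T\<in>?I. F T)" by (rule UN_I[rotated])
  next
    fix x assume "x \<in> (\<Union>T\<in>?I. F T)"
    then obtain T where T: "T \<subseteq> R" "card T = j" "x \<in> F T" by auto
    then have "{l \<in> R. x l \<in> B} = T" "x \<in> space (Pi\<^sub>M R (\<lambda>_. M))"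
      using sets.sets_into_space[OF B] by (auto simp: F_def space_PiM PiE_iff split: if_splits)
    then show "x \<in> {x \<in> space (Pi\<^sub>M R (\<lambda>_. M)). card {l \<in> R. x l \<in> B} = j}" using T by simp
  qed
  have disj: "disjoint_family_on F ?I"
    unfolding disjoint_family_on_def
  proof (intro ballI impI)
    fix T T' assume T: "T \<in> ?I" "T' \<in> ?I" "T \<noteq> T'"
    have "T = {l \<in> R. x l \<in> B}" if "x \<in> F T" "T \<subseteq> R" for x T
      using that by (auto simp: F_def PiE_iff split: if_splits)
    then show "F T \<inter> F T' = {}" using T by blast
  qed
  have em: "emeasure (Pi\<^sub>M R (\<lambda>_. M)) (F T) = ennreal (measure M B ^ j * (1 - measure M B) ^ (card R - j))" if "T \<in> ?I" for T
  proof -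
    have "emeasure (Pi\<^sub>M R (\<lambda>_. M)) (F T) = (\<Prod>l\<in>R. emeasure M (if l \<in> T then B else space M - B))"
      unfolding F_def using R B by (intro emeasure_PiM) auto
    also have "\<dots> = (\<Prod>l\<in>R. ennreal (if l \<in> T then measure M B else 1 - measure M B))"
      by (intro prod.cong) (auto simp: eB)
    also have "\<dots> = ennreal (\<Prod>l\<in>R. if l \<in> T then measure M B else 1 - measure M B)"
      by (rule prod_ennreal) auto
    also have "(\<Prod>l\<in>R. if l \<in> T then measure M B else 1 - measure M B) = measure M B ^ card (R \<inter> T) * (1 - measure M B) ^ card (R - T)"
      using R by (simp add: prod.If_cases Diff_eq[symmetric])
    also have "R \<inter> T = T" using that by auto
    also have "card (R - T) = card R - j" using that R finite_subset[of T R] by (auto simp: card_Diff_subset)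
    finally show ?thesis using that by simp
  qed
  have "emeasure (Pi\<^sub>M R (\<lambda>_. M)) (\<Union>T\<in>?I. F T) = (\<Sum>T\<in>?I. emeasure (Pi\<^sub>M R (\<lambda>_. M)) (F T))"
    using R Fs disj by (intro sum_emeasure[symmetric]) auto
  also have "\<dots> = (\<Sum>T\<in>?I. ennreal (measure M B ^ j * (1 - measure M B) ^ (card R - j)))"
    by (intro sum.cong em) auto
  also have "\<dots> = ennreal (real (card R choose j) * measure M B ^ j * (1 - measure M B) ^ (card R - j))"
    using n_subsets[OF R, of j] by (simp add: ennreal_mult ennreal_of_nat_eq_real_of_nat mult.assoc)
  finally show ?thesis unfolding eq .
qed

lemma measurable_card_Collect:
  assumes S: "finite S" and Q: "\<And>l. l \<in> S \<Longrightarrow> Measurable.pred N (Q l)"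
  shows "(\<lambda>x. card {l \<in> S. Q l x}) \<in> N \<rightarrow>\<^sub>M count_space UNIV"
proof -
  have eq: "card {l \<in> S. Q l x} = (\<Sum>l\<in>S. if Q l x then 1 else 0)" for x
    using S by (auto simp: sum.If_cases Int_def)
  show ?thesis unfolding eq
    by (rule measurable_sum_nat[OF S], rule measurable_If) (use Q in \<open>auto simp: pred_def\<close>)
qed

context borel_density
begin

abbreviation "law \<equiv> density lborel (\<lambda>y. ennreal (q y))"

sublocale law: prob_space law by (rule prob_space_q)

sublocale law_prod: product_prob_space "\<lambda>_ :: nat. law" UNIV by unfold_locales

abbreviation "sample J \<equiv> Pi\<^sub>M J (\<lambda>_. law)"

lemma AE_law_dist: "AE y in law. dist z y \<noteq> r"
proof -
  have "emeasure lebesgue (sphere z r) = 0"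
    using negligible_sphere[of z r] by (subst negligible_iff_emeasure0[symmetric]) auto
  then have "emeasure lborel (sphere z r) = 0" by simp
  then have "sphere z r \<in> null_sets lborel" by (intro null_setsI) auto
  then have "AE y in lborel. y \<notin> sphere z r" by (rule AE_not_in)
  then show ?thesis by (subst AE_density) (auto simp: sphere_def)
qed

lemma measurable_law_prod: "measurable (sample J) L = measurable (Pi\<^sub>M J (\<lambda>_. borel)) L"
  by (intro measurable_cong_sets sets_PiM_cong) auto

lemma measurable_coordinate: "l \<in> J \<Longrightarrow> (\<lambda>x. x l) \<in> Pi\<^sub>M J (\<lambda>_. borel) \<rightarrow>\<^sub>M borel"
  by (rule measurable_component_singleton)

text \<open>Given all points but one, a tie confines that point to a sphere, which is a null set.\<close>

lemma AE_no_ties: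
  fixes J :: "nat set"
  assumes J: "finite J" "i \<in> J"
  shows "AE x in sample J. inj_on (\<lambda>l. dist (x i) (x l)) (J - {i})"
proof -
  have "AE x in sample J. dist (x i) (x j) \<noteq> dist (x i) (x l)"
    if jl: "j \<in> J - {i}" "l \<in> J - {i}" "j \<noteq> l" for j l
  proof -
    let ?I = "J - {l}"
    have Jl: "J = insert l ?I" using jl by auto
    define f where "f x = (if dist (x i) (x j) = dist (x i) (x l) then 1 else 0 :: ennreal)" for x :: "nat \<Rightarrow> 'a"
    have mf: "f \<in> borel_measurable (sample J)"
    proof -
      have [measurable]: "(\<lambda>x. x i) \<in> Pi\<^sub>M J (\<lambda>_. borel) \<rightarrow>\<^sub>M borel" "(\<lambda>x. x j) \<in> Pi\<^sub>M J (\<lambda>_. borel) \<rightarrow>\<^sub>M borel"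
        "(\<lambda>x. x l) \<in> Pi\<^sub>M J (\<lambda>_. borel) \<rightarrow>\<^sub>M borel"
        using jl J by (auto intro: measurable_coordinate)
      show ?thesis unfolding f_def measurable_law_prod by measurable
    qed
    have "f \<in> borel_measurable (sample (insert l ?I))" using mf unfolding Jl[symmetric] .
    then have "integral\<^sup>N (sample (insert l ?I)) f = (\<integral>\<^sup>+x. (\<integral>\<^sup>+y. f (x(l := y)) \<partial>law) \<partial>sample ?I)"
      using J by (intro law_prod.product_nn_integral_insert) auto
    then have "integral\<^sup>N (sample J) f = (\<integral>\<^sup>+x. (\<integral>\<^sup>+y. f (x(l := y)) \<partial>law) \<partial>sample ?I)"
      unfolding Jl[symmetric] .
    also have "\<dots> = (\<integral>\<^sup>+x. 0 \<partial>sample ?I)"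
    proof (rule nn_integral_cong)
      fix x :: "nat \<Rightarrow> 'a"
      have "(\<integral>\<^sup>+y. f (x(l := y)) \<partial>law) = (\<integral>\<^sup>+y. 0 \<partial>law)"
        using AE_law_dist[of "x i" "dist (x i) (x j)"] jl
        by (intro nn_integral_cong_AE) (auto simp: f_def)
      then show "(\<integral>\<^sup>+y. f (x(l := y)) \<partial>law) = 0" by simp
    qed
    finally have "integral\<^sup>N (sample J) f = 0" by simp
    then have "AE x in sample J. f x = 0"
      using mf by (simp add: nn_integral_0_iff_AE)
    then show ?thesis by eventually_elim (auto simp: f_def split: if_splits)
  qed
  then have "AE x in sample J. \<forall>j\<in>J - {i}. \<forall>l\<in>J - {i}. j \<noteq> l \<longrightarrow> dist (x i) (x j) \<noteq> dist (x i) (x l)"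
    using J by (intro AE_finite_allI AE_impI) auto
  then show ?thesis by eventually_elim (auto simp: inj_on_def)
qed

lemma measurable_neighbour_term:
  fixes J :: "nat set" and h :: "real \<Rightarrow> ennreal"
  assumes J: "finite J" "i \<in> J" "j \<in> J" and [measurable]: "h \<in> borel_measurable borel"
  shows "(\<lambda>x. h (dist (x i) (x j)) * of_bool (card {l \<in> J - {i} - {j}. dist (x i) (x l) < dist (x i) (x j)} = k))
    \<in> borel_measurable (sample J)"
proof -
  have d: "(\<lambda>x :: nat \<Rightarrow> 'a. dist (x i) (x l)) \<in> borel_measurable (Pi\<^sub>M J (\<lambda>_. borel))" if "l \<in> J" for l
    by (rule borel_measurable_dist[OF measurable_coordinate[OF J(2)] measurable_coordinate[OF that]])
  define N where "N x = card {l \<in> J - {i} - {j}. dist (x i) (x l) < dist (x i) (x j)}" for x :: "nat \<Rightarrow> 'a"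
  have [measurable]: "N \<in> Pi\<^sub>M J (\<lambda>_. borel) \<rightarrow>\<^sub>M count_space UNIV"
    unfolding N_def
    by (intro measurable_card_Collect borel_measurable_pred_less d) (use J in auto)
  define r where "r x = dist (x i) (x j)" for x :: "nat \<Rightarrow> 'a"
  have [measurable]: "r \<in> borel_measurable (Pi\<^sub>M J (\<lambda>_. borel))" using d J unfolding r_def by simp
  have "(\<lambda>x. h (r x) * (if N x = k then 1 else 0)) \<in> borel_measurable (Pi\<^sub>M J (\<lambda>_. borel))"
    by measurable
  then show ?thesis by (simp add: of_bool_def N_def r_def measurable_law_prod)
qed

text \<open>Integrate first over the points other than \<open>x i\<close> and \<open>x j\<close>: given these two, the integrand is the indicator of the
  binomial event for the ball around \<open>x i\<close> with \<open>x j\<close> on its boundary.\<close>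

lemma nn_integral_neighbour_term:
  fixes J :: "nat set" and h :: "real \<Rightarrow> ennreal"
  assumes J: "finite J" "i \<in> J" "j \<in> J" "i \<noteq> j" "card J = n + 1" and k: "1 \<le> k" "k \<le> n"
    and [measurable]: "h \<in> borel_measurable borel"
  shows "(\<integral>\<^sup>+x. h (dist (x i) (x j)) * of_bool (card {l \<in> J - {i} - {j}. dist (x i) (x l) < dist (x i) (x j)} = k - 1)
      \<partial>sample J)
    = (\<integral>\<^sup>+y. (\<integral>\<^sup>+z. h (dist y z) * ennreal (binomial_kernel k n (measure law (ball y (dist y z)))) \<partial>law) \<partial>law)"
proof -
  define f where "f x = h (dist (x i) (x j)) * of_bool (card {l \<in> J - {i} - {j}. dist (x i) (x l) < dist (x i) (x j)} = k - 1)"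
    for x :: "nat \<Rightarrow> 'a"
  define R where "R = J - {i} - {j}"
  have R: "finite R" "i \<notin> R" "j \<notin> R" "J = insert i (insert j R)" using J by (auto simp: R_def)
  have cR: "card R = n - 1" using J R by simp
  have mf: "f \<in> borel_measurable (sample J)"
    unfolding f_def by (rule measurable_neighbour_term) (use J in auto)
  have "integral\<^sup>N (sample J) f
      = (\<integral>\<^sup>+y. (\<integral>\<^sup>+x. f (x(i := y)) \<partial>sample (insert j R)) \<partial>law)"
    using R J mf unfolding R(4) by (intro law_prod.product_nn_integral_insert_rev) auto
  also have "\<dots> = (\<integral>\<^sup>+y. (\<integral>\<^sup>+z. (\<integral>\<^sup>+x. f (x(j := z, i := y)) \<partial>sample R) \<partial>law) \<partial>law)"
  proof (rule nn_integral_cong)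
    fix y :: 'a
    have "(\<lambda>x. x(i := y)) \<in> sample (insert j R) \<rightarrow>\<^sub>M sample J"
      by (rule measurable_fun_upd[where J = "insert j R"]) (use R in auto)
    from measurable_compose[OF this mf]
    show "(\<integral>\<^sup>+x. f (x(i := y)) \<partial>sample (insert j R)) = (\<integral>\<^sup>+z. (\<integral>\<^sup>+x. f (x(j := z, i := y)) \<partial>sample R) \<partial>law)"
      using R by (intro law_prod.product_nn_integral_insert_rev) auto
  qed
  also have "\<dots> = (\<integral>\<^sup>+y. (\<integral>\<^sup>+z. h (dist y z) * ennreal (binomial_kernel k n (measure law (ball y (dist y z)))) \<partial>law) \<partial>law)"
  proof (intro nn_integral_cong)
    fix y z :: 'a
    let ?C = "{x \<in> space (sample R). card {l \<in> R. x l \<in> ball y (dist y z)} = k - 1}"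
    have "{l \<in> R. dist y (if l = i then y else if l = j then z else x l) < dist y z} = {l \<in> R. x l \<in> ball y (dist y z)}" for x
      using R by auto
    then have fx: "f (x(j := z, i := y)) = h (dist y z) * indicator ?C x" if "x \<in> space (sample R)" for x
      using that J(4) by (simp add: f_def R_def[symmetric] indicator_def fun_upd_def)
    have C: "?C \<in> sets (sample R)"
    proof -
      define N where "N x = card {l \<in> R. x l \<in> ball y (dist y z)}" for x
      have [measurable]: "N \<in> sample R \<rightarrow>\<^sub>M count_space UNIV"
        unfolding N_def measurable_law_prod
      proof (rule measurable_card_Collect[OF R(1)])
        fix l assume "l \<in> R"
        then have [measurable]: "(\<lambda>x. x l) \<in> Pi\<^sub>M R (\<lambda>_. borel) \<rightarrow>\<^sub>M borel" by (rule measurable_coordinate)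
        show "Measurable.pred (Pi\<^sub>M R (\<lambda>_. borel)) (\<lambda>x. x l \<in> ball y (dist y z))" by measurable
      qed
      show ?thesis unfolding N_def[symmetric] by measurable
    qed
    have "(\<integral>\<^sup>+x. f (x(j := z, i := y)) \<partial>sample R) = (\<integral>\<^sup>+x. h (dist y z) * indicator ?C x \<partial>sample R)"
      by (intro nn_integral_cong fx)
    also have "\<dots> = h (dist y z) * emeasure (sample R) ?C"
      using C by (rule nn_integral_cmult_indicator)
    also have "emeasure (sample R) ?C = ennreal (binomial_kernel k n (measure law (ball y (dist y z))))"
      using law.emeasure_PiM_count[OF R(1), of "ball y (dist y z)" "k - 1"] k
      by (simp add: cR binomial_kernel_def)
    finally show "(\<integral>\<^sup>+x. f (x(j := z, i := y)) \<partial>sample R) = h (dist y z) * ennreal (binomial_kernel k n (measure law (ball y (dist y z))))" .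
  qed
  finally show ?thesis unfolding f_def .
qed

lemma nn_integral_pair_weight:
  fixes h :: "real \<Rightarrow> ennreal"
  assumes [measurable]: "h \<in> borel_measurable borel"
  shows "of_nat n * (\<integral>\<^sup>+y. (\<integral>\<^sup>+z. h (dist y z) * ennreal (binomial_kernel k n (measure law (ball y (dist y z)))) \<partial>law) \<partial>law)
    = (\<integral>\<^sup>+w. h (norm (snd w)) * ennreal (knn_weight k n (fst w) (snd w)) \<partial>lborel2)"
proof -
  have mass: "measure law (ball y (dist y z)) = ball_mass y (z - y)" for y z
    by (simp add: ball_mass_def dist_norm norm_minus_commute)
  let ?b = "\<lambda>y v. ennreal (binomial_kernel k n (ball_mass y v))"
  have [measurable]: "(\<lambda>v. ?b y v) \<in> borel_measurable borel" for y
    using measurable_compose[OF _ measurable_ball_mass, of "\<lambda>v. (y, v)" borel]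
    unfolding binomial_kernel_def by simp
  have [measurable]: "(\<lambda>w. ?b (fst w) (snd w)) \<in> borel_measurable (borel \<Otimes>\<^sub>M borel)"
    unfolding binomial_kernel_def by measurable
  have [measurable]: "(\<lambda>w. ennreal (knn_weight k n (fst w) (snd w))) \<in> borel_measurable (borel \<Otimes>\<^sub>M borel)"
    by measurable
  have inner: "(\<integral>\<^sup>+z. h (dist y z) * ennreal (binomial_kernel k n (measure law (ball y (dist y z)))) \<partial>law)
      = (\<integral>\<^sup>+v. ennreal (q (y + v)) * (h (norm v) * ?b y v) \<partial>lborel)" for y
  proof -
    have "(\<integral>\<^sup>+z. h (dist y z) * ennreal (binomial_kernel k n (measure law (ball y (dist y z)))) \<partial>law)
        = (\<integral>\<^sup>+z. ennreal (q z) * (h (dist y z) * ?b y (z - y)) \<partial>lborel)"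
      unfolding mass by (subst nn_integral_density) auto
    also have "\<dots> = (\<integral>\<^sup>+v. ennreal (q (v + y)) * (h (dist y (v + y)) * ?b y (v + y - y)) \<partial>lborel)"
      by (rule nn_integral_translate[symmetric]) measurable
    finally show ?thesis by (simp add: dist_norm add.commute)
  qed
  have bin: "0 \<le> binomial_kernel k n (ball_mass y v)" for y v
    by (rule binomial_kernel_nonneg) (rule ball_mass_01)+
  have "(\<integral>\<^sup>+y. (\<integral>\<^sup>+z. h (dist y z) * ennreal (binomial_kernel k n (measure law (ball y (dist y z)))) \<partial>law) \<partial>law)
      = (\<integral>\<^sup>+y. ennreal (q y) * (\<integral>\<^sup>+v. ennreal (q (y + v)) * (h (norm v) * ?b y v) \<partial>lborel) \<partial>lborel)"
    unfolding inner by (subst nn_integral_density) (auto intro!: lborel.borel_measurable_nn_integral)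
  also have "of_nat n * \<dots> = (\<integral>\<^sup>+y. (\<integral>\<^sup>+v. h (norm v) * ennreal (knn_weight k n y v) \<partial>lborel) \<partial>lborel)"
    by (subst nn_integral_cmult[symmetric])
       (auto intro!: lborel.borel_measurable_nn_integral nn_integral_cong
         simp: nn_integral_cmult[symmetric] knn_weight_def ennreal_mult q_nonneg bin ennreal_of_nat_eq_real_of_nat mult_ac)
  also have "\<dots> = (\<integral>\<^sup>+w. h (norm (snd w)) * ennreal (knn_weight k n (fst w) (snd w)) \<partial>lborel2)"
    using lborel.nn_integral_fst[of "\<lambda>w. h (norm (snd w)) * ennreal (knn_weight k n (fst w) (snd w))" lborel] by simp
  finally show ?thesis .
qed

text \<open>The sum over the possible \<open>k\<close>-th neighbors has \<open>n\<close> equal terms, which gives the factor \<open>n\<close> in the weight.\<close>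

lemma distr_nn_dist:
  fixes J :: "nat set"
  assumes J: "finite J" "i \<in> J" "card J = n + 1" and k: "1 \<le> k" "k \<le> n"
  shows "distr (sample J) borel (\<lambda>x. nn_dist k (x i) (x ` (J - {i})))
    = distr (density lborel2 (\<lambda>w. ennreal (knn_weight k n (fst w) (snd w)))) borel (\<lambda>w. norm (snd w))"
proof (rule measure_eqI)
  fix A assume "A \<in> sets (distr (sample J) borel (\<lambda>x. nn_dist k (x i) (x ` (J - {i}))))"
  then have [measurable]: "A \<in> sets borel" by simp
  let ?h = "indicator A :: real \<Rightarrow> ennreal"
  let ?t = "\<lambda>j x. ?h (dist (x i) (x j))
      * of_bool (card {l \<in> J - {i} - {j}. dist (x i) (x l) < dist (x i) (x j)} = k - 1)"
    and ?R = "\<lambda>x. nn_dist k (x i) (x ` (J - {i}))"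
    and ?I = "\<integral>\<^sup>+y. (\<integral>\<^sup>+z. ?h (dist y z) * ennreal (binomial_kernel k n (measure law (ball y (dist y z)))) \<partial>law) \<partial>law"
    and ?N = "density lborel2 (\<lambda>w. ennreal (knn_weight k n (fst w) (snd w)))"
  have [measurable]: "(\<lambda>x. ?R x) \<in> borel_measurable (sample J)"
    unfolding measurable_law_prod
    by (rule measurable_nn_dist) (use J k in \<open>auto intro: measurable_coordinate\<close>)
  have [measurable]: "(\<lambda>w. ennreal (knn_weight k n (fst w) (snd w))) \<in> borel_measurable (borel \<Otimes>\<^sub>M borel)"
    by measurable
  have cJ: "card (J - {i}) = n" using J by simp
  have "emeasure (distr (sample J) borel (\<lambda>x. ?R x)) A
     = (\<integral>\<^sup>+x. ?h (?R x) \<partial>sample J)"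
    by (subst nn_integral_indicator[symmetric], simp, subst nn_integral_distr) auto
  also have "\<dots> = (\<integral>\<^sup>+x. (\<Sum>j\<in>J - {i}. ?t j x) \<partial>sample J)"
  proof (rule nn_integral_cong_AE)
    show "AE x in sample J. ?h (?R x) = (\<Sum>j\<in>J - {i}. ?t j x)"
      using AE_no_ties[OF J(1,2)]
      by eventually_elim (rule nn_dist_sum_eq, use J k cJ in auto)
  qed
  also have "\<dots> = (\<Sum>j\<in>J - {i}. \<integral>\<^sup>+x. ?t j x \<partial>sample J)"
    by (rule nn_integral_sum) (rule measurable_neighbour_term, use J in auto)
  also have "\<dots> = (\<Sum>j\<in>J - {i}. ?I)"
    by (intro sum.cong refl nn_integral_neighbour_term) (use J k in auto)
  also have "\<dots> = of_nat n * ?I"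
    by (simp add: cJ)
  also have "\<dots> = (\<integral>\<^sup>+w. ?h (norm (snd w)) * ennreal (knn_weight k n (fst w) (snd w)) \<partial>lborel2)"
    by (rule nn_integral_pair_weight) simp
  also have "\<dots> = emeasure (distr (?N) borel (\<lambda>w. norm (snd w))) A"
    by (subst nn_integral_indicator[symmetric], simp, subst nn_integral_distr, simp, simp, subst nn_integral_density)
       (auto simp: mult.commute)
  finally show "emeasure (distr (sample J) borel (\<lambda>x. ?R x)) A
     = emeasure (distr (?N) borel (\<lambda>w. norm (snd w))) A" .
qed simp

end

section \<open>Expectation of one summand of the estimator\<close>

context knn_bias
begin

text \<open>The function \<open>\<psi>\<close> may have any value at \<open>u = 0\<close>: it is reached only when the \<open>k\<close>-th neighbor coincides with the
  point, which happens with probability 0, but measurability is needed there as well.\<close>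

lemma knn_term_expectation:
  fixes X :: "nat \<Rightarrow> 'w \<Rightarrow> 'a" and M :: "'w measure"
  assumes M: "prob_space M" "prob_space.indep_vars M (\<lambda>_. borel) X {1..}"
    and X: "\<And>i. 1 \<le> i \<Longrightarrow> distr M borel (X i) = law"
    and m: "k + 1 \<le> m" and i: "i \<in> {1..m}"
    and \<psi>: "\<And>u. 0 < u \<Longrightarrow> \<psi> u = \<phi> u"
    and int: "integrable lborel2 (weighted (m - 1) (knn_weight k (m - 1)))"
  shows "integrable M (\<lambda>\<omega>. \<psi> (knn_volume k m (\<lambda>i. X i \<omega>) i))"
    and "(\<integral>\<omega>. \<psi> (knn_volume k m (\<lambda>i. X i \<omega>) i) \<partial>M) = (\<integral>w. weighted (m - 1) (knn_weight k (m - 1)) w \<partial>lborel2)"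
proof -
  interpret M: prob_space M by (rule M(1))
  let ?n = "m - 1"
  let ?w = "\<lambda>w. knn_weight k ?n (fst w) (snd w)" and ?V = "weighted ?n (knn_weight k ?n)"
  define J where "J = {1..m}"
  have J: "finite J" "i \<in> J" "card J = ?n + 1" "\<And>l. l \<in> J \<Longrightarrow> 1 \<le> l" "J \<noteq> {}"
    using i m by (auto simp: J_def)
  have n: "1 \<le> ?n" "k \<le> ?n" using m k by auto
  have mX: "X i \<in> M \<rightarrow>\<^sub>M borel" if "1 \<le> i" for i
    using M(2) that unfolding M.indep_vars_def by auto
  define T where "T \<omega> = (\<lambda>i\<in>J. X i \<omega>)" for \<omega>
  have [measurable]: "T \<in> M \<rightarrow>\<^sub>M Pi\<^sub>M J (\<lambda>_. borel)"
    unfolding T_def using J by (intro measurable_restrict mX) auto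
  have "M.indep_vars (\<lambda>_. borel) X J"
    by (rule M.indep_vars_subset[OF M(2)]) (use J in auto)
  then have "distr M (Pi\<^sub>M J (\<lambda>_. borel)) T = Pi\<^sub>M J (\<lambda>i. distr M borel (X i))"
    unfolding T_def using J mX by (subst (asm) M.indep_vars_iff_distr_eq_PiM') auto
  also have "\<dots> = Pi\<^sub>M J (\<lambda>_. law)" using J by (intro PiM_cong) (auto simp: X)
  finally have dT: "distr M (Pi\<^sub>M J (\<lambda>_. borel)) T = Pi\<^sub>M J (\<lambda>_. law)" .
  define R where "R x = nn_dist k (x i) (x ` (J - {i}))" for x :: "nat \<Rightarrow> 'a"
  have [measurable]: "R \<in> borel_measurable (Pi\<^sub>M J (\<lambda>_. borel))"
    unfolding R_def by (rule measurable_nn_dist) (use k J in \<open>auto intro: measurable_coordinate\<close>)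
  have RT: "nn_dist k (X i \<omega>) ((\<lambda>i. X i \<omega>) ` (J - {i})) = R (T \<omega>)" for \<omega>
  proof -
    have "(\<lambda>i. X i \<omega>) ` (J - {i}) = T \<omega> ` (J - {i})" by (intro image_cong) (auto simp: T_def)
    then show ?thesis using J by (simp add: R_def T_def)
  qed
  \<comment> \<open>Agrees with \<open>\<psi>\<close> on the range of the volumes, including 0, and is measurable on the whole line.\<close>
  define \<psi>' where "\<psi>' u = \<phi> u + (if u = 0 then \<psi> 0 else 0)" for u
  have [measurable]: "\<psi>' \<in> borel_measurable borel" unfolding \<psi>'_def by measurable
  define \<Phi> where "\<Phi> r = \<psi>' (real ?n * ball_volume TYPE('a) r)" for r
  have [measurable]: "\<Phi> \<in> borel_measurable borel" unfolding \<Phi>_def ball_volume_def by measurable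
  have eq: "\<psi> (knn_volume k m (\<lambda>i. X i \<omega>) i) = \<Phi> (R (T \<omega>))" for \<omega>
  proof -
    have nn: "0 \<le> real ?n * ball_volume TYPE('a) (R (T \<omega>))" by (simp add: ball_volume_def)
    have "knn_volume k m (\<lambda>i. X i \<omega>) i = real ?n * ball_volume TYPE('a) (R (T \<omega>))"
      using m unfolding knn_volume_def J_def[symmetric] RT measure_ball_volume by (simp add: of_nat_diff)
    then show ?thesis using nn \<psi> \<phi>_zero[of 0] by (auto simp: \<Phi>_def \<psi>'_def less_le)
  qed
  let ?N = "density lborel2 (\<lambda>w. ennreal (?w w))"
  have W0: "0 \<le> knn_weight k n' x h" for n' x h
    unfolding knn_weight_def by (intro mult_nonneg_nonneg q_nonneg binomial_kernel_nonneg ball_mass_01) auto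
  have "distr M borel (\<lambda>\<omega>. R (T \<omega>)) = distr (distr M (Pi\<^sub>M J (\<lambda>_. borel)) T) borel R"
    by (subst distr_distr) (auto simp: comp_def)
  also have "\<dots> = distr ?N borel (\<lambda>w. norm (snd w))"
    unfolding dT R_def by (rule distr_nn_dist) (use J k n in auto)
  finally have law: "distr M borel (\<lambda>\<omega>. R (T \<omega>)) = distr ?N borel (\<lambda>w. norm (snd w))" .
  have ae: "AE w in lborel2. ?w w *\<^sub>R \<Phi> (norm (snd w)) = ?V w"
  proof -
    have "UNIV \<times> {0} \<in> null_sets (lborel \<Otimes>\<^sub>M (lborel :: 'a measure))"
      by (intro null_setsI) (auto simp: lborel.emeasure_pair_measure_Times)
    then have "AE w in (lborel :: 'a measure) \<Otimes>\<^sub>M (lborel :: 'a measure). w \<notin> UNIV \<times> {0}" by (rule AE_not_in)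
    then show ?thesis
    proof eventually_elim
      fix w :: "'a \<times> 'a" assume "w \<notin> UNIV \<times> {0}"
      then have h: "snd w \<noteq> 0" by (cases w) auto
      have bv: "ball_volume TYPE('a) (norm (snd w)) = radial_volume (snd w)"
        by (simp add: ball_volume_def radial_volume_def)
      have "real ?n * radial_volume (snd w) \<noteq> 0" using radial_volume_pos[OF h] n by auto
      then show "?w w *\<^sub>R \<Phi> (norm (snd w)) = ?V w"
        by (simp add: weighted_def \<Phi>_def bv \<psi>'_def)
    qed
  qed
  have i1: "integrable lborel2 (\<lambda>w. ?w w *\<^sub>R \<Phi> (norm (snd w)))"
    using int ae by (subst integrable_cong_AE) (auto intro!: borel_measurable_integrable)
  then have "integrable ?N (\<lambda>w. \<Phi> (norm (snd w)))"
    by (subst integrable_density) (auto simp: W0)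
  then have "integrable (distr M borel (\<lambda>\<omega>. R (T \<omega>))) \<Phi>"
    unfolding law by (subst integrable_distr_eq) auto
  then show "integrable M (\<lambda>\<omega>. \<psi> (knn_volume k m (\<lambda>i. X i \<omega>) i))"
    unfolding eq by (subst (asm) integrable_distr_eq) auto
  have "(\<integral>\<omega>. \<Phi> (R (T \<omega>)) \<partial>M) = (\<integral>r. \<Phi> r \<partial>distr M borel (\<lambda>\<omega>. R (T \<omega>)))"
    by (subst integral_distr) auto
  also have "\<dots> = (\<integral>w. \<Phi> (norm (snd w)) \<partial>?N)"
    unfolding law by (subst integral_distr) auto
  also have "\<dots> = (\<integral>w. ?w w *\<^sub>R \<Phi> (norm (snd w)) \<partial>lborel2)"
    by (subst integral_density) (auto simp: W0)
  also have "\<dots> = (\<integral>w. ?V w \<partial>lborel2)"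
    using i1 int ae by (intro integral_cong_AE) auto
  finally show "(\<integral>\<omega>. \<psi> (knn_volume k m (\<lambda>i. X i \<omega>) i) \<partial>M) = (\<integral>w. ?V w \<partial>lborel2)"
    unfolding eq .
qed

end

section \<open>The support of a density\<close>

lemma closed_supp:
  fixes p :: "'a::euclidean_space \<Rightarrow> real"
  assumes p: "prob_density p"
  shows "closed (supp p)"
proof -
  let ?\<mu> = "density lborel (\<lambda>y. ennreal (p y))"
  interpret prob_space ?\<mu>
    using p by (intro prob_spaceI) (simp add: emeasure_density prob_density_def)
  have "open (- supp p)"
    unfolding open_contains_ball
  proof safe
    fix x assume "x \<notin> supp p"
    then obtain r where r: "r > 0" "measure ?\<mu> (ball x r) = 0"
      using measure_nonneg by (fastforce simp: supp_def not_less intro: antisym)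
    have "y \<notin> supp p" if y: "y \<in> ball x r" for y
    proof -
      have "ball y (r - dist x y) \<subseteq> ball x r"
        by (auto simp: dist_commute) (metis add.commute dist_commute dist_triangle_lt less_diff_eq)
      then have "measure ?\<mu> (ball y (r - dist x y)) \<le> 0"
        using finite_measure_mono[of "ball y (r - dist x y)" "ball x r"] r by simp
      moreover have "r - dist x y > 0" using y by simp
      ultimately show ?thesis unfolding supp_def by (auto simp: not_less intro!: exI[of _ "r - dist x y"])
    qed
    then show "\<exists>e>0. ball x e \<subseteq> - supp p" using r by (auto intro!: exI[of _ r])
  qed
  then show ?thesis by (simp add: closed_open)
qed

text \<open>The complement of the support is a union of open balls without mass; by Lindelof's theorem countably
  many of them suffice.\<close>

lemma AE_supp:
  fixes p :: "'a::euclidean_space \<Rightarrow> real"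
  assumes p: "prob_density p"
  shows "AE x in lborel. x \<notin> supp p \<longrightarrow> p x = 0"
proof -
  let ?\<mu> = "density lborel (\<lambda>y. ennreal (p y))"
  have [measurable]: "p \<in> borel_measurable borel" and p0: "\<And>x. 0 \<le> p x"
    using p by (auto simp: prob_density_def)
  interpret prob_space ?\<mu>
    using p by (intro prob_spaceI) (simp add: emeasure_density prob_density_def)
  define \<F> where "\<F> = {ball x r | x r. 0 < r \<and> measure ?\<mu> (ball x r) = 0}"
  obtain \<G> where \<G>: "\<G> \<subseteq> \<F>" "countable \<G>" "\<Union>\<G> = \<Union>\<F>"
    by (rule Lindelof[of \<F>]) (auto simp: \<F>_def)
  have sub: "- supp p \<subseteq> \<Union>\<F>"
  proof
    fix x assume "x \<in> - supp p"
    then obtain r where r: "r > 0" "measure ?\<mu> (ball x r) = 0"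
      using measure_nonneg by (fastforce simp: supp_def not_less intro: antisym)
    then show "x \<in> \<Union>\<F>" by (auto simp: \<F>_def intro!: exI[of _ "ball x r"])
  qed
  have "U \<in> null_sets ?\<mu>" if "U \<in> \<G>" for U
    using that \<G>(1) by (auto simp: \<F>_def null_sets_def emeasure_eq_measure)
  then have "\<Union>\<G> \<in> null_sets ?\<mu>"
    using null_sets_UN'[OF \<G>(2), of "\<lambda>U. U" ?\<mu>] by simp
  then have "AE x in ?\<mu>. x \<notin> \<Union>\<G>" by (rule AE_not_in)
  then have "AE x in lborel. 0 < ennreal (p x) \<longrightarrow> x \<notin> \<Union>\<G>"
    by (subst (asm) AE_density) auto
  then show ?thesis
  proof eventually_elim
    fix x assume "0 < ennreal (p x) \<longrightarrow> x \<notin> \<Union>\<G>"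
    then show "x \<notin> supp p \<longrightarrow> p x = 0" using sub \<G>(3) p0[of x] by (auto simp: less_le)
  qed
qed

text \<open>Up to the radius \<open>r0\<close> this combines the lower bound of the density with the regularity of the support. For
  larger radii, up to \<open>D\<close>, the ball of radius \<open>r0\<close> already has a fixed share of the volume, at the expense of a
  smaller constant.\<close>

lemma ball_mass_lower_bound:
  fixes p :: "'a::euclidean_space \<Rightarrow> real"
  assumes p: "prob_density p"
    and cp: "0 < cp" "\<And>x. x \<in> supp p \<Longrightarrow> cp \<le> p x"
    and reg: "0 < r0" "0 < (INF x\<in>supp p. INF r'\<in>{0<..r0}.
            measure lborel (ball x r' \<inter> supp p) / measure lborel (ball x r'))"
    and D: "0 < D"
  obtains c where "0 < c" "c \<le> cp"
    "\<And>x (h :: 'a). \<lbrakk>x \<in> supp p; norm h \<le> D\<rbrakk>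
      \<Longrightarrow> c * radial_volume h \<le> measure (density lborel (\<lambda>y. ennreal (p y))) (ball x (norm h))"
proof -
  let ?\<mu> = "density lborel (\<lambda>y. ennreal (p y))"
  have [measurable]: "p \<in> borel_measurable borel" and p0: "\<And>x. 0 \<le> p x"
    using p by (auto simp: prob_density_def)
  interpret P: prob_space ?\<mu>
    using p by (intro prob_spaceI) (simp add: emeasure_density prob_density_def)
  have S [measurable]: "supp p \<in> sets borel" using closed_supp[OF p] by (rule borel_closed)
  let ?ratio = "\<lambda>x r'. measure lborel (ball x r' \<inter> supp p) / measure lborel (ball x r')"
  define \<eta> where "\<eta> = (INF x\<in>supp p. INF r'\<in>{0<..r0}. ?ratio x r')"
  have ratio: "\<eta> \<le> ?ratio x r'" if "x \<in> supp p" "0 < r'" "r' \<le> r0" for x r'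
  proof -
    have "bdd_below (?ratio x ` {0<..r0})" for x
      by (rule bdd_belowI[of _ 0]) auto
    then have inner: "(INF r'\<in>{0<..r0}. ?ratio x r') \<le> ?ratio x r'"
      using that by (intro cINF_lower) auto
    have "0 \<le> (INF r'\<in>{0<..r0}. ?ratio x r')" for x
      using reg by (intro cINF_greatest) auto
    then have "bdd_below ((\<lambda>x. INF r'\<in>{0<..r0}. ?ratio x r') ` supp p)"
      by (intro bdd_belowI[of _ 0]) auto
    then have "\<eta> \<le> (INF r'\<in>{0<..r0}. ?ratio x r')"
      unfolding \<eta>_def using that by (intro cINF_lower) auto
    then show ?thesis using inner by linarith
  qed
  have \<eta>: "0 < \<eta>" using reg by (simp add: \<eta>_def)
  have mass: "cp * \<eta> * ball_volume TYPE('a) r' \<le> P.prob (ball x r')" if x: "x \<in> supp p" and r': "0 < r'" "r' \<le> r0" for x r'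
  proof -
    have bv: "0 < ball_volume TYPE('a) r'" using r' by (simp add: ball_volume_def)
    have "\<eta> \<le> measure lborel (ball x r' \<inter> supp p) / ball_volume TYPE('a) r'"
      using ratio[OF x r'] by (simp add: measure_ball_volume)
    then have "\<eta> * ball_volume TYPE('a) r' \<le> measure lborel (ball x r' \<inter> supp p)"
      using bv by (simp add: pos_le_divide_eq)
    then have 1: "cp * (\<eta> * ball_volume TYPE('a) r') \<le> cp * measure lborel (ball x r' \<inter> supp p)"
      using cp by (intro mult_left_mono) auto
    have fin: "emeasure lborel (ball x r' \<inter> supp p) < \<infinity>"
      by (rule order.strict_trans1[OF emeasure_mono emeasure_lborel_ball_finite[of x r']]) auto
    have "ennreal (cp * measure lborel (ball x r' \<inter> supp p)) = ennreal cp * emeasure lborel (ball x r' \<inter> supp p)"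
      using fin cp by (simp add: ennreal_mult emeasure_eq_ennreal_measure less_top[symmetric])
    also have "\<dots> = (\<integral>\<^sup>+y. ennreal cp * indicator (ball x r' \<inter> supp p) y \<partial>lborel)"
      by (rule nn_integral_cmult_indicator[symmetric]) measurable
    also have "\<dots> \<le> (\<integral>\<^sup>+y. ennreal (p y) * indicator (ball x r') y \<partial>lborel)"
      using cp by (intro nn_integral_mono) (auto simp: indicator_def intro!: ennreal_leI)
    also have "\<dots> = emeasure ?\<mu> (ball x r')" by (subst emeasure_density) auto
    also have "\<dots> = ennreal (P.prob (ball x r'))" by (rule P.emeasure_eq_measure)
    finally have "cp * measure lborel (ball x r' \<inter> supp p) \<le> P.prob (ball x r')"
      by (subst (asm) ennreal_le_iff) auto
    then show ?thesis using 1 by (simp add: mult.assoc)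
  qed
  \<comment> \<open>The minima keep \<open>c\<close> below \<open>cp\<close> and below the constants of both ranges of radii.\<close>
  define c where "c = cp * min 1 (\<eta> * min 1 ((r0 / D) ^ DIM('a)))"
  have s: "0 < (r0 / D) ^ DIM('a)" using reg D by simp
  show ?thesis
  proof (rule that[of c])
    show "0 < c" using cp \<eta> s by (simp add: c_def)
    show "c \<le> cp" using cp by (simp add: c_def mult_left_le)
    fix x h :: 'a
    assume x: "x \<in> supp p" and h: "norm h \<le> D"
    show "c * radial_volume h \<le> P.prob (ball x (norm h))"
    proof (cases "h = 0")
      case True
      then show ?thesis by (simp add: radial_volume_def zero_power)
    next
      case False
      define r' where "r' = min (norm h) r0"
      have r': "0 < r'" "r' \<le> r0" "r' \<le> norm h" using False reg by (auto simp: r'_def)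
      let ?v = "unit_ball_vol (real DIM('a))"
      have v: "0 < ?v" by simp
      have "min 1 ((r0 / D) ^ DIM('a)) * norm h ^ DIM('a) \<le> r' ^ DIM('a)"
      proof (cases "norm h \<le> r0")
        case True
        have "min 1 ((r0 / D) ^ DIM('a)) * norm h ^ DIM('a) \<le> 1 * norm h ^ DIM('a)"
          by (intro mult_right_mono) auto
        then show ?thesis using True by (simp add: r'_def)
      next
        case False
        have "min 1 ((r0 / D) ^ DIM('a)) * norm h ^ DIM('a) \<le> (r0 / D) ^ DIM('a) * D ^ DIM('a)"
          using h D reg by (intro mult_mono power_mono) auto
        also have "\<dots> = r0 ^ DIM('a)" using D by (simp add: power_divide)
        finally show ?thesis using False by (simp add: r'_def)
      qed
      then have "cp * \<eta> * ?v * (min 1 ((r0 / D) ^ DIM('a)) * norm h ^ DIM('a)) \<le> cp * \<eta> * ?v * r' ^ DIM('a)"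
        using cp \<eta> v by (intro mult_left_mono) auto
      also have "\<dots> = cp * \<eta> * ball_volume TYPE('a) r'" using r' by (simp add: ball_volume_def)
      also have "\<dots> \<le> P.prob (ball x r')" by (rule mass[OF x r'(1,2)])
      also have "\<dots> \<le> P.prob (ball x (norm h))"
        using r' by (intro P.finite_measure_mono) auto
      finally have "cp * (\<eta> * min 1 ((r0 / D) ^ DIM('a))) * radial_volume h \<le> P.prob (ball x (norm h))"
        by (simp add: radial_volume_def mult_ac)
      moreover have "c * radial_volume h \<le> cp * (\<eta> * min 1 ((r0 / D) ^ DIM('a))) * radial_volume h"
        unfolding c_def using cp radial_volume_nonneg[of h] by (intro mult_right_mono mult_left_mono) auto
      ultimately show ?thesis by linarith
    qed
  qed
qed

section \<open>Estimator functions and rates\<close>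

text \<open>The transform at \<open>s = 1\<close> is integrable, hence its integrand is measurable, and the known factors can
  be divided out.\<close>

lemma estimator_function_positive_part:
  assumes "estimator_function f k \<phi>"
  shows "estimator_function f k (\<lambda>u. indicator {0<..} u * \<phi> u)"
    and "(\<lambda>u. indicator {0<..} u * \<phi> u) \<in> borel_measurable borel"
proof -
  have eq: "(\<lambda>u. indicator {0<..} u *\<^sub>R (u ^ (k - 1) * (indicator {0<..} u * \<phi> u) * exp (- s * u)))
      = (\<lambda>u::real. indicator {0<..} u *\<^sub>R (u ^ (k - 1) * \<phi> u * exp (- s * u)))" for s
    by (auto simp: indicator_def fun_eq_iff)
  show "estimator_function f k (\<lambda>u. indicator {0<..} u * \<phi> u)"
    using assms unfolding estimator_function_def set_integrable_def set_lebesgue_integral_def eq .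
  have "set_integrable lborel {0<..} (\<lambda>u. u ^ (k - 1) * \<phi> u * exp (- 1 * u))"
    using assms unfolding estimator_function_def using zero_less_one by blast
  then have [measurable]: "(\<lambda>u. indicator {0<..} u *\<^sub>R (u ^ (k - 1) * \<phi> u * exp (- 1 * u))) \<in> borel_measurable borel"
    unfolding set_integrable_def by (auto dest: borel_measurable_integrable)
  have "(\<lambda>u. indicator {0<..} u * \<phi> u)
      = (\<lambda>u. (indicator {0<..} u *\<^sub>R (u ^ (k - 1) * \<phi> u * exp (- 1 * u))) * (exp u / u ^ (k - 1)))"
    by (auto simp: indicator_def fun_eq_iff exp_minus)
  also have "\<dots> \<in> borel_measurable borel" by measurable
  finally show "(\<lambda>u. indicator {0<..} u * \<phi> u) \<in> borel_measurable borel" .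
qed

text \<open>The function \<open>f\<close> need not be measurable at \<open>s \<le> 0\<close>, but for positive arguments it is given by a
  parameter integral.\<close>

lemma estimator_function_imp_measurable:
  assumes est: "estimator_function f k \<phi>" and [measurable]: "\<phi> \<in> borel_measurable borel" and k: "1 \<le> k"
  obtains F where "F \<in> borel_measurable borel" "\<And>s. 0 < s \<Longrightarrow> f s = F s"
proof
  let ?F = "\<lambda>s. s ^ k / Gamma (real k) * (\<integral>u. indicator {0<..} u * (u ^ (k - 1) * \<phi> u * exp (- s * u)) \<partial>lborel)"
  show "?F \<in> borel_measurable borel" by measurable
  show "f s = ?F s" if "0 < s" for s
  proof -
    have "(LBINT u:{0<..}. u ^ (k - 1) * \<phi> u * exp (- s * u)) = Gamma (real k) * f s / s ^ k"
      using est that unfolding estimator_function_def by blast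
    moreover have "0 < Gamma (real k)" using k by (intro Gamma_real_pos) auto
    ultimately show ?thesis using that by (simp add: set_lebesgue_integral_def)
  qed
qed

text \<open>In the first two cases \<open>a \<le> - 1\<close>, which forces \<open>k \<ge> 2\<close> and \<open>0 < (k + a) / (k - 1) \<le> 1\<close>.\<close>

lemma rate_exponent_bounds:
  assumes "0 < \<sigma>" "1 \<le> k" "- a < real k" "1 \<le> d"
  shows "0 < rate_exponent d \<sigma> a k" "rate_exponent d \<sigma> a k \<le> min \<sigma> 1 / real d"
proof -
  have d: "0 < 1 / real d" using assms by simp
  have r: "0 < (real k + a) / (real k - 1)" "(real k + a) / (real k - 1) \<le> 1" if "a \<le> - 1"
    using that assms by (simp_all add: divide_le_eq_1)
  have s: "0 < \<sigma> / real d" using assms by simp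
  consider "a \<le> - \<sigma> / real d - 1" | "- \<sigma> / real d - 1 < a" "a \<le> - 1" | "- 1 < a" by linarith
  then have "0 < rate_exponent d \<sigma> a k \<and> rate_exponent d \<sigma> a k \<le> 1 / real d * min \<sigma> 1"
  proof cases
    case 1
    then have "a \<le> - 1" using s by simp
    note r = r[OF this]
    have "1 / real d * min \<sigma> 1 * ((real k + a) / (real k - 1)) \<le> 1 / real d * min \<sigma> 1 * 1"
      using r d assms by (intro mult_left_mono) auto
    moreover have "0 < 1 / real d * min \<sigma> 1 * ((real k + a) / (real k - 1))"
      using r d assms by (intro mult_pos_pos) auto
    ultimately show ?thesis using 1 by (simp add: rate_exponent_def)
  next
    case 2
    note r = r[OF 2(2)]
    have "1 / real d * min \<sigma> ((real k + a) / (real k - 1)) \<le> 1 / real d * min \<sigma> 1"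
      using r d by (intro mult_left_mono min.mono) auto
    moreover have "0 < 1 / real d * min \<sigma> ((real k + a) / (real k - 1))"
      using r d assms by (intro mult_pos_pos) auto
    ultimately show ?thesis using 2 by (simp add: rate_exponent_def)
  next
    case 3
    then have "\<not> a \<le> - \<sigma> / real d - 1" using s by simp
    then show ?thesis using 3 d assms by (simp add: rate_exponent_def)
  qed
  then show "0 < rate_exponent d \<sigma> a k" "rate_exponent d \<sigma> a k \<le> min \<sigma> 1 / real d" by simp_all
qed

text \<open>The exponent 0 of the logarithm suffices; its base does not vanish for \<open>m \<ge> 2\<close>.\<close>

lemma soft_O_powr:
  fixes F :: "nat \<Rightarrow> real"
  assumes F: "\<And>m. k + 1 \<le> m \<Longrightarrow> \<bar>F m\<bar> \<le> K * real (m - 1) powr (- \<beta>)"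
    and \<lambda>: "0 < l" "l \<le> \<beta>" and k: "1 \<le> k"
  shows "soft_O F (\<lambda>m. real m powr (- l))"
  unfolding soft_O_def
proof (rule exI[of _ 0], rule bigoI[of _ "max K 0 * 2 powr \<beta>"])
  show "\<forall>\<^sub>F m in sequentially. norm (F m)
      \<le> max K 0 * 2 powr \<beta> * norm (real m powr (- l) * \<bar>ln (real m powr (- l))\<bar> powr 0)"
    using eventually_ge_at_top[of "k + 1"]
  proof eventually_elim
    fix m assume m: "k + 1 \<le> m"
    then have m2: "2 \<le> real m" using k by simp
    have l0: "\<bar>ln (real m powr (- l))\<bar> powr 0 = 1" using m2 \<lambda> by (simp add: ln_powr)
    have "\<bar>F m\<bar> \<le> K * real (m - 1) powr (- \<beta>)" by (rule F[OF m])
    also have "\<dots> \<le> max K 0 * (real m / 2) powr (- \<beta>)"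
      using m m2 \<lambda> by (intro mult_mono powr_mono2') (auto simp: of_nat_diff)
    also have "(real m / 2) powr (- \<beta>) = 2 powr \<beta> * real m powr (- \<beta>)"
      using m2 by (simp add: powr_divide powr_minus field_simps)
    also have "max K 0 * (2 powr \<beta> * real m powr (- \<beta>)) \<le> max K 0 * (2 powr \<beta> * real m powr (- l))"
      using m2 \<lambda> by (intro mult_left_mono powr_mono) auto
    finally show "norm (F m) \<le> max K 0 * 2 powr \<beta> * norm (real m powr (- l) * \<bar>ln (real m powr (- l))\<bar> powr 0)"
      unfolding l0 by simp
  qed
qed

section \<open>The bias of the estimator\<close>

theorem mainTheorem4:
  fixes p :: "'a::euclidean_space \<Rightarrow> real"
    and f \<phi> :: "real \<Rightarrow> real"
    and a b \<sigma> :: real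
    and k :: nat
    and M :: "'w measure"
    and X :: "nat \<Rightarrow> 'w \<Rightarrow> 'a"
  assumes "prob_density p"
    and "1 \<le> k" and "real k > - a"
    and "estimator_function f k \<phi>"
    and "\<exists>C. \<forall>u>0. \<bar>\<phi> u\<bar> \<le> C * poly_envelope a b u"
    and "\<exists>Cp>0. AE x in lborel. p x \<le> Cp"
    and "\<exists>cp>0. \<forall>x\<in>supp p. cp \<le> p x"
    and "bounded (supp p)"
    and "\<exists>r>0. (INF x\<in>supp p. INF r'\<in>{0<..r}.
            measure lborel (ball x r' \<inter> supp p) / measure lborel (ball x r')) > 0"
    and "0 < \<sigma>" and "\<sigma> \<le> 2"
    and "hoelder_continuous \<sigma> p (interior (supp p))"
    and "hausdorff_measure (DIM('a) - 1) (frontier (supp p)) < \<infinity>"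
    and "prob_space M"
    and "prob_space.indep_vars M (\<lambda>_. borel) X {1..}"
    and "\<And>i. 1 \<le> i \<Longrightarrow> distributed M lborel (X i) (\<lambda>x. ennreal (p x))"
  shows "integrable lborel (\<lambda>x. f (p x) * p x)
    \<and> (\<forall>m\<ge>k + 1. integrable M (\<lambda>\<omega>. knn_estimator \<phi> k m (\<lambda>i. X i \<omega>)))
    \<and> soft_O
        (\<lambda>m. \<bar>prob_space.expectation M (\<lambda>\<omega>. knn_estimator \<phi> k m (\<lambda>i. X i \<omega>)) - T_functional f p\<bar>)
        (\<lambda>m. real m powr (- rate_exponent DIM('a) \<sigma> a k))"
proof -
  note p = assms(1) and k = assms(2,3) and est = assms(4) and \<sigma> = assms(10,11)
  let ?\<Omega> = "supp p" and ?\<tau> = "min \<sigma> 1" and ?d = "real DIM('a)"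
  let ?\<phi> = "\<lambda>u. indicator {0<..} u * \<phi> u"
  have [measurable]: "p \<in> borel_measurable borel" and p0: "\<And>x. 0 \<le> p x"
    and p1: "(\<integral>\<^sup>+x. ennreal (p x) \<partial>lborel) = 1"
    using p by (auto simp: prob_density_def)
  obtain C0 where C0: "\<And>u. 0 < u \<Longrightarrow> \<bar>\<phi> u\<bar> \<le> C0 * poly_envelope a b u" using assms(5) by blast
  obtain B0 where B0: "0 < B0" "AE x in lborel. p x \<le> B0" using assms(6) by blast
  obtain cp where cp: "0 < cp" "\<And>x. x \<in> ?\<Omega> \<Longrightarrow> cp \<le> p x" using assms(7) by blast
  obtain r0 where r0: "0 < r0" "0 < (INF x\<in>?\<Omega>. INF r'\<in>{0<..r0}.
            measure lborel (ball x r' \<inter> ?\<Omega>) / measure lborel (ball x r'))" using assms(9) by blast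
  have cl: "closed ?\<Omega>" by (rule closed_supp[OF p])
  then have \<Omega>: "compact ?\<Omega>" using assms(8) by (simp add: compact_eq_bounded_closed)
  have [measurable]: "?\<Omega> \<in> sets borel" using cl by (rule borel_closed)
  \<comment> \<open>One is added to have \<open>D > 0\<close> also when the support is a single point.\<close>
  define D where "D = diameter ?\<Omega> + 1"
  have D: "0 < D" using diameter_ge_0[OF assms(8)] by (simp add: D_def)
  define B where "B = max B0 cp"
  have B: "0 < B" "AE x in lborel. p x \<le> B"
    using B0 by (auto simp: B_def elim: eventually_mono)
  obtain c where c: "0 < c" "c \<le> cp" and mass: "\<And>x (h :: 'a). \<lbrakk>x \<in> ?\<Omega>; norm h \<le> D\<rbrakk>
      \<Longrightarrow> c * radial_volume h \<le> measure (density lborel (\<lambda>y. ennreal (p y))) (ball x (norm h))"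
    using ball_mass_lower_bound[OF p cp r0 D] by blast
  \<comment> \<open>A version of the density that satisfies the bounds at every point. Truncation by \<open>B\<close> does not increase differences, so the Hoelder condition survives.\<close>
  define q where "q x = (if x \<in> ?\<Omega> then min (p x) B else 0)" for x
  have [measurable]: "q \<in> borel_measurable borel" unfolding q_def by measurable
  have qp: "AE x in lborel. q x = p x"
    using AE_supp[OF p] B(2) by eventually_elim (auto simp: q_def)
  have law: "density lborel (\<lambda>y. ennreal (q y)) = density lborel (\<lambda>y. ennreal (p y))"
    using qp by (intro density_cong) (auto elim: eventually_mono)
  have q1: "(\<integral>\<^sup>+x. ennreal (q x) \<partial>lborel) = 1"
  proof -
    have "(\<integral>\<^sup>+x. ennreal (q x) \<partial>lborel) = (\<integral>\<^sup>+x. ennreal (p x) \<partial>lborel)"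
      by (rule nn_integral_cong_AE) (use qp in \<open>auto elim: eventually_mono\<close>)
    then show ?thesis using p1 by simp
  qed
  obtain L where L: "0 \<le> L" and axis: "\<And>x e t. \<lbrakk>e \<in> Basis; 0 < t; \<And>s. \<lbrakk>0 \<le> s; s \<le> t\<rbrakk> \<Longrightarrow> x + s *\<^sub>R e \<in> interior ?\<Omega>\<rbrakk>
       \<Longrightarrow> \<bar>p (x + t *\<^sub>R e) - p x\<bar> \<le> L * t powr ?\<tau>"
    using hoelder_along_axis[OF assms(12) \<sigma>] assms(8) by (metis bounded_interior)
  obtain C where C: "0 \<le> C" and sweep: "\<And>e t. \<lbrakk>e \<in> Basis; 0 < t\<rbrakk>
       \<Longrightarrow> emeasure lborel {x. \<exists>s\<in>{0..t}. x + s *\<^sub>R e \<in> frontier ?\<Omega>} \<le> ennreal (C * t)"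
    using hausdorff_sweep[OF assms(13)] by blast
  interpret H: piecewise_hoelder_density q ?\<Omega> B L C ?\<tau>
  proof
    fix x e :: 'a and t :: real
    assume e: "e \<in> Basis" "0 < t" and seg: "\<And>s. \<lbrakk>0 \<le> s; s \<le> t\<rbrakk> \<Longrightarrow> x + s *\<^sub>R e \<in> interior ?\<Omega>"
    have "x + 0 *\<^sub>R e \<in> ?\<Omega>" "x + t *\<^sub>R e \<in> ?\<Omega>"
      using seg[of 0] seg[of t] e interior_subset[of ?\<Omega>] by auto
    then have "\<bar>q (x + t *\<^sub>R e) - q x\<bar> \<le> \<bar>p (x + t *\<^sub>R e) - p x\<bar>" by (simp add: q_def)
    also have "\<dots> \<le> L * t powr ?\<tau>" by (rule axis[OF e seg])
    finally show "\<bar>q (x + t *\<^sub>R e) - q x\<bar> \<le> L * t powr ?\<tau>" .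
  qed (use \<Omega> p0 B L C \<sigma> sweep in \<open>auto simp: q_def\<close>)
  have qn: "x \<in> ?\<Omega>" if "q x \<noteq> 0" for x using that by (auto simp: q_def split: if_splits)
  interpret K: knn_bias q B D c "?d * H.modulus_const" ?\<tau> a b "max C0 0" k ?\<phi>
  proof
    show "c \<le> B" using c by (simp add: B_def)
    show "c \<le> q x" if "q x \<noteq> 0" for x
      using qn[OF that] cp(2)[of x] c by (auto simp: q_def B_def)
    show "norm h \<le> D" if "q x \<noteq> 0" "q (x + h) \<noteq> 0" for x h
      using diameter_bounded_bound[OF assms(8) qn[OF that(1)] qn[OF that(2)]] by (simp add: D_def dist_norm)
    show "c * radial_volume h \<le> measure (density lborel (\<lambda>y. ennreal (q y))) (ball x (norm h))"
      if "q x \<noteq> 0" "norm h \<le> D" for x h :: 'a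
      unfolding law by (rule mass[OF qn[OF that(1)] that(2)])
    show "\<bar>?\<phi> u\<bar> \<le> max C0 0 * poly_envelope a b u" if "0 < u" for u
    proof -
      have "\<bar>?\<phi> u\<bar> \<le> C0 * poly_envelope a b u" using C0[OF that] that by simp
      also have "\<dots> \<le> max C0 0 * poly_envelope a b u"
        using poly_envelope_nonneg by (intro mult_right_mono) auto
      finally show ?thesis .
    qed
    show "?\<phi> \<in> borel_measurable borel" by (rule estimator_function_positive_part(2)[OF est])
  qed (use q1 c D \<sigma> k H.modulus_const_nonneg H.L1_modulus H.q_bounds in auto)
  obtain K where int: "\<And>n. k \<le> n \<Longrightarrow> integrable (lborel \<Otimes>\<^sub>M lborel) (K.weighted n (K.knn_weight k n))"
    and bias: "\<And>n. k \<le> n \<Longrightarrow> \<bar>(\<integral>z. K.weighted n (K.knn_weight k n) z \<partial>(lborel \<Otimes>\<^sub>M lborel))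
        - (\<integral>z. K.weighted n (K.ideal_weight n) z \<partial>(lborel \<Otimes>\<^sub>M lborel))\<bar> \<le> K * real n powr (- ?\<tau> / ?d)"
    using K.knn_bias_bound by blast
  note est' = estimator_function_positive_part[OF est]
  obtain F where F: "F \<in> borel_measurable borel" "\<And>s. 0 < s \<Longrightarrow> f s = F s"
    using estimator_function_imp_measurable[OF est' k(1)] by blast
  note [measurable] = F(1)
  \<comment> \<open>At \<open>s = 0\<close> the factor \<open>s\<close> removes the unspecified value of \<open>f\<close>.\<close>
  have fF: "f s * s = F s * s" if "0 \<le> s" for s using F(2)[of s] that by (cases "s = 0") auto
  have fp: "(\<lambda>x. f (p x) * p x) \<in> borel_measurable lborel" "(\<lambda>x. f (q x) * q x) \<in> borel_measurable lborel"
    by (simp_all add: fF p0 H.q_bounds)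
  have ae: "AE x in lborel. f (q x) * q x = f (p x) * p x" using qp by eventually_elim simp
  have T1: "integrable lborel (\<lambda>x. f (p x) * p x)"
    using K.ideal_value(1)[OF est'(1), of 1] integrable_cong_AE[OF fp(2,1) ae] by simp
  have T2: "(\<integral>z. K.weighted n (K.ideal_weight n) z \<partial>(lborel \<Otimes>\<^sub>M lborel)) = T_functional f p" if "1 \<le> n" for n
    using K.ideal_value(2)[OF est'(1) that] integral_cong_AE[OF fp(2,1) ae] by (simp add: T_functional_def)
  have X: "distr M borel (X i) = density lborel (\<lambda>y. ennreal (q y))" if "1 \<le> i" for i
  proof -
    have "distr M borel (X i) = distr M lborel (X i)" by (rule distr_cong) auto
    also have "\<dots> = density lborel (\<lambda>y. ennreal (p y))" using assms(16)[OF that] by (simp add: distributed_def)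
    finally show ?thesis unfolding law .
  qed
  interpret M: prob_space M by (rule assms(14))
  let ?E = "\<lambda>m. M.expectation (\<lambda>\<omega>. knn_estimator \<phi> k m (\<lambda>i. X i \<omega>))"
    and ?V = "\<lambda>m. (\<integral>w. K.weighted (m - 1) (K.knn_weight k (m - 1)) w \<partial>(lborel \<Otimes>\<^sub>M lborel))"
    and ?v = "\<lambda>m i \<omega>. \<phi> (knn_volume k m (\<lambda>i. X i \<omega>) i)"
  have est_int: "integrable M (\<lambda>\<omega>. knn_estimator \<phi> k m (\<lambda>i. X i \<omega>))"
    and est_val: "?E m
      = ?V m" if m: "k + 1 \<le> m" for m
  proof -
    have km: "k \<le> m - 1" using m by simp
    note te = K.knn_term_expectation[OF assms(14,15) X m _ _ int[OF km], of _ \<phi>]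
    have i: "integrable M (?v m i)" if "i \<in> {1..m}" for i
      by (rule te(1)) (use that in auto)
    show "integrable M (\<lambda>\<omega>. knn_estimator \<phi> k m (\<lambda>i. X i \<omega>))"
      unfolding knn_estimator_def by (intro integrable_mult_right Bochner_Integration.integrable_sum i)
    have v: "M.expectation (?v m i)
        = ?V m" if "i \<in> {1..m}" for i
      by (rule te(2)) (use that in auto)
    have "?E m
        = 1 / real m * (\<Sum>i=1..m. M.expectation (?v m i))"
      unfolding knn_estimator_def
      by (subst integral_mult_right_zero, subst Bochner_Integration.integral_sum) (use i in auto)
    also have "\<dots> = ?V m"
      using m by (simp only: v cong: sum.cong) simp
    finally show "?E m
      = ?V m" .
  qed
  have d1: "1 \<le> DIM('a)" using DIM_positive[where 'a = 'a] by simp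
  have "soft_O
        (\<lambda>m. \<bar>?E m - T_functional f p\<bar>)
        (\<lambda>m. real m powr (- rate_exponent DIM('a) \<sigma> a k))"
  proof (rule soft_O_powr[where \<beta> = "?\<tau> / ?d" and K = K and k = k])
    fix m assume m: "k + 1 \<le> m"
    then have n: "k \<le> m - 1" "1 \<le> m - 1" using k by auto
    show "\<bar>\<bar>?E m - T_functional f p\<bar>\<bar> \<le> K * real (m - 1) powr (- (?\<tau> / ?d))"
      using bias[OF n(1)] unfolding T2[OF n(2)] est_val[OF m] abs_idempotent minus_divide_left .
  qed (use rate_exponent_bounds[OF \<sigma>(1) k(1) _ d1, of a] k in auto)
  then show ?thesis using T1 est_int by blast
qed

end
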